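(* Let $\alpha,\beta\in\mathbb{C}$ with $\operatorname{Re}(\alpha)\ge0$, $\operatorname{Re}(\beta)>0$, and $m=\lfloor\operatorname{Re}(\alpha)\rfloor+1$. Let $\varphi$ be a non-negative increasing $C^m$ function on $[0,\infty)$ with $\varphi(0)=0$ and $\varphi'>0$. Let $\mathcal{A}(x)=\sum_n a_nx^n$ be analytic on a complex disc $\mathcal{D}(0,R)$, where $R>(b-a)^{\operatorname{Re}(\beta)}$ for the interval $[a,b]$ on which the operators are taken (here $a=0$), and let the analytic function $\overline{\mathcal{A}}(x)=\sum_n\overline a_nx^n$ be defined so that $\mathcal{A}_\Gamma\cdot\overline{\mathcal{A}}_\Gamma=1$. Assume that the function $u$ is such that $u(x)$, ${}^{RL}_{0}I^{m-\alpha}_{\varphi(x)}u(x)$, ${}^{RL}_{0}D^{1}_{\varphi(x)}\,{}^{RL}_{0}I^{m-\alpha}_{\varphi(x)}u(x)$, $\dots$, ${}^{RL}_{0}D^{m}_{\varphi(x)}\,{}^{RL}_{0}I^{m-\alpha}_{\varphi(x)}u(x)$ are continuous on $(0,\infty)$ and of $\varphi$-exponential order, while ${}^{RL}_{0}D^{\alpha}_{\varphi(x)}u(x)$ is piecewise continuous on $[0,\infty)$. Then ${}^{\mathcal{A}_R}_{\;\;0}D^{\alpha,\beta}_{\varphi(x)}u(x)$ has a generalised Laplace transform given by $$\mathcal{L}_\varphi\left\{{}^{\mathcal{A}_R}_{\;\;0}D^{\alpha,\beta}_{\varphi(x)}u(x)\right\}(s)=\sum_{n=0}^\infty\overline a_n\Gamma(\beta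 n-\alpha+m)s^{\alpha-\beta n}\hat u(s)-\sum_{n=0}^{\lfloor\operatorname{Re}\alpha/\operatorname{Re}\beta\rfloor}\ \sum_{i=0}^{\lfloor N_n\rfloor}\overline a_n\Gamma(\beta n-\alpha+m)\,s^{N_n-i}\left({}^{RL}_{0}I^{N_n-i+\beta n-\alpha+1}_{\varphi(x)}u\right)(0),$$ where $N_n\in\mathbb{Z}$ is defined as $N_n=\lfloor\operatorname{Re}(\alpha-\beta n)\rfloor$ for all $n$ such that this quantity is non-negative.
   Context: The function $u$ is a real-valued function on $[0,\infty)$, in $L^1$ with sufficient differentiability properties for the derivative to be defined. The generalised Laplace transform (with respect to $\varphi$) of a function $f$ is $\mathcal{L}_\varphi\{f(x)\}(s)=\hat f(s)=\int_0^\infty e^{-s\varphi(x)}\varphi'(x)f(x)\,dx$, for all $s\in\mathbb{C}$ such that this integral converges. A function $f$ is of $\varphi$-exponential order $c>0$ if there are positive constants $M,X$ with $|f(x)|\le Me^{c\varphi(x)}$ for all $x>X$. Transformed series: $\mathcal{A}_\Gamma(x)=\sum_n a_n\Gamma(\beta n+\alpha)x^n$ and $\overline{\mathcal{A}}_\Gamma(x)=\sum_n\overline a_n\Gamma(\beta n+m-\alpha)x^n$. The coefficients may depend on $\alpha,\beta$. The generalised fractional derivative (Riemann--Liouville sense) with respect to $\varphi$ is $${}^{\mathcal{A}_R}_{\;\;0}D^{\alpha,\beta}_{\varphi(x)}u(x)=\left(\frac{1}{\varphi'(x)}\cdot\frac{d}{dx}\right)^m\int_0^x\varphi'(t)[\varphi(x)-\varphi(t)]^{m-\alpha-1}\,\overline{\mathcal{A}}\big([\varphi(x)-\varphi(t)]^\beta\big)u(t)\,dt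 .$$ Riemann--Liouville operators with respect to $\varphi$: for $\operatorname{Re}(\mu)>0$, ${}^{RL}_{0}I^{\mu}_{\varphi(x)}u(x)=\frac{1}{\Gamma(\mu)}\int_0^x\varphi'(t)[\varphi(x)-\varphi(t)]^{\mu-1}u(t)\,dt$; for $\operatorname{Re}(\mu)\ge0$, ${}^{RL}_{0}D^{\mu}_{\varphi(x)}u=\left(\frac{1}{\varphi'(x)}\frac{d}{dx}\right)^k\,{}^{RL}_{0}I^{k-\mu}_{\varphi(x)}u$ with $k=\lfloor\operatorname{Re}(\mu)\rfloor+1$. For $\operatorname{Re}(\mu)\le0$, ${}^{RL}_{0}I^{\mu}_{\varphi(x)}$ means ${}^{RL}_{0}D^{-\mu}_{\varphi(x)}$.
   Formalization: Added: φ(x)→∞ (false for φ=1−e^{−x}, α=β=1, u=φ); the values (I…u)(0) with ā_n≠0 exist as finite right limits; A_Γ, Ā_Γ have positive radius of convergence; A, Ā are entire. The formula is asserted for all s with Re s large; α=0 is excluded since Γ(0) is undefined. *)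

theory Defs
  imports "HOL-Analysis.Analysis"
begin

text \<open>
  Functions on \<open>[0,\<infinity>)\<close> are total functions on \<^typ>\<open>real\<close> of which only the values on
  \<open>{0..}\<close> are used. The derivative is taken within \<open>{0..}\<close>: it is the one-sided derivative
  at \<open>0\<close> and the ordinary derivative at every \<open>x > 0\<close>.
\<close>

definition dhl :: "(real \<Rightarrow> 'a::real_normed_vector) \<Rightarrow> real \<Rightarrow> 'a" where
  "dhl f x = vector_derivative f (at x within {0..})"

definition C_k_halfline :: "nat \<Rightarrow> (real \<Rightarrow> 'a::real_normed_vector) \<Rightarrow> bool" where
  "C_k_halfline k f \<longleftrightarrow>
     (\<forall>j<k. \<forall>x\<ge>0. (dhl ^^ j) f differentiable (at x within {0..})) \<and>
     (\<forall>j\<le>k. continuous_on {0..} ((dhl ^^ j) f))"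

definition piecewise_continuous_halfline :: "(real \<Rightarrow> 'a::real_normed_vector) \<Rightarrow> bool" where
  "piecewise_continuous_halfline f \<longleftrightarrow>
     (\<forall>b>0. \<exists>S. finite S \<and> continuous_on ({0..b} - S) f \<and>
        (\<forall>x\<in>{0<..b}. \<exists>l. (f \<longlongrightarrow> l) (at_left x)) \<and>
        (\<forall>x\<in>{0..<b}. \<exists>l. (f \<longlongrightarrow> l) (at_right x)))"

definition phi_exponential_order :: "(real \<Rightarrow> real) \<Rightarrow> (real \<Rightarrow> complex) \<Rightarrow> bool" where
  "phi_exponential_order \<phi> f \<longleftrightarrow>
     (\<exists>c>0. \<exists>M>0. \<exists>X>0. \<forall>x>X. cmod (f x) \<le> M * exp (c * \<phi> x))"

text \<open>The generalised Laplace transform. The Henstock-Kurzweil integral over \<open>{0..}\<close>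
  includes conditionally convergent improper integrals.\<close>

definition laplace_integrand ::
    "(real \<Rightarrow> real) \<Rightarrow> (real \<Rightarrow> complex) \<Rightarrow> complex \<Rightarrow> real \<Rightarrow> complex" where
  "laplace_integrand \<phi> f s x = exp (- s * of_real (\<phi> x)) * of_real (dhl \<phi> x) * f x"

definition laplace_converges :: "(real \<Rightarrow> real) \<Rightarrow> (real \<Rightarrow> complex) \<Rightarrow> complex \<Rightarrow> bool" where
  "laplace_converges \<phi> f s \<longleftrightarrow> laplace_integrand \<phi> f s integrable_on {0..}"

definition laplace :: "(real \<Rightarrow> real) \<Rightarrow> (real \<Rightarrow> complex) \<Rightarrow> complex \<Rightarrow> complex" where
  "laplace \<phi> f s = integral {0..} (laplace_integrand \<phi> f s)"

definition dphi :: "(real \<Rightarrow> real) \<Rightarrow> (real \<Rightarrow> complex) \<Rightarrow> real \<Rightarrow> complex" where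
  "dphi \<phi> f x = dhl f x / of_real (dhl \<phi> x)"

text \<open>\<^const>\<open>dphi\<close> is total, so the existence of the iterated derivatives on \<open>(0,\<infinity>)\<close> is
  a separate predicate.\<close>

definition dphi_exists :: "nat \<Rightarrow> (real \<Rightarrow> real) \<Rightarrow> (real \<Rightarrow> complex) \<Rightarrow> bool" where
  "dphi_exists k \<phi> f \<longleftrightarrow> (\<forall>j<k. \<forall>x>0. ((dphi \<phi> ^^ j) f) differentiable (at x))"

text \<open>The fractional integral as an integral (meaningful for \<open>Re \<mu> > 0\<close>). Complex powers
  are those of the positive number \<open>\<phi> x - \<phi> t\<close>, with the principal logarithm.\<close>

definition RL_integral ::
    "(real \<Rightarrow> real) \<Rightarrow> complex \<Rightarrow> (real \<Rightarrow> complex) \<Rightarrow> real \<Rightarrow> complex" where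
  "RL_integral \<phi> \<mu> f x = 1 / Gamma \<mu> *
     integral {0..x} (\<lambda>t. of_real (dhl \<phi> t) * of_real (\<phi> x - \<phi> t) powr (\<mu> - 1) * f t)"

definition RL_deg :: "complex \<Rightarrow> nat" where
  "RL_deg \<mu> = nat (\<lfloor>Re \<mu>\<rfloor> + 1)"

definition RL_D ::
    "(real \<Rightarrow> real) \<Rightarrow> complex \<Rightarrow> (real \<Rightarrow> complex) \<Rightarrow> real \<Rightarrow> complex" where
  "RL_D \<phi> \<mu> f = (dphi \<phi> ^^ RL_deg \<mu>) (RL_integral \<phi> (of_nat (RL_deg \<mu>) - \<mu>) f)"

definition RL_D_exists :: "(real \<Rightarrow> real) \<Rightarrow> complex \<Rightarrow> (real \<Rightarrow> complex) \<Rightarrow> bool" where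
  "RL_D_exists \<phi> \<mu> f \<longleftrightarrow>
     dphi_exists (RL_deg \<mu>) \<phi> (RL_integral \<phi> (of_nat (RL_deg \<mu>) - \<mu>) f)"

definition RL_I ::
    "(real \<Rightarrow> real) \<Rightarrow> complex \<Rightarrow> (real \<Rightarrow> complex) \<Rightarrow> real \<Rightarrow> complex" where
  "RL_I \<phi> \<mu> f = (if Re \<mu> > 0 then RL_integral \<phi> \<mu> f else RL_D \<phi> (- \<mu>) f)"

definition power_series :: "(nat \<Rightarrow> complex) \<Rightarrow> complex \<Rightarrow> complex" where
  "power_series c z = (\<Sum>n. c n * z ^ n)"

text \<open>Coefficients of the transformed series: \<open>\<A>\<^sub>\<Gamma>\<close> is the case \<open>\<gamma> = \<alpha>\<close>, and the
  transform of \<open>\<A>\<close>-bar is the case \<open>\<gamma> = m - \<alpha>\<close>.\<close>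

definition Gamma_coeff :: "complex \<Rightarrow> complex \<Rightarrow> (nat \<Rightarrow> complex) \<Rightarrow> nat \<Rightarrow> complex" where
  "Gamma_coeff \<beta> \<gamma> c n = c n * Gamma (\<beta> * of_nat n + \<gamma>)"

text \<open>
  The identity \<open>\<A>\<^sub>\<Gamma> \<cdot> \<B>\<^sub>\<Gamma> = 1\<close> for \<open>\<B>\<close> = \<open>\<A>\<close>-bar is one between functions analytic near
  \<open>0\<close>; as an identity of formal series it would not give a transform \<open>\<B>\<^sub>\<Gamma>\<close> that converges
  anywhere except at \<open>0\<close>.
\<close>

definition Gamma_reciprocal ::
    "complex \<Rightarrow> complex \<Rightarrow> nat \<Rightarrow> (nat \<Rightarrow> complex) \<Rightarrow> (nat \<Rightarrow> complex) \<Rightarrow> bool" where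
  "Gamma_reciprocal \<alpha> \<beta> m a abar \<longleftrightarrow>
     conv_radius (Gamma_coeff \<beta> \<alpha> a) > 0 \<and>
     conv_radius (Gamma_coeff \<beta> (of_nat m - \<alpha>) abar) > 0 \<and>
     (\<forall>\<^sub>F z in nhds 0. power_series (Gamma_coeff \<beta> \<alpha> a) z *
        power_series (Gamma_coeff \<beta> (of_nat m - \<alpha>) abar) z = 1)"

definition gen_integral ::
    "(real \<Rightarrow> real) \<Rightarrow> complex \<Rightarrow> complex \<Rightarrow> nat \<Rightarrow> (nat \<Rightarrow> complex) \<Rightarrow>
     (real \<Rightarrow> complex) \<Rightarrow> real \<Rightarrow> complex" where
  "gen_integral \<phi> \<alpha> \<beta> m abar f x =
     integral {0..x} (\<lambda>t. of_real (dhl \<phi> t) * of_real (\<phi> x - \<phi> t) powr (of_nat m - \<alpha> - 1) *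
       power_series abar (of_real (\<phi> x - \<phi> t) powr \<beta>) * f t)"

definition gen_D ::
    "(real \<Rightarrow> real) \<Rightarrow> complex \<Rightarrow> complex \<Rightarrow> nat \<Rightarrow> (nat \<Rightarrow> complex) \<Rightarrow>
     (real \<Rightarrow> complex) \<Rightarrow> real \<Rightarrow> complex" where
  "gen_D \<phi> \<alpha> \<beta> m abar f = (dphi \<phi> ^^ m) (gen_integral \<phi> \<alpha> \<beta> m abar f)"

definition gen_D_exists ::
    "(real \<Rightarrow> real) \<Rightarrow> complex \<Rightarrow> complex \<Rightarrow> nat \<Rightarrow> (nat \<Rightarrow> complex) \<Rightarrow>
     (real \<Rightarrow> complex) \<Rightarrow> bool" where
  "gen_D_exists \<phi> \<alpha> \<beta> m abar f \<longleftrightarrow> dphi_exists m \<phi> (gen_integral \<phi> \<alpha> \<beta> m abar f)"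

text \<open>The value at \<open>0\<close> of a function that is given on \<open>(0,\<infinity>)\<close> is its right-hand limit.\<close>

definition has_value_at_0 :: "(real \<Rightarrow> complex) \<Rightarrow> bool" where
  "has_value_at_0 f \<longleftrightarrow> (\<exists>l. (f \<longlongrightarrow> l) (at_right 0))"

definition value_at_0 :: "(real \<Rightarrow> complex) \<Rightarrow> complex" where
  "value_at_0 f = Lim (at_right 0) f"

end

theory Submission
  imports Defs
begin

text \<open>
  Put \<open>y = \<phi> x\<close>: for \<open>v = u \<circ> \<phi>\<close>-inverse every operator becomes a convolution on the half-line
  with the kernels \<open>p\<^sub>\<mu>(y) = y powr (\<mu> - 1) / \<Gamma>(\<mu>)\<close>, for which \<open>p\<^sub>\<mu> * p\<^sub>\<nu> = p\<^bsub>\<mu>+\<nu>\<^esub>\<close>, \<open>p\<^sub>\<mu>' = p\<^bsub>\<mu>-1\<^esub>\<close> and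
  \<open>L p\<^sub>\<mu> (s) = s powr (- \<mu>)\<close>. The kernel of the generalised derivative is a series of \<open>p\<^sub>\<mu>\<close>, which is
  split at \<open>n = \<lfloor>Re \<alpha> / Re \<beta>\<rfloor>\<close>.

  For larger \<open>n\<close> the \<open>m\<close> derivatives can be put on the kernel. The resulting kernel is Laplace
  integrable, because \<open>\<Gamma>(Re z) / \<bar>\<Gamma>(z)\<bar>\<close> grows at most exponentially along \<open>z = \<beta> n - \<alpha>\<close>, and its
  transform is the tail of the series in the theorem.

  For each of the finitely many remaining \<open>n\<close> one has a Riemann-Liouville derivative of order
  \<open>\<gamma> = \<alpha> - \<beta> n\<close>. By the regularity of the Riemann-Liouville derivative of order \<open>\<alpha>\<close>, Taylor's
  formula for \<open>p\<^bsub>m-\<alpha>\<^esub> * v\<close> yields an explicit expression for it on \<open>(0,\<infinity>)\<close>. It may fail to be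
  absolutely integrable at \<open>0\<close>, but repeated integration by parts gives an antiderivative of
  \<open>exp (- s y)\<close> times it, and the existence of the initial values makes that antiderivative
  continuous at \<open>0\<close>.
\<close>

section \<open>Convolution on the half-line\<close>

text \<open>The obstacle is the behaviour at 0. The hypotheses on the derivatives of the
  Riemann-Liouville integral speak about (0,\<infinity>) and about large arguments. Piecewise
  continuity of the derivative of order \<alpha> adds a one-sided limit at 0; this makes that
  derivative bounded near 0 and bounded by an exponential on all of (0,\<infinity>), so it can be
  the remainder in a Taylor formula. The Taylor coefficients are constants of integration and
  presuppose no initial values.

  The split index comes from the orders. After m derivatives the n-th kernel has index \<beta> n -
  \<alpha>, and its real part is positive exactly beyond the split. Up to the split the
  differentiated kernel need not be integrable at 0 and cannot be convolved with v; the Taylor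
  formula then replaces the derivative of a convolution by a finite sum of kernels and a convolution
  with the remainder.\<close>

definition causal :: "(real \<Rightarrow> complex) \<Rightarrow> bool" where
  "causal f \<longleftrightarrow> (\<forall>y\<le>0. f y = 0) \<and> continuous_on {0<..} f \<and> (\<forall>b. set_integrable lborel {..b} f)"

text \<open>Causal functions vanish for \<open>y \<le> 0\<close>, so for them this integral over the
  whole line is the one over \<open>{0..y}\<close> that occurs in the fractional operators. Without
  variable endpoints, Fubini and affine substitutions apply directly. Integrable singularities at 0
  are allowed.\<close>

definition conv :: "(real \<Rightarrow> complex) \<Rightarrow> (real \<Rightarrow> complex) \<Rightarrow> real \<Rightarrow> complex" where
  "conv f g y = (LINT t|lborel. f (y - t) * g t)"

lemma causal_eq_0: "causal f \<Longrightarrow> y \<le> 0 \<Longrightarrow> f y = 0"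
  and causal_continuous_on: "causal f \<Longrightarrow> continuous_on {0<..} f"
  and causal_set_integrable: "causal f \<Longrightarrow> set_integrable lborel {..b} f"
  by (auto simp: causal_def)

lemma measurable_continuous_on_halfline:
  fixes f :: "real \<Rightarrow> complex"
  assumes "\<And>y. y \<le> 0 \<Longrightarrow> f y = 0" "continuous_on {0<..} f"
  shows "f \<in> borel_measurable borel"
proof -
  have "(\<lambda>x. indicator {0<..} x *\<^sub>R f x) \<in> borel_measurable borel"
    by (rule borel_measurable_continuous_on_indicator) (use assms in auto)
  also have "(\<lambda>x. indicator {0<..} x *\<^sub>R f x) = f"
    using assms(1) by (auto simp: fun_eq_iff indicator_def)
  finally show ?thesis .
qed

lemma causal_measurable [measurable_dest]: "causal f \<Longrightarrow> f \<in> borel_measurable borel"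
  by (rule measurable_continuous_on_halfline) (auto simp: causal_def)

lemma causal_norm: "causal f \<Longrightarrow> causal (\<lambda>y. of_real (norm (f y)))"
proof -
  assume f: "causal f"
  have "set_integrable lborel {..b} (\<lambda>y. complex_of_real (norm (f y)))" for b
  proof -
    have "integrable lborel (\<lambda>y. complex_of_real (norm (indicator {..b} y *\<^sub>R f y)))"
      using causal_set_integrable[OF f, of b] unfolding set_integrable_def
      by (intro integrable_of_real integrable_norm)
    also have "(\<lambda>y. complex_of_real (norm (indicator {..b} y *\<^sub>R f y))) =
        (\<lambda>y. indicator {..b} y *\<^sub>R complex_of_real (norm (f y)))"
      by (auto simp: indicator_def)
    finally show ?thesis unfolding set_integrable_def .
  qed
  thus ?thesis using f by (auto simp: causal_def intro!: continuous_intros)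
qed

section \<open>Convolution of integrable functions on the line\<close>

lemma integrable_conv_full:
  fixes f g :: "real \<Rightarrow> complex"
  assumes f: "integrable lborel f" and g: "integrable lborel g"
  shows "integrable (lborel \<Otimes>\<^sub>M lborel) (\<lambda>(t, y). f (y - t) * g t)"
proof (rule lborel_pair.Fubini_integrable)
  have [measurable]: "f \<in> borel_measurable borel" "g \<in> borel_measurable borel" using f g by auto
  show "(\<lambda>(t, y). f (y - t) * g t) \<in> borel_measurable (lborel \<Otimes>\<^sub>M lborel)" by measurable
  have sh: "integrable lborel (\<lambda>y. f (y - t))" for t
    using lborel_integrable_real_affine[OF f, of 1 "-t"] by simp
  have "(\<lambda>t. LINT y|lborel. norm (case (t, y) of (t, y) \<Rightarrow> f (y - t) * g t)) =
     (\<lambda>t. (LINT y|lborel. norm (f y)) * norm (g t))"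
  proof
    fix t
    have "(LINT y|lborel. norm (f (y - t))) = (LINT y|lborel. norm (f y))"
      using lborel_integral_real_affine[of 1 "\<lambda>y. norm (f y)" "-t"] by simp
    thus "(LINT y|lborel. norm (case (t, y) of (t, y) \<Rightarrow> f (y - t) * g t)) = (LINT y|lborel. norm (f y)) * norm (g t)"
      by (simp add: norm_mult)
  qed
  thus "integrable lborel (\<lambda>t. LINT y|lborel. norm (case (t, y) of (t, y) \<Rightarrow> f (y - t) * g t))"
    using g by auto
  show "AE t in lborel. integrable lborel (\<lambda>y. case (t, y) of (t, y) \<Rightarrow> f (y - t) * g t)"
    using sh by auto
qed

lemma
  assumes f: "integrable lborel f" and g: "integrable lborel g"
  shows integrable_conv: "integrable lborel (conv f g)"
    and integral_conv: "(LINT y|lborel. conv f g y) = (LINT y|lborel. f y) * (LINT y|lborel. g y)"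
proof -
  note I = integrable_conv_full[OF f g]
  show "integrable lborel (conv f g)"
    using lborel_pair.integrable_snd[OF I] by (simp add: conv_def[abs_def])
  have "(LINT y|lborel. conv f g y) = (LINT t|lborel. LINT y|lborel. f (y - t) * g t)"
    unfolding conv_def using lborel_pair.Fubini_integral[OF I] by simp
  also have "\<dots> = (LINT t|lborel. (LINT y|lborel. f y) * g t)"
  proof (rule Bochner_Integration.integral_cong[OF refl])
    fix t
    show "(LINT y|lborel. f (y - t) * g t) = (LINT y|lborel. f y) * g t"
      using lborel_integral_real_affine[of 1 f "-t"] by simp
  qed
  finally show "(LINT y|lborel. conv f g y) = (LINT y|lborel. f y) * (LINT y|lborel. g y)" by simp
qed

lemma conv_commute: "conv f g = conv g f"
proof
  fix y
  show "conv f g y = conv g f y"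
    unfolding conv_def using lborel_integral_real_affine[of "-1" "\<lambda>t. f (y - t) * g t" y]
    by (simp add: mult.commute)
qed

lemma conv_nonpos:
  assumes "causal f" "causal g" "y \<le> 0"
  shows "conv f g y = 0"
proof -
  have "(\<lambda>t. f (y - t) * g t) = (\<lambda>_. 0)"
  proof
    show "f (y - t) * g t = 0" for t
      using assms by (cases "t \<le> 0") (auto simp: causal_def)
  qed
  thus ?thesis by (simp add: conv_def)
qed

lemma causal_bounded_on:
  assumes "causal f" "0 < a"
  obtains B where "B \<ge> 0" "\<And>t. a \<le> t \<Longrightarrow> t \<le> b \<Longrightarrow> norm (f t) \<le> B"
proof -
  have "continuous_on {a..b} f" using causal_continuous_on[OF assms(1)]
    by (rule continuous_on_subset) (use assms in auto)
  hence "bounded (f ` {a..b})" by (intro compact_imp_bounded compact_continuous_image) auto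
  then obtain B where "\<forall>t\<in>{a..b}. norm (f t) \<le> B" by (auto simp: bounded_iff)
  thus ?thesis by (intro that[of "max 0 B"]) force+
qed

text \<open>For \<open>0 < t \<le> y/2\<close> the argument \<open>y - t\<close> stays in
  \<open>[y/2, y]\<close>, away from the singularity of f at 0. There f is bounded, and local
  integrability of g suffices.\<close>

lemma integrable_half_conv:
  assumes f: "causal f" and g: "causal g" and y: "y > 0"
  shows "integrable lborel (\<lambda>t. indicator {..y/2} t *\<^sub>R (f (y - t) * g t))"
proof -
  note [measurable] = causal_measurable[OF f] causal_measurable[OF g]
  obtain B where B: "B \<ge> 0" "\<And>t. y/2 \<le> t \<Longrightarrow> t \<le> y \<Longrightarrow> norm (f t) \<le> B"
    using causal_bounded_on[OF f, of "y/2" y] y by auto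
  have "integrable lborel (\<lambda>t. B *\<^sub>R norm (indicator {..y} t *\<^sub>R g t))"
    using causal_set_integrable[OF g, of y] unfolding set_integrable_def
    by (intro integrable_scaleR_right integrable_norm)
  thus ?thesis
  proof (rule Bochner_Integration.integrable_bound)
    show "AE t in lborel. norm (indicator {..y/2} t *\<^sub>R (f (y - t) * g t))
          \<le> norm (B *\<^sub>R norm (indicator {..y} t *\<^sub>R g t))"
    proof (rule AE_I2)
      fix t
      show "norm (indicator {..y/2} t *\<^sub>R (f (y - t) * g t)) \<le> norm (B *\<^sub>R norm (indicator {..y} t *\<^sub>R g t))"
        using B(2)[of "y - t"] causal_eq_0[OF g, of t] B(1)
        by (cases "t \<le> 0") (auto simp: indicator_def norm_mult intro!: mult_right_mono)
    qed
  qed measurable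
qed

text \<open>The reflection \<open>t \<mapsto> y - t\<close> turns the half
  \<open>t \<ge> y/2\<close> into the half already treated, with f and g exchanged. In each half at
  most one factor is singular.\<close>

lemma
  assumes f: "causal f" and g: "causal g"
  shows conv_integrable: "integrable lborel (\<lambda>t. f (y - t) * g t)"
    and conv_split: "y > 0 \<Longrightarrow> conv f g y =
      (LINT t|lborel. indicator {..y/2} t *\<^sub>R (f (y - t) * g t)) +
      (LINT t|lborel. indicator {..y/2} t *\<^sub>R (g (y - t) * f t))"
proof -
  have *: "integrable lborel (\<lambda>t. f (y - t) * g t) \<and> conv f g y =
      (LINT t|lborel. indicator {..y/2} t *\<^sub>R (f (y - t) * g t)) +
      (LINT t|lborel. indicator {..y/2} t *\<^sub>R (g (y - t) * f t))" if y: "y > 0"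
  proof -
    let ?h = "\<lambda>t. indicator {..y/2} t *\<^sub>R (g (y - t) * f t)"
    have 1: "integrable lborel (\<lambda>t. ?h (y + (-1) * t))"
      using lborel_integrable_real_affine[OF integrable_half_conv[OF g f y], of "-1" y] by simp
    have 2: "(LINT t|lborel. ?h (y + (-1) * t)) = (LINT t|lborel. ?h t)"
      using lborel_integral_real_affine[of "-1" ?h y] by simp
    note 3 = integrable_half_conv[OF f g y]
    \<comment> \<open>The half-lines \<open>t \<le> y/2\<close> and \<open>y - t \<le> y/2\<close>
      overlap at \<open>t = y/2\<close>, where the product is counted twice.\<close>
    have e: "(AE t in lborel. indicator {..y/2} t *\<^sub>R (f (y - t) * g t) + ?h (y + (-1) * t) = f (y - t) * g t)"
      using AE_lborel_singleton[of "y/2"] by eventually_elim (auto simp: indicator_def mult.commute)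
    note [measurable] = causal_measurable[OF f] causal_measurable[OF g]
    have i: "integrable lborel (\<lambda>t. f (y - t) * g t)"
      by (rule integrable_cong_AE_imp[OF Bochner_Integration.integrable_add[OF 3 1]])
         (use e in \<open>auto elim: eventually_mono\<close>)
    have "conv f g y = (LINT t|lborel. indicator {..y/2} t *\<^sub>R (f (y - t) * g t) + ?h (y + (-1) * t))"
      unfolding conv_def by (rule integral_cong_AE) (use e in \<open>auto elim: eventually_mono\<close>)
    also have "\<dots> = (LINT t|lborel. indicator {..y/2} t *\<^sub>R (f (y - t) * g t)) + (LINT t|lborel. ?h t)"
      by (subst Bochner_Integration.integral_add[OF 3 1]) (use 2 in simp)
    finally show ?thesis using i by simp
  qed
  have "(\<lambda>t. f (y - t) * g t) = (\<lambda>_. 0)" if "y \<le> 0"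
  proof
    show "f (y - t) * g t = 0" for t
      using that f g by (cases "t \<le> 0") (auto simp: causal_def)
  qed
  thus "integrable lborel (\<lambda>t. f (y - t) * g t)" using * by (cases "y > 0") auto
  show "y > 0 \<Longrightarrow> conv f g y =
      (LINT t|lborel. indicator {..y/2} t *\<^sub>R (f (y - t) * g t)) +
      (LINT t|lborel. indicator {..y/2} t *\<^sub>R (g (y - t) * f t))" using * by blast
qed

lemma continuous_half_conv:
  assumes f: "causal f" and g: "causal g"
  shows "continuous_on {0<..} (\<lambda>y. LINT t|lborel. indicator {..y/2} t *\<^sub>R (f (y - t) * g t))"
    (is "continuous_on _ ?F")
proof (rule continuous_at_imp_continuous_on, rule ballI)
  fix y :: real assume "y \<in> {0<..}"
  hence y: "y > 0" by simp
  note [measurable] = causal_measurable[OF f] causal_measurable[OF g]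
  \<comment> \<open>If \<open>X n\<close> lies between \<open>y/2\<close> and \<open>2*y\<close> and
    \<open>0 < t \<le> X n / 2\<close>, then \<open>X n - t\<close> lies between \<open>y/4\<close>
    and \<open>2*y\<close>, and \<open>t \<le> y\<close>. The majorant therefore does not depend on
    n.\<close>
  obtain B where B: "B \<ge> 0" "\<And>t. y/4 \<le> t \<Longrightarrow> t \<le> 2*y \<Longrightarrow> norm (f t) \<le> B"
    using causal_bounded_on[OF f, of "y/4" "2*y"] y by auto
  show "isCont ?F y"
    unfolding continuous_at_sequentially o_def
  proof (intro allI impI)
    fix X :: "nat \<Rightarrow> real" assume X: "X \<longlonglongrightarrow> y"
    have "\<forall>\<^sub>F n in sequentially. X n \<in> {y/2<..<2*y}"
      using X y by (intro topological_tendstoD) auto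
    then obtain M where M: "\<And>n. n \<ge> M \<Longrightarrow> X n \<in> {y/2<..<2*y}" by (auto simp: eventually_sequentially)
    \<comment> \<open>The shift by M makes the domination hold for every n, not just
      eventually.\<close>
    have "(\<lambda>n. ?F (X (n + M))) \<longlonglongrightarrow> ?F y"
    proof (rule integral_dominated_convergence)
      show "integrable lborel (\<lambda>t. B *\<^sub>R norm (indicator {..y} t *\<^sub>R g t))"
        using causal_set_integrable[OF g, of y] unfolding set_integrable_def
        by (intro integrable_scaleR_right integrable_norm)
      show "AE t in lborel. (\<lambda>n. indicator {..X (n+M)/2} t *\<^sub>R (f (X (n+M) - t) * g t)) \<longlonglongrightarrow>
          indicator {..y/2} t *\<^sub>R (f (y - t) * g t)"
        using AE_lborel_singleton[of "y/2"]
      proof eventually_elim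
        case (elim t)
        have XM: "(\<lambda>n. X (n+M)) \<longlonglongrightarrow> y" using LIMSEQ_ignore_initial_segment[OF X] .
        have X2: "(\<lambda>n. X (n+M)/2) \<longlonglongrightarrow> y/2" using XM by (intro tendsto_intros) auto
        show ?case
        proof (cases "t < y/2")
          case True
          have "isCont f (y - t)"
            using causal_continuous_on[OF f] True y by (auto simp: continuous_on_eq_continuous_at)
          hence "(\<lambda>n. f (X (n+M) - t) * g t) \<longlonglongrightarrow> f (y - t) * g t"
            using XM by (intro tendsto_intros isCont_tendsto_compose[where g=f])
          moreover have "\<forall>\<^sub>F n in sequentially. X (n+M)/2 > t" using order_tendstoD(1)[OF X2 True] .
          hence "\<forall>\<^sub>F n in sequentially. f (X (n+M) - t) * g t = indicator {..X (n+M)/2} t *\<^sub>R (f (X (n+M) - t) * g t)"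
            by eventually_elim (auto simp: indicator_def)
          ultimately have "(\<lambda>n. indicator {..X (n+M)/2} t *\<^sub>R (f (X (n+M) - t) * g t)) \<longlonglongrightarrow> f (y - t) * g t"
            by (rule Lim_transform_eventually)
          thus ?thesis using True by simp
        next
          case False
          hence "\<forall>\<^sub>F n in sequentially. X (n+M)/2 < t" using order_tendstoD(2)[OF X2, of t] elim by auto
          hence "\<forall>\<^sub>F n in sequentially. 0 = indicator {..X (n+M)/2} t *\<^sub>R (f (X (n+M) - t) * g t)"
            by eventually_elim (auto simp: indicator_def)
          hence "(\<lambda>n. indicator {..X (n+M)/2} t *\<^sub>R (f (X (n+M) - t) * g t)) \<longlonglongrightarrow> 0"
            by (rule Lim_transform_eventually[OF tendsto_const])
          thus ?thesis using False elim by simp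
        qed
      qed
      fix n
      have M': "y/2 < X (n+M)" "X (n+M) < 2*y" using M[of "n+M"] by auto
      show "AE t in lborel. norm (indicator {..X (n+M)/2} t *\<^sub>R (f (X (n+M) - t) * g t))
          \<le> B *\<^sub>R norm (indicator {..y} t *\<^sub>R g t)"
      proof (rule AE_I2)
        fix t
        show "norm (indicator {..X (n+M)/2} t *\<^sub>R (f (X (n+M) - t) * g t)) \<le> B *\<^sub>R norm (indicator {..y} t *\<^sub>R g t)"
          using B(2)[of "X (n+M) - t"] causal_eq_0[OF g, of t] B(1) M'
          by (cases "t \<le> 0") (auto simp: indicator_def norm_mult intro!: mult_right_mono)
      qed
    qed measurable
    thus "(\<lambda>n. ?F (X n)) \<longlonglongrightarrow> ?F y" by (rule LIMSEQ_offset)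
  qed
qed

text \<open>Up to b a causal convolution sees its factors only up to b. Cutting both off there
  reduces local integrability of the convolution to the case of integrable functions.\<close>

lemma conv_eq_on:
  assumes f: "causal f" and g: "causal g" and y: "y \<le> b"
  shows "conv f g y = conv (\<lambda>t. indicator {..b} t *\<^sub>R f t) (\<lambda>t. indicator {..b} t *\<^sub>R g t) y"
  unfolding conv_def
proof (rule Bochner_Integration.integral_cong[OF refl])
  fix t
  show "f (y - t) * g t = indicator {..b} (y - t) *\<^sub>R f (y - t) * indicator {..b} t *\<^sub>R g t"
    using causal_eq_0[OF f, of "y - t"] causal_eq_0[OF g, of t] y by (auto simp: indicator_def)
qed

lemma causal_conv:
  assumes f: "causal f" and g: "causal g"
  shows "causal (conv f g)"
  unfolding causal_def
proof (intro conjI allI impI)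
  fix y :: real assume "y \<le> 0" thus "conv f g y = 0" by (rule conv_nonpos[OF f g])
next
  show "continuous_on {0<..} (conv f g)"
    by (rule continuous_on_eq[OF continuous_on_add[OF continuous_half_conv[OF f g] continuous_half_conv[OF g f]]])
       (simp add: conv_split[OF f g])
next
  fix b :: real
  have "integrable lborel (conv (\<lambda>t. indicator {..b} t *\<^sub>R f t) (\<lambda>t. indicator {..b} t *\<^sub>R g t))"
    using causal_set_integrable[OF f, of b] causal_set_integrable[OF g, of b]
    unfolding set_integrable_def by (intro integrable_conv)
  hence "set_integrable lborel {..b} (conv (\<lambda>t. indicator {..b} t *\<^sub>R f t) (\<lambda>t. indicator {..b} t *\<^sub>R g t))"
    unfolding set_integrable_def by (intro integrable_mult_indicator) auto
  thus "set_integrable lborel {..b} (conv f g)"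
    by (rule set_integrable_cong[THEN iffD1, rotated 3]) (auto simp: conv_eq_on[OF f g])
qed

lemma conv_assoc:
  assumes f: "causal f" and g: "causal g" and h: "causal h"
  shows "conv f (conv g h) = conv (conv f g) h"
proof
  fix y
  note [measurable] = causal_measurable[OF f] causal_measurable[OF g] causal_measurable[OF h]
  let ?n = "\<lambda>f y. complex_of_real (norm (f y))"
  have I: "integrable (lborel \<Otimes>\<^sub>M lborel) (\<lambda>(t, r). f (y - t) * (g (t - r) * h r))"
  proof (rule lborel_pair.Fubini_integrable)
    \<comment> \<open>The absolute iterated integral is again a convolution of causal functions,
      built from the norms of f, g and h. Its integrand is therefore integrable by the results just
      proved, and \<open>Re\<close> only leads back from complex to real values.\<close>
    have "integrable lborel (\<lambda>t. Re (?n f (y - t) * conv (?n g) (?n h) t))"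
      by (intro integrable_Re conv_integrable causal_conv causal_norm f g h)
    also have "(\<lambda>t. Re (?n f (y - t) * conv (?n g) (?n h) t)) =
      (\<lambda>t. LINT r|lborel. norm (case (t, r) of (t, r) \<Rightarrow> f (y - t) * (g (t - r) * h r)))"
    proof
      fix t
      have "Re (?n f (y - t) * conv (?n g) (?n h) t) =
        Re (LINT r|lborel. ?n f (y - t) * (?n g (t - r) * ?n h r))"
        by (simp add: conv_def)
      also have "\<dots> = Re (LINT r|lborel. complex_of_real (norm (f (y - t) * (g (t - r) * h r))))"
        by (simp add: norm_mult)
      finally show "Re (?n f (y - t) * conv (?n g) (?n h) t) =
        (LINT r|lborel. norm (case (t, r) of (t, r) \<Rightarrow> f (y - t) * (g (t - r) * h r)))"
        by simp
    qed
    finally show "integrable lborel (\<lambda>t. LINT r|lborel. norm (case (t, r) of (t, r) \<Rightarrow> f (y - t) * (g (t - r) * h r)))" .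
    show "AE t in lborel. integrable lborel (\<lambda>r. case (t, r) of (t, r) \<Rightarrow> f (y - t) * (g (t - r) * h r))"
      using conv_integrable[OF g h] by auto
  qed measurable
  have "conv f (conv g h) y = (LINT t|lborel. LINT r|lborel. f (y - t) * (g (t - r) * h r))"
    by (simp add: conv_def)
  also have "\<dots> = (LINT r|lborel. LINT t|lborel. f (y - t) * (g (t - r) * h r))"
    using lborel_pair.Fubini_integral[OF I] by simp
  also have "\<dots> = (LINT r|lborel. conv f g (y - r) * h r)"
  proof (rule Bochner_Integration.integral_cong[OF refl])
    fix r
    have "(LINT t|lborel. f (y - t) * (g (t - r) * h r)) = (LINT t|lborel. f (y - t) * g (t - r)) * h r"
      by (simp flip: mult.assoc)
    also have "(LINT t|lborel. f (y - t) * g (t - r)) = conv f g (y - r)"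
      unfolding conv_def using lborel_integral_real_affine[of 1 "\<lambda>t. f (y - t) * g (t - r)" r]
      by (simp add: algebra_simps)
    finally show "(LINT t|lborel. f (y - t) * (g (t - r) * h r)) = conv f g (y - r) * h r" .
  qed
  finally show "conv f (conv g h) y = conv (conv f g) h y" by (simp add: conv_def)
qed

section \<open>Riemann-Liouville kernels and the Laplace transform\<close>

definition lap_integrable :: "(real \<Rightarrow> complex) \<Rightarrow> complex \<Rightarrow> bool" where
  "lap_integrable f s \<longleftrightarrow> integrable lborel (\<lambda>y. exp (- s * of_real y) * f y)"

definition lap :: "(real \<Rightarrow> complex) \<Rightarrow> complex \<Rightarrow> complex" where
  "lap f s = (LINT y|lborel. exp (- s * of_real y) * f y)"

lemma causalI_lap_integrable:
  assumes 0: "\<And>y. y \<le> 0 \<Longrightarrow> f y = 0" and c: "continuous_on {0<..} f" and f: "lap_integrable f s"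
  shows "causal f"
proof -
  have [measurable]: "f \<in> borel_measurable borel" by (rule measurable_continuous_on_halfline) fact+
  have "integrable lborel (\<lambda>y. indicator {..b} y *\<^sub>R f y)" for b
  proof (rule Bochner_Integration.integrable_bound)
    \<comment> \<open>On (0,b] this constant outweighs the possible decay of
      \<open>exp (- s y)\<close>; elsewhere the left-hand side of the bound is 0.\<close>
    show "integrable lborel (\<lambda>y. exp (\<bar>Re s\<bar> * \<bar>b\<bar>) *\<^sub>R (exp (- s * of_real y) * f y))"
      using f unfolding lap_integrable_def by (intro integrable_scaleR_right)
    show "AE y in lborel. norm (indicator {..b} y *\<^sub>R f y) \<le>
       norm (exp (\<bar>Re s\<bar> * \<bar>b\<bar>) *\<^sub>R (exp (- s * of_real y) * f y))"
    proof (rule AE_I2)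
      fix y
      show "norm (indicator {..b} y *\<^sub>R f y) \<le> norm (exp (\<bar>Re s\<bar> * \<bar>b\<bar>) *\<^sub>R (exp (- s * of_real y) * f y))"
      proof (cases "0 < y \<and> y \<le> b")
        case True
        hence "Re s * y \<le> \<bar>Re s\<bar> * \<bar>b\<bar>" by (intro mult_mono) auto
        hence "1 * norm (f y) \<le> exp (\<bar>Re s\<bar> * \<bar>b\<bar> - Re s * y) * norm (f y)"
          by (intro mult_right_mono) auto
        thus ?thesis using True by (simp add: norm_mult exp_diff exp_minus norm_divide field_simps)
      qed (use 0 in \<open>auto simp: indicator_def\<close>)
    qed
  qed measurable
  thus ?thesis using 0 c by (auto simp: causal_def set_integrable_def)
qed

text \<open>The exponential is multiplicative, so it distributes over the two arguments
  \<open>y - t\<close> and t. This reduces the convolution theorem for \<open>lap\<close> to the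
  integral of a convolution.\<close>

lemma conv_exp:
  "exp (- s * of_real y) * conv f g y =
     conv (\<lambda>y. exp (- s * of_real y) * f y) (\<lambda>y. exp (- s * of_real y) * g y) y"
proof -
  have *: "(\<lambda>t. exp (- s * of_real y) * (f (y - t) * g t)) =
      (\<lambda>t. exp (- s * of_real (y - t)) * f (y - t) * (exp (- s * of_real t) * g t))"
  proof
    fix t
    have "exp (- s * of_real y) = exp (- s * of_real (y - t)) * exp (- s * of_real t)"
      by (simp add: algebra_simps flip: exp_add)
    thus "exp (- s * of_real y) * (f (y - t) * g t) =
      exp (- s * of_real (y - t)) * f (y - t) * (exp (- s * of_real t) * g t)" by simp
  qed
  have "exp (- s * of_real y) * conv f g y = (LINT t|lborel. exp (- s * of_real y) * (f (y - t) * g t))"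
    by (simp add: conv_def)
  thus ?thesis unfolding * conv_def .
qed

lemma
  assumes f: "lap_integrable f s" and g: "lap_integrable g s"
  shows lap_integrable_conv: "lap_integrable (conv f g) s"
    and lap_conv: "lap (conv f g) s = lap f s * lap g s"
  using integrable_conv[OF f[unfolded lap_integrable_def] g[unfolded lap_integrable_def]]
    integral_conv[OF f[unfolded lap_integrable_def] g[unfolded lap_integrable_def]]
  unfolding lap_integrable_def lap_def conv_exp by blast+

lemma Gamma_times_rGamma: "Re z > 0 \<Longrightarrow> Gamma z * rGamma z = 1" for z :: complex
proof -
  assume "Re z > 0"
  hence "z \<notin> \<int>\<^sub>\<le>\<^sub>0" by (auto elim!: nonpos_Ints_cases)
  thus ?thesis by (simp add: rGamma_inverse_Gamma Gamma_eq_zero_iff)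
qed

definition rl_kernel :: "complex \<Rightarrow> real \<Rightarrow> complex" where
  "rl_kernel \<mu> y = (if y > 0 then of_real y powr (\<mu> - 1) * rGamma \<mu> else 0)"

lemma rl_kernel_nonpos [simp]: "y \<le> 0 \<Longrightarrow> rl_kernel \<mu> y = 0"
  by (simp add: rl_kernel_def)

lemma norm_rl_kernel: "y > 0 \<Longrightarrow> norm (rl_kernel \<mu> y) = y powr (Re \<mu> - 1) * norm (rGamma \<mu>)"
  by (simp add: rl_kernel_def norm_mult norm_powr_real_powr)

lemma has_vector_derivative_rl_kernel:
  assumes "y > 0"
  shows "(rl_kernel \<mu> has_vector_derivative rl_kernel (\<mu> - 1) y) (at y)"
proof -
  have "((\<lambda>y. of_real y powr (\<mu> - 1) * rGamma \<mu>) has_vector_derivative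
      ((\<mu> - 1) * of_real y powr (\<mu> - 1 - 1) * 1) * rGamma \<mu>) (at y)"
    using assms by (auto intro!: derivative_eq_intros has_vector_derivative_real_field)
  also have "((\<mu> - 1) * of_real y powr (\<mu> - 1 - 1) * 1) * rGamma \<mu> = rl_kernel (\<mu> - 1) y"
    using assms rGamma_plus1[of "\<mu> - 1"] by (simp add: rl_kernel_def mult_ac)
  finally show ?thesis
    by (rule has_vector_derivative_transform_within_open[where S="{0<..}"]) (use assms in \<open>auto simp: rl_kernel_def\<close>)
qed

lemma continuous_on_rl_kernel: "continuous_on {0<..} (rl_kernel \<mu>)"
  by (auto intro!: continuous_at_imp_continuous_on has_vector_derivative_continuous has_vector_derivative_rl_kernel)

lemma measurable_rl_kernel [measurable]: "rl_kernel \<mu> \<in> borel_measurable borel"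
  by (rule measurable_continuous_on_halfline) (auto intro: continuous_on_rl_kernel)

lemma lap_integrable_rl_kernel:
  assumes "Re \<mu> > 0" "Re s > 0"
  shows "lap_integrable (rl_kernel \<mu>) s"
  unfolding lap_integrable_def
proof (rule Bochner_Integration.integrable_bound)
  let ?f = "\<lambda>t. indicator {0<..} t *\<^sub>R (complex_of_real t powr (\<mu> - 1) / of_real (exp (Re s * t)))"
  have "integrable lebesgue ?f"
    using absolutely_integrable_Gamma_integral[OF assms] unfolding set_integrable_def .
  moreover have "(\<lambda>t. indicator {0<..} t *\<^sub>R (complex_of_real t powr (\<mu> - 1) / of_real (exp (Re s * t))))
      \<in> borel_measurable borel"
    by (intro borel_measurable_continuous_on_indicator continuous_intros) auto
  ultimately have "integrable lborel ?f"
    by (subst (asm) integrable_completion) auto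
  thus "integrable lborel (\<lambda>t. rGamma \<mu> * ?f t)" by (rule integrable_mult_right)
  show "AE t in lborel. norm (exp (- s * of_real t) * rl_kernel \<mu> t) \<le> norm (rGamma \<mu> * ?f t)"
    by (rule AE_I2) (auto simp: rl_kernel_def norm_mult norm_divide indicator_def exp_minus field_simps)
qed measurable

lemma causal_rl_kernel: "Re \<mu> > 0 \<Longrightarrow> causal (rl_kernel \<mu>)"
  using lap_integrable_rl_kernel[of \<mu> 1] by (intro causalI_lap_integrable[of _ 1]) (auto intro: continuous_on_rl_kernel)

lemma lap_rl_kernel_1:
  assumes "Re \<mu> > 0"
  shows "lap (rl_kernel \<mu>) 1 = 1"
proof -
  let ?f = "\<lambda>y. exp (- 1 * of_real y) * rl_kernel \<mu> y"
  have "integrable lborel ?f" using lap_integrable_rl_kernel[of \<mu> 1] assms by (simp add: lap_integrable_def)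
  from has_integral_integral_lborel[OF this]
  have 1: "(?f has_integral lap (rl_kernel \<mu>) 1) UNIV" by (simp add: lap_def)
  have "((\<lambda>t. if t \<in> {0<..} then rGamma \<mu> * (of_real t powr (\<mu> - 1) / of_real (exp t)) else 0)
      has_integral (rGamma \<mu> * Gamma \<mu>)) UNIV"
    unfolding has_integral_restrict_UNIV
    by (intro has_integral_mult_right Gamma_integral_complex' assms)
  also have "(\<lambda>t. if t \<in> {0<..} then rGamma \<mu> * (of_real t powr (\<mu> - 1) / of_real (exp t)) else 0) = ?f"
    by (auto simp: rl_kernel_def fun_eq_iff exp_minus field_simps simp flip: exp_of_real)
  also have "rGamma \<mu> * Gamma \<mu> = 1"
    using Gamma_times_rGamma[OF assms] by (simp add: mult.commute)
  finally show ?thesis using 1 has_integral_unique by blast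
qed

text \<open>Scaling by r reduces this to the transform at 1, which is Euler's integral; the kernel
  is homogeneous of degree \<open>\<mu> - 1\<close>.\<close>

lemma lap_rl_kernel_real:
  assumes \<mu>: "Re \<mu> > 0" and r: "r > (0::real)"
  shows "lap (rl_kernel \<mu>) (of_real r) = of_real r powr (- \<mu>)"
proof -
  have "1 = r *\<^sub>R (LINT y|lborel. exp (- 1 * of_real (0 + r * y)) * rl_kernel \<mu> (0 + r * y))"
    using lborel_integral_real_affine[of r "\<lambda>y. exp (- 1 * of_real y) * rl_kernel \<mu> y" 0] r lap_rl_kernel_1[OF \<mu>]
    by (simp add: lap_def)
  also have "rl_kernel \<mu> (0 + r * y) = of_real r powr (\<mu> - 1) * rl_kernel \<mu> y" for y
    using r by (auto simp: rl_kernel_def powr_times_real zero_less_mult_iff)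
  hence "(LINT y|lborel. exp (- 1 * of_real (0 + r * y)) * rl_kernel \<mu> (0 + r * y)) =
     (LINT y|lborel. of_real r powr (\<mu> - 1) * (exp (- of_real r * of_real y) * rl_kernel \<mu> y))"
    by (intro Bochner_Integration.integral_cong) (auto simp: mult_ac)
  also have "\<dots> = of_real r powr (\<mu> - 1) * lap (rl_kernel \<mu>) (of_real r)"
    by (simp add: lap_def)
  also have "r *\<^sub>R \<dots> = of_real r powr \<mu> * lap (rl_kernel \<mu>) (of_real r)"
    using r by (simp add: scaleR_conv_of_real powr_diff)
  finally show ?thesis using r by (simp add: powr_minus field_simps)
qed

lemma power_times_rl_kernel: "of_real y ^ k * rl_kernel \<mu> y = pochhammer \<mu> k * rl_kernel (\<mu> + of_nat k) y"
proof (cases "y > 0")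
  case True
  have "of_real y powr (\<mu> + of_nat k - 1) = of_real y powr (of_nat k) * complex_of_real y powr (\<mu> - 1)"
    by (simp flip: powr_add add: algebra_simps)
  also have "of_real y powr (of_nat k) = complex_of_real y ^ k" using True by (subst powr_nat') auto
  finally show ?thesis using True pochhammer_rGamma[of \<mu> k] by (simp add: rl_kernel_def mult_ac)
qed auto

text \<open>Expanding the square, the condition reads \<open>(norm s)^2 < 2 * r * Re s\<close>; the
  chosen r makes the right-hand side twice the left-hand side.\<close>

lemma exists_dominating_real:
  assumes "Re s > 0"
  obtains r :: real where "r > 0" "norm (s - of_real r) < r"
proof -
  define r where "r = (norm s)^2 / (Re s)"
  have ns: "norm s > 0" using assms by (auto simp: complex_eq_iff)
  hence r: "r > 0" using assms by (simp add: r_def)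
  have "(norm (s - of_real r))^2 = (norm s)^2 - 2 * r * Re s + r^2"
    unfolding cmod_power2 by (simp add: power2_eq_square algebra_simps)
  also have "\<dots> < r^2" using assms ns by (simp add: r_def field_simps power2_eq_square)
  finally have "norm (s - of_real r) < r" using r by (rule power_less_imp_less_base[OF _ less_imp_le])
  with r show ?thesis by (rule that)
qed

text \<open>Expand \<open>exp (- s y)\<close> around a real \<open>r\<close> whose disc of radius \<open>r\<close> contains \<open>s\<close>; the
  resulting series of integrals is the binomial series of \<open>s powr (- \<mu>)\<close>.\<close>

lemma lap_rl_kernel:
  assumes \<mu>: "Re \<mu> > 0" and s: "Re s > 0"
  shows "lap (rl_kernel \<mu>) s = s powr (- \<mu>)"
proof -
  obtain r :: real where r: "r > 0" "norm (s - of_real r) < r" using exists_dominating_real[OF s] .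
  define h where "h = s - of_real r"
  define g where "g = (\<lambda>n y. (\<Sum>k<n. (- h * of_real y) ^ k / fact k) * (exp (- of_real r * of_real y) * rl_kernel \<mu> y))"
  have [measurable]: "g n \<in> borel_measurable borel" for n unfolding g_def by measurable
  have "(\<lambda>n. LINT y|lborel. g n y) \<longlonglongrightarrow> (LINT y|lborel. exp (- s * of_real y) * rl_kernel \<mu> y)"
  proof (rule integral_dominated_convergence)
    \<comment> \<open>The partial sums of \<open>exp (- h y)\<close> are bounded by
      \<open>exp (norm h * y)\<close>. Together with \<open>exp (- r y)\<close> this leaves decay at
      rate \<open>r - norm h\<close>, positive by the choice of r.\<close>
    have "lap_integrable (rl_kernel \<mu>) (of_real (r - norm h))"
      using r \<mu> by (intro lap_integrable_rl_kernel) (auto simp: h_def)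
    thus "integrable lborel (\<lambda>y. norm (exp (- of_real (r - norm h) * of_real y) * rl_kernel \<mu> y))"
      unfolding lap_integrable_def by (rule integrable_norm)
    show "AE y in lborel. (\<lambda>n. g n y) \<longlonglongrightarrow> exp (- s * of_real y) * rl_kernel \<mu> y"
    proof (rule AE_I2)
      fix y :: real
      have "(\<lambda>k. (- h * of_real y) ^ k / fact k) sums exp (- h * of_real y)"
        using exp_converges[of "- h * of_real y"] by (simp add: scaleR_conv_of_real field_simps)
      hence "(\<lambda>n. g n y) \<longlonglongrightarrow> exp (- h * of_real y) * (exp (- of_real r * of_real y) * rl_kernel \<mu> y)"
        unfolding g_def sums_def by (intro tendsto_intros)
      also have "exp (- h * of_real y) * (exp (- of_real r * of_real y) * rl_kernel \<mu> y) = exp (- s * of_real y) * rl_kernel \<mu> y"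
        by (simp add: h_def algebra_simps flip: mult.assoc exp_add)
      finally show "(\<lambda>n. g n y) \<longlonglongrightarrow> exp (- s * of_real y) * rl_kernel \<mu> y" .
    qed
    fix n
    show "AE y in lborel. norm (g n y) \<le> norm (exp (- of_real (r - norm h) * of_real y) * rl_kernel \<mu> y)"
    proof (rule AE_I2)
      fix y :: real
      show "norm (g n y) \<le> norm (exp (- of_real (r - norm h) * of_real y) * rl_kernel \<mu> y)"
      proof (cases "y > 0")
        case True
        have "norm (\<Sum>k<n. (- h * of_real y) ^ k / fact k) \<le> (\<Sum>k<n. (norm h * y) ^ k / fact k)"
          using True by (intro sum_norm_le) (auto simp: norm_mult norm_divide norm_power)
        also have "\<dots> \<le> (\<Sum>k. (norm h * y) ^ k / fact k)"
        proof (rule sum_le_suminf)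
          show "summable (\<lambda>k. (norm h * y) ^ k / fact k)"
            using summable_exp[of "norm h * y"] by (simp add: field_simps)
        qed (use True in auto)
        also have "\<dots> = exp (norm h * y)" by (simp add: exp_def divide_inverse mult.commute)
        finally have "norm (\<Sum>k<n. (- h * of_real y) ^ k / fact k) \<le> exp (norm h * y)" .
        hence "norm (g n y) \<le> exp (norm h * y) * (exp (- r * y) * norm (rl_kernel \<mu> y))"
          unfolding g_def norm_mult by (intro mult_mono) auto
        also have "exp (norm h * y) * (exp (- r * y) * norm (rl_kernel \<mu> y)) = norm (exp (- of_real (r - norm h) * of_real y) * rl_kernel \<mu> y)"
          by (simp add: norm_mult algebra_simps flip: exp_add mult.assoc)
        finally show ?thesis .
      qed (auto simp: g_def)
    qed
  qed measurable
  hence lim: "(\<lambda>n. LINT y|lborel. g n y) \<longlonglongrightarrow> lap (rl_kernel \<mu>) s" by (simp add: lap_def)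
  have g_eq: "(LINT y|lborel. g n y) =
     (\<Sum>k<n. ((- \<mu>) gchoose k) * (h / of_real r) ^ k) * of_real r powr (- \<mu>)" for n
  proof -
    have gn: "g n = (\<lambda>y. \<Sum>k<n. (- h) ^ k / fact k * pochhammer \<mu> k *
        (exp (- of_real r * of_real y) * rl_kernel (\<mu> + of_nat k) y))"
    proof
      fix y :: real
      have "g n y = (\<Sum>k<n. (- h) ^ k / fact k * exp (- of_real r * of_real y) * (of_real y ^ k * rl_kernel \<mu> y))"
        unfolding g_def sum_distrib_right power_mult_distrib by (intro sum.cong) (auto simp: field_simps)
      thus "g n y = (\<Sum>k<n. (- h) ^ k / fact k * pochhammer \<mu> k *
        (exp (- of_real r * of_real y) * rl_kernel (\<mu> + of_nat k) y))"
        unfolding power_times_rl_kernel by (simp add: mult_ac)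
    qed
    have "(LINT y|lborel. g n y) =
        (\<Sum>k<n. (- h) ^ k / fact k * pochhammer \<mu> k * lap (rl_kernel (\<mu> + of_nat k)) (of_real r))"
      unfolding gn
    proof (subst Bochner_Integration.integral_sum)
      fix k
      have "lap_integrable (rl_kernel (\<mu> + of_nat k)) (of_real r)" using r \<mu> by (intro lap_integrable_rl_kernel) auto
      thus "integrable lborel (\<lambda>y. (- h) ^ k / fact k * pochhammer \<mu> k * (exp (- of_real r * of_real y) * rl_kernel (\<mu> + of_nat k) y))"
        unfolding lap_integrable_def by (intro integrable_mult_right)
    qed (simp add: lap_def)
    \<comment> \<open>Raising the index by k divides the transform at r by \<open>r ^ k\<close>, and
      the signed Pochhammer symbol over \<open>fact k\<close> is a binomial coefficient of
      \<open>- \<mu>\<close>. What remains is the binomial series in \<open>h / r\<close>.\<close>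
    also have "\<dots> = (\<Sum>k<n. ((- \<mu>) gchoose k) * (h / of_real r) ^ k * of_real r powr (- \<mu>))"
    proof (rule sum.cong[OF refl])
      fix k
      have "lap (rl_kernel (\<mu> + of_nat k)) (of_real r) = of_real r powr (- \<mu> - of_nat k)"
        using lap_rl_kernel_real[of "\<mu> + of_nat k" r] r \<mu> by simp
      also have "\<dots> = of_real r powr (- \<mu>) / of_real r ^ k"
        using r by (simp add: powr_diff)
      finally show "(- h) ^ k / fact k * pochhammer \<mu> k * lap (rl_kernel (\<mu> + of_nat k)) (of_real r) =
          ((- \<mu>) gchoose k) * (h / of_real r) ^ k * of_real r powr (- \<mu>)"
        by (simp add: gbinomial_pochhammer power_divide power_minus[of h])
    qed
    finally show ?thesis by (simp add: sum_distrib_right)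
  qed
  have "norm (h / of_real r) < 1" using r by (simp add: h_def norm_divide)
  from gen_binomial_complex[OF this, of "-\<mu>"]
  have "(\<lambda>n. LINT y|lborel. g n y) \<longlonglongrightarrow> (1 + h / of_real r) powr (- \<mu>) * of_real r powr (- \<mu>)"
    unfolding g_eq sums_def by (intro tendsto_intros)
  also have "(1 + h / of_real r) powr (- \<mu>) * of_real r powr (- \<mu>) = (of_real r * (1 + h / of_real r)) powr (- \<mu>)"
    using r by (subst powr_times_real_left) auto
  also have "of_real r * (1 + h / of_real r) = s" using r by (simp add: h_def field_simps)
  finally show ?thesis using lim LIMSEQ_unique by blast
qed

text \<open>The Beta integral is not evaluated. By homogeneity the convolution is a constant
  multiple of the kernel of index \<open>\<mu> + \<nu>\<close>; comparing Laplace transforms at 1,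
  where each kernel has transform 1, shows that the constant is 1.\<close>

lemma conv_rl_kernel:
  assumes \<mu>: "Re \<mu> > 0" and \<nu>: "Re \<nu> > 0"
  shows "conv (rl_kernel \<mu>) (rl_kernel \<nu>) = rl_kernel (\<mu> + \<nu>)"
proof -
  define C where "C = conv (rl_kernel \<mu>) (rl_kernel \<nu>) 1"
  have G: "Gamma (\<mu> + \<nu>) * rGamma (\<mu> + \<nu>) = 1"
    using assms by (intro Gamma_times_rGamma) auto
  have hom: "rl_kernel \<mu> (y * t) = of_real y powr (\<mu> - 1) * rl_kernel \<mu> t" if "y > 0" for y t \<mu>
    using that by (auto simp: rl_kernel_def powr_times_real zero_less_mult_iff)
  have eq: "conv (rl_kernel \<mu>) (rl_kernel \<nu>) y = (C * Gamma (\<mu> + \<nu>)) * rl_kernel (\<mu> + \<nu>) y" for y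
  proof (cases "y > 0")
    case True
    have "conv (rl_kernel \<mu>) (rl_kernel \<nu>) y = y *\<^sub>R (LINT t|lborel. rl_kernel \<mu> (y - y * t) * rl_kernel \<nu> (y * t))"
      unfolding conv_def using lborel_integral_real_affine[of y "\<lambda>t. rl_kernel \<mu> (y - t) * rl_kernel \<nu> t" 0] True by simp
    also have "(\<lambda>t. rl_kernel \<mu> (y - y * t) * rl_kernel \<nu> (y * t)) =
       (\<lambda>t. (of_real y powr (\<mu> - 1) * of_real y powr (\<nu> - 1)) * (rl_kernel \<mu> (1 - t) * rl_kernel \<nu> t))"
    proof
      fix t
      have "y - y * t = y * (1 - t)" by (simp add: algebra_simps)
      thus "rl_kernel \<mu> (y - y * t) * rl_kernel \<nu> (y * t) =
          (of_real y powr (\<mu> - 1) * of_real y powr (\<nu> - 1)) * (rl_kernel \<mu> (1 - t) * rl_kernel \<nu> t)"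
        using hom[OF True] by simp
    qed
    also have "y *\<^sub>R (LINT t|lborel. (of_real y powr (\<mu> - 1) * of_real y powr (\<nu> - 1)) * (rl_kernel \<mu> (1 - t) * rl_kernel \<nu> t)) =
      of_real y * of_real y powr (\<mu> - 1) * of_real y powr (\<nu> - 1) * C"
      by (simp add: C_def conv_def scaleR_conv_of_real)
    also have "of_real y * of_real y powr (\<mu> - 1) * of_real y powr (\<nu> - 1) = complex_of_real y powr (\<mu> + \<nu> - 1)"
      using True by (simp add: powr_diff powr_add)
    finally have "conv (rl_kernel \<mu>) (rl_kernel \<nu>) y =
        of_real y powr (\<mu> + \<nu> - 1) * C * (Gamma (\<mu> + \<nu>) * rGamma (\<mu> + \<nu>))"
      using G by simp
    also have "\<dots> = (C * Gamma (\<mu> + \<nu>)) * rl_kernel (\<mu> + \<nu>) y"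
      using True by (simp add: rl_kernel_def)
    finally show ?thesis .
  qed (use conv_nonpos[OF causal_rl_kernel causal_rl_kernel] assms in auto)
  have "lap (conv (rl_kernel \<mu>) (rl_kernel \<nu>)) 1 = 1 * 1"
    using lap_conv[OF lap_integrable_rl_kernel lap_integrable_rl_kernel, of \<mu> 1 \<nu>] assms lap_rl_kernel_1 by simp
  moreover have "lap (conv (rl_kernel \<mu>) (rl_kernel \<nu>)) 1 = (C * Gamma (\<mu> + \<nu>)) * lap (rl_kernel (\<mu> + \<nu>)) 1"
    unfolding lap_def eq by (simp flip: Bochner_Integration.integral_mult_right_zero add: mult_ac)
  ultimately have "C * Gamma (\<mu> + \<nu>) = 1" using lap_rl_kernel_1[of "\<mu> + \<nu>"] assms by simp
  thus ?thesis using eq by auto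
qed

section \<open>Derivatives and Taylor expansion\<close>

lemma causal_mult: "causal f \<Longrightarrow> causal (\<lambda>y. c * f y)"
  by (auto simp: causal_def intro!: continuous_intros set_integrable_mult_right)

lemma causal_add: "causal f \<Longrightarrow> causal g \<Longrightarrow> causal (\<lambda>y. f y + g y)"
  by (auto simp: causal_def intro!: continuous_intros set_integral_add)

lemma causal_zero: "causal (\<lambda>_. 0)"
  by (auto simp: causal_def set_integrable_def)

lemma causal_sum: "(\<And>i. i \<in> A \<Longrightarrow> causal (f i)) \<Longrightarrow> causal (\<lambda>y. \<Sum>i\<in>A. f i y)"
  by (induction A rule: infinite_finite_induct) (auto intro: causal_add causal_zero)

lemma conv_mult_left: "conv (\<lambda>y. c * f y) g = (\<lambda>y. c * conv f g y)"
  by (auto simp: conv_def fun_eq_iff mult.assoc)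

lemma conv_mult_right: "conv f (\<lambda>y. c * g y) = (\<lambda>y. c * conv f g y)"
  using conv_mult_left[of c g f] by (simp add: conv_commute)

lemma conv_add_left:
  assumes "causal f" "causal f'" "causal g"
  shows "conv (\<lambda>y. f y + f' y) g = (\<lambda>y. conv f g y + conv f' g y)"
  unfolding conv_def
  by (rule ext) (simp add: distrib_right Bochner_Integration.integral_add conv_integrable assms)

lemma conv_add_right:
  assumes "causal f" "causal f'" "causal g"
  shows "conv g (\<lambda>y. f y + f' y) = (\<lambda>y. conv g f y + conv g f' y)"
  using conv_add_left[OF assms] by (simp add: conv_commute)

lemma conv_zero_right: "conv f (\<lambda>_. 0) = (\<lambda>_. 0)"
  by (simp add: conv_def fun_eq_iff)

lemma conv_sum_right:
  assumes "causal g" "\<And>i. i \<in> A \<Longrightarrow> causal (f i)"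
  shows "conv g (\<lambda>y. \<Sum>i\<in>A. f i y) = (\<lambda>y. \<Sum>i\<in>A. conv g (f i) y)"
  using assms(2)
  by (induction A rule: infinite_finite_induct)
     (auto simp: conv_zero_right conv_add_right assms(1) causal_sum)

lemma conv_sum_left:
  assumes "causal g" "\<And>i. i \<in> A \<Longrightarrow> causal (f i)"
  shows "conv (\<lambda>y. \<Sum>i\<in>A. f i y) g = (\<lambda>y. \<Sum>i\<in>A. conv (f i) g y)"
  using conv_sum_right[OF assms] by (simp add: conv_commute)

section \<open>Integration from 0 as convolution with the Heaviside function
  \<open>rl_kernel 1\<close>\<close>

lemma conv_rl_kernel_1: "conv (rl_kernel 1) f y = (LINT t|lborel. indicator {..y} t *\<^sub>R f t)" if "causal f"
proof -
  note [measurable] = causal_measurable[OF that]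
  show ?thesis unfolding conv_def
  proof (rule integral_cong_AE)
    show "AE t in lborel. rl_kernel 1 (y - t) * f t = indicator {..y} t *\<^sub>R f t"
      using AE_lborel_singleton[of y] by eventually_elim (auto simp: rl_kernel_def indicator_def)
  qed measurable
qed

lemma causal_integrable_on: "causal f \<Longrightarrow> f integrable_on {0..b}"
proof -
  assume f: "causal f"
  have "set_integrable lborel {0..b} f"
    by (rule set_integrable_subset[OF causal_set_integrable[OF f]]) auto
  thus ?thesis by (rule set_borel_integral_eq_integral)
qed

lemma conv_rl_kernel_1_eq_integral:
  assumes f: "causal f"
  shows "conv (rl_kernel 1) f y = integral {0..y} f"
proof -
  have "set_integrable lborel {0..y} f"
    by (rule set_integrable_subset[OF causal_set_integrable[OF f]]) auto
  hence "integral {0..y} f = (LINT t|lborel. indicator {0..y} t *\<^sub>R f t)"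
    by (metis set_borel_integral_eq_integral(2) set_lebesgue_integral_def)
  also have "(\<lambda>t. indicator {0..y} t *\<^sub>R f t) = (\<lambda>t. indicator {..y} t *\<^sub>R f t)"
    using causal_eq_0[OF f] by (auto simp: indicator_def fun_eq_iff not_le intro: ccontr)
  finally show ?thesis using conv_rl_kernel_1[OF f] by simp
qed

lemma has_vector_derivative_conv_rl_kernel_1:
  assumes f: "causal f" and y: "y > 0"
  shows "(conv (rl_kernel 1) f has_vector_derivative f y) (at y)"
proof -
  have "isCont f y" using causal_continuous_on[OF f] y by (auto simp: continuous_on_eq_continuous_at)
  hence "((\<lambda>u. integral {0..u} f) has_vector_derivative f y) (at y within ({0..y+1} - {}))"
    using y by (intro integral_has_vector_derivative_continuous_at causal_integrable_on f)
       (auto intro: continuous_at_imp_continuous_at_within)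
  also have "at y within ({0..y+1} - {}) = at y"
    using y by (intro at_within_interior) auto
  finally show ?thesis by (simp add: conv_rl_kernel_1_eq_integral[OF f, abs_def])
qed

lemma conv_rl_kernel_1_at_right_0:
  assumes f: "causal f"
  shows "(conv (rl_kernel 1) f \<longlongrightarrow> 0) (at_right 0)"
proof -
  have "continuous_on {0..1} (\<lambda>x. integral {0..x} f)"
    by (intro indefinite_integral_continuous_1 causal_integrable_on f)
  hence "((\<lambda>x. integral {0..x} f) \<longlongrightarrow> integral {0..0} f) (at 0 within {0..1})"
    unfolding continuous_on_def by (elim ballE[of _ _ 0]) auto
  moreover have "at 0 within {0..1} = at_right (0::real)"
    by (metis at_within_Icc_at_right zero_less_one)
  ultimately show ?thesis by (simp add: conv_rl_kernel_1_eq_integral[OF f, abs_def])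
qed

lemma conv_rl_kernel_1_at_top:
  assumes f: "causal f" and i: "integrable lborel f"
  shows "(conv (rl_kernel 1) f \<longlongrightarrow> (LINT y|lborel. f y)) at_top"
  unfolding conv_rl_kernel_1[OF f, abs_def] by (rule tendsto_integral_at_top[OF _ i]) simp

lemma conv_rl_kernel_conv_rl_kernel:
  assumes "Re \<mu> > 0" "Re \<nu> > 0" "causal f"
  shows "conv (rl_kernel \<mu>) (conv (rl_kernel \<nu>) f) = conv (rl_kernel (\<mu> + \<nu>)) f"
  using assms by (simp add: conv_assoc causal_rl_kernel conv_rl_kernel)

text \<open>By the semigroup law a factor \<open>rl_kernel 1\<close> splits off, and the fundamental
  theorem of calculus removes it. The remaining index \<open>\<mu> - 1\<close> must still have
  positive real part.\<close>

lemma has_vector_derivative_conv_rl_kernel: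
  assumes "Re \<mu> > 1" "causal f" "y > 0"
  shows "(conv (rl_kernel \<mu>) f has_vector_derivative conv (rl_kernel (\<mu> - 1)) f y) (at y)"
  using has_vector_derivative_conv_rl_kernel_1[of "conv (rl_kernel (\<mu> - 1)) f" y] assms conv_rl_kernel_conv_rl_kernel[of 1 "\<mu> - 1" f]
  by (simp add: causal_conv causal_rl_kernel)

text \<open>The constant of integration is recorded as a multiple of \<open>rl_kernel 1\<close>, so
  that later convolutions treat it like any other kernel.\<close>

lemma primitive_causal:
  assumes "\<And>y. y > 0 \<Longrightarrow> (f has_vector_derivative g y) (at y)" "causal g"
  obtains a where "\<And>y. y > 0 \<Longrightarrow> f y = a * rl_kernel 1 y + conv (rl_kernel 1) g y"
proof -
  have "((\<lambda>y. f y - conv (rl_kernel 1) g y) has_vector_derivative 0) (at y within {0<..})" if "y \<in> {0<..}" for y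
    using has_vector_derivative_diff[OF assms(1) has_vector_derivative_conv_rl_kernel_1[OF assms(2)], of y] that
    by (auto intro: has_vector_derivative_at_within)
  from has_vector_derivative_zero_constant[OF _ this]
  obtain a where "\<And>y. y \<in> {0<..} \<Longrightarrow> f y - conv (rl_kernel 1) g y = a" by (auto simp: is_interval_convex)
  thus ?thesis by (intro that[of a]) (auto simp: rl_kernel_def algebra_simps)
qed

text \<open>Integrating the expansion of the first derivative raises every index by one and adds one
  constant. Since the \<open>a l\<close> are constants of integration, no derivative is required to
  have a limit at 0.\<close>

lemma taylor_causal:
  assumes "m > 0" "\<And>j y. j < m \<Longrightarrow> y > 0 \<Longrightarrow> (W j has_vector_derivative W (Suc j) y) (at y)"
    and "causal V" "\<And>y. y > 0 \<Longrightarrow> W m y = V y"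
  obtains a where "\<And>y. y > 0 \<Longrightarrow>
    W 0 y = (\<Sum>l<m. a l * rl_kernel (of_nat l + 1) y) + conv (rl_kernel (of_nat m)) V y"
  using assms(1,2,4)
proof (induction m arbitrary: W thesis rule: nat_induct_non_zero)
  case 1
  have "(W 0 has_vector_derivative V y) (at y)" if "y > 0" for y
    using 1(2)[of 0 y] 1(3)[of y] that by simp
  from primitive_causal[OF this assms(3)]
  obtain a where "\<And>y. y > 0 \<Longrightarrow> W 0 y = a * rl_kernel 1 y + conv (rl_kernel 1) V y" by blast
  thus ?case by (intro 1(1)[of "\<lambda>_. a"]) auto
next
  case (Suc m)
  obtain a where a: "\<And>y. y > 0 \<Longrightarrow> W 1 y = (\<Sum>l<m. a l * rl_kernel (of_nat l + 1) y) + conv (rl_kernel (of_nat m)) V y"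
    using Suc.IH[of "\<lambda>j. W (Suc j)"] Suc.prems by auto
  define g where "g = (\<lambda>y. (\<Sum>l<m. a l * rl_kernel (of_nat l + 1) y) + conv (rl_kernel (of_nat m)) V y)"
  have cs: "causal (\<lambda>y. \<Sum>l<m. a l * rl_kernel (of_nat l + 1) y)"
    by (intro causal_sum causal_mult causal_rl_kernel) auto
  have cV: "causal (conv (rl_kernel (of_nat m)) V)"
    using Suc.hyps by (intro causal_conv causal_rl_kernel assms(3)) auto
  have "causal g" unfolding g_def by (intro causal_add cs cV)
  moreover have "(W 0 has_vector_derivative g y) (at y)" if "y > 0" for y
    using Suc.prems(2)[of 0 y] a[of y] that Suc.hyps by (simp add: g_def)
  ultimately obtain b where b: "\<And>y. y > 0 \<Longrightarrow> W 0 y = b * rl_kernel 1 y + conv (rl_kernel 1) g y"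
    using primitive_causal by metis
  have "conv (rl_kernel 1) g = (\<lambda>y. conv (rl_kernel 1) (\<lambda>y. \<Sum>l<m. a l * rl_kernel (of_nat l + 1) y) y + conv (rl_kernel 1) (conv (rl_kernel (of_nat m)) V) y)"
    unfolding g_def by (rule conv_add_right) (use cs cV causal_rl_kernel[of 1] in auto)
  also have "conv (rl_kernel 1) (\<lambda>y. \<Sum>l<m. a l * rl_kernel (of_nat l + 1) y) = (\<lambda>y. \<Sum>l<m. a l * rl_kernel (of_nat (Suc l) + 1) y)"
    by (subst conv_sum_right) (auto intro!: causal_rl_kernel causal_mult simp: conv_mult_right conv_rl_kernel add_ac)
  also have "conv (rl_kernel 1) (conv (rl_kernel (of_nat m)) V) = conv (rl_kernel (of_nat (Suc m))) V"
    using Suc.hyps by (subst conv_rl_kernel_conv_rl_kernel) (auto simp: assms(3))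
  finally have *: "conv (rl_kernel 1) g y = (\<Sum>l<m. a l * rl_kernel (of_nat (Suc l) + 1) y) + conv (rl_kernel (of_nat (Suc m))) V y" for y
    by simp
  show ?case
  proof (rule Suc.prems(1))
    fix y :: real assume "y > 0"
    \<comment> \<open>The new constant b takes position 0 and the old coefficients move up by
      one.\<close>
    show "W 0 y = (\<Sum>l<Suc m. (case l of 0 \<Rightarrow> b | Suc l \<Rightarrow> a l) * rl_kernel (of_nat l + 1) y) + conv (rl_kernel (of_nat (Suc m))) V y"
      unfolding b[OF \<open>y > 0\<close>] * sum.lessThan_Suc_shift by simp
  qed
qed

section \<open>Growth of the kernels and decay of boundary terms at infinity\<close>

text \<open>Restrict Euler's integral for \<open>Gamma x\<close> to \<open>u \<ge> t\<close>. There
  the power is at least its value at t because \<open>x \<ge> 1\<close>, and the exponential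
  integrates to \<open>exp (- t)\<close>.\<close>

lemma powr_le_exp_Gamma:
  fixes x t :: real
  assumes x: "x \<ge> 1" and t: "t \<ge> 0"
  shows "t powr (x - 1) \<le> exp t * Gamma x"
proof -
  have "((\<lambda>u. exp (- u)) has_integral exp (- t)) {t..}"
    using has_integral_exp_minus_to_infinity[of 1 t] by simp
  hence "((\<lambda>u. t powr (x - 1) * exp (- u)) has_integral t powr (x - 1) * exp (- t)) {t..}"
    by (rule has_integral_mult_right)
  hence 1: "((\<lambda>u. if u \<in> {t..} then t powr (x - 1) * exp (- u) else 0) has_integral t powr (x - 1) * exp (- t)) {0..}"
    using t by (subst has_integral_restrict) auto
  have 2: "((\<lambda>u. u powr (x - 1) / exp u) has_integral Gamma x) {0..}"
    using x by (intro Gamma_integral_real) auto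
  have "t powr (x - 1) * exp (- t) \<le> Gamma x"
  proof (rule has_integral_le[OF 1 2])
    fix u :: real assume "u \<in> {0..}"
    show "(if u \<in> {t..} then t powr (x - 1) * exp (- u) else 0) \<le> u powr (x - 1) / exp u"
      using x t by (auto simp: exp_minus field_simps intro!: powr_mono2)
  qed
  thus ?thesis by (simp add: exp_minus field_simps)
qed

text \<open>Using the previous bound at \<open>x + 1\<close> covers all positive x, at the price of
  the factor \<open>x / y\<close>. The parameter \<sigma> produces the geometric factor that later
  makes the series of kernels converge.\<close>

lemma powr_le_exp_scaled:
  fixes x y \<sigma> :: real
  assumes "x > 0" "y > 0" "\<sigma> > 0"
  shows "y powr (x - 1) \<le> x / y * Gamma x * exp (\<sigma> * y) * \<sigma> powr (- x)"
proof -
  have "(\<sigma> * y) powr (x + 1 - 1) \<le> exp (\<sigma> * y) * Gamma (x + 1)"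
    by (rule powr_le_exp_Gamma) (use assms in auto)
  also have "Gamma (x + 1) = x * Gamma x" using assms by (intro Gamma_plus1) (auto elim!: nonpos_Ints_cases)
  finally have "\<sigma> powr x * y powr x \<le> exp (\<sigma> * y) * (x * Gamma x)" using assms by (simp add: powr_mult)
  thus ?thesis using assms by (simp add: powr_diff powr_minus field_simps)
qed

lemma exp_decay_at_top:
  fixes f :: "real \<Rightarrow> complex"
  assumes "\<And>y. y \<ge> 1 \<Longrightarrow> norm (f y) \<le> C * exp (c * y)" "Re s > c"
  shows "((\<lambda>y. exp (- s * of_real y) * f y) \<longlongrightarrow> 0) at_top"
proof (rule Lim_null_comparison)
  show "\<forall>\<^sub>F y in at_top. norm (exp (- s * of_real y) * f y) \<le> C * exp (- (Re s - c) * y)"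
    using eventually_ge_at_top[of 1]
  proof eventually_elim
    case (elim y)
    have "norm (exp (- s * of_real y) * f y) \<le> exp (- Re s * y) * (C * exp (c * y))"
      unfolding norm_mult by (rule mult_mono) (use assms(1)[OF elim] in auto)
    also have "\<dots> = C * exp (- (Re s - c) * y)" by (simp add: algebra_simps flip: exp_add)
    finally show ?case .
  qed
  have "filterlim (\<lambda>y. - (Re s - c) * y) at_bot at_top"
    using assms(2) by (intro filterlim_tendsto_neg_mult_at_bot[OF tendsto_const] filterlim_ident) auto
  hence "((\<lambda>y. exp (- (Re s - c) * y)) \<longlongrightarrow> 0) at_top"
    by (rule filterlim_compose[OF exp_at_bot])
  from tendsto_mult_left[OF this, of C] show "((\<lambda>y. C * exp (- (Re s - c) * y)) \<longlongrightarrow> 0) at_top" by simp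
qed

lemma rl_kernel_decay:
  assumes "Re s > 0"
  shows "((\<lambda>y. exp (- s * of_real y) * rl_kernel \<mu> y) \<longlongrightarrow> 0) at_top"
proof (rule exp_decay_at_top[where c="Re s / 2"])
  \<comment> \<open>The real part of the index may be negative here; for \<open>y \<ge> 1\<close>
    the exponent can be raised to a value that the bound covers.\<close>
  define x where "x = max (Re \<mu>) 1"
  fix y :: real assume y: "y \<ge> 1"
  have "y powr (Re \<mu> - 1) \<le> y powr (x - 1)" using y by (intro powr_mono) (auto simp: x_def)
  also have "\<dots> \<le> x / y * Gamma x * exp (Re s / 2 * y) * (Re s / 2) powr (- x)"
    using y assms by (intro powr_le_exp_scaled) (auto simp: x_def)
  also have "\<dots> \<le> x / 1 * Gamma x * exp (Re s / 2 * y) * (Re s / 2) powr (- x)"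
    using y by (intro mult_right_mono divide_left_mono) (auto simp: x_def intro!: Gamma_real_pos less_imp_le)
  finally have "norm (rl_kernel \<mu> y) \<le> (x * Gamma x * exp (Re s / 2 * y) * (Re s / 2) powr (- x)) * norm (rGamma \<mu>)"
    using y by (simp add: norm_rl_kernel mult_right_mono)
  thus "norm (rl_kernel \<mu> y) \<le> (x * Gamma x * (Re s / 2) powr (- x) * norm (rGamma \<mu>)) * exp (Re s / 2 * y)"
    by (simp add: mult_ac)
qed (use assms in auto)

text \<open>Split \<open>exp (c * (y - t))\<close> into \<open>exp (c * y)\<close> and
  \<open>exp (- c * t)\<close>. The second factor turns the integral of the kernel into a finite
  constant, and the rate c is preserved.\<close>

lemma conv_rl_kernel_exp_bound:
  assumes \<mu>: "Re \<mu> > 0" and f: "causal f" and b: "\<And>y. y > 0 \<Longrightarrow> norm (f y) \<le> M * exp (c * y)"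
    and c: "c > 0"
  shows "norm (conv (rl_kernel \<mu>) f y) \<le> M * (LINT t|lborel. norm (exp (- of_real c * of_real t) * rl_kernel \<mu> t)) * exp (c * y)"
proof -
  have M: "M \<ge> 0" using order_trans[OF norm_ge_zero b[of 1]] by (simp add: zero_le_mult_iff)
  have "norm (conv f (rl_kernel \<mu>) y) \<le> (LINT t|lborel. M * exp (c * y) * norm (exp (- of_real c * of_real t) * rl_kernel \<mu> t))"
    unfolding conv_def
  proof (rule Bochner_Integration.integral_norm_bound_integral)
    show "integrable lborel (\<lambda>t. f (y - t) * rl_kernel \<mu> t)" by (intro conv_integrable f causal_rl_kernel \<mu>)
    have "lap_integrable (rl_kernel \<mu>) (of_real c)" using lap_integrable_rl_kernel[OF \<mu>, of "of_real c"] c by simp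
    thus "integrable lborel (\<lambda>t. M * exp (c * y) * norm (exp (- of_real c * of_real t) * rl_kernel \<mu> t))"
      unfolding lap_integrable_def by (intro integrable_mult_right integrable_norm)
    fix t
    have "norm (f (y - t)) \<le> M * exp (c * (y - t))"
      using b[of "y - t"] causal_eq_0[OF f, of "y - t"] M by (cases "y - t > 0") auto
    hence "norm (f (y - t)) * norm (rl_kernel \<mu> t) \<le> M * exp (c * (y - t)) * norm (rl_kernel \<mu> t)"
      by (rule mult_right_mono) auto
    thus "norm (f (y - t) * rl_kernel \<mu> t) \<le> M * exp (c * y) * norm (exp (- of_real c * of_real t) * rl_kernel \<mu> t)"
      by (simp add: norm_mult norm_divide exp_diff exp_minus field_simps)
  qed
  thus ?thesis by (simp add: conv_commute mult_ac)
qed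

lemma conv_rl_kernel_decay:
  assumes "Re \<mu> > 0" "causal f" "\<And>y. y > 0 \<Longrightarrow> norm (f y) \<le> M * exp (c * y)" "c > 0" "Re s > c"
  shows "((\<lambda>y. exp (- s * of_real y) * conv (rl_kernel \<mu>) f y) \<longlongrightarrow> 0) at_top"
  by (rule exp_decay_at_top[where c=c, OF _ assms(5)], rule conv_rl_kernel_exp_bound[OF assms(1-4)])

text \<open>The \<open>j\<close>-th derivative on \<open>(0,\<infinity>)\<close> of \<open>p\<^sub>z * w\<close>, where \<open>w\<close> has the Taylor expansion with coefficients \<open>a\<close> and
  remainder \<open>p\<^sub>m * V\<close>. The case distinction is needed because \<^term>\<open>rl_kernel 0\<close> is \<open>0\<close>, not the unit of the
  convolution; kernels whose index is a non-positive integer vanish likewise, as they should.\<close>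

definition expansion :: "nat \<Rightarrow> (nat \<Rightarrow> complex) \<Rightarrow> (real \<Rightarrow> complex) \<Rightarrow> complex \<Rightarrow> nat \<Rightarrow> real \<Rightarrow> complex" where
  "expansion m a V z j y = (\<Sum>l<m. a l * rl_kernel (z + of_nat l + 1 - of_nat j) y) +
     (if z = 0 \<and> j = m then V y else conv (rl_kernel (z + of_nat m - of_nat j)) V y)"

lemma has_vector_derivative_expansion:
  assumes V: "causal V" and z: "Re z > 0 \<or> z = 0" and j: "j < m" and y: "y > 0"
  shows "(expansion m a V z j has_vector_derivative expansion m a V z (Suc j) y) (at y)"
proof -
  have 1: "((\<lambda>y. \<Sum>l<m. a l * rl_kernel (z + of_nat l + 1 - of_nat j) y) has_vector_derivative
     (\<Sum>l<m. a l * rl_kernel (z + of_nat l + 1 - of_nat (Suc j)) y)) (at y)"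
  proof (intro has_vector_derivative_sum has_vector_derivative_mult_right)
    fix l
    show "(rl_kernel (z + of_nat l + 1 - of_nat j) has_vector_derivative rl_kernel (z + of_nat l + 1 - of_nat (Suc j)) y) (at y)"
      using has_vector_derivative_rl_kernel[OF y, of "z + of_nat l + 1 - of_nat j"] by (simp add: algebra_simps)
  qed
  \<comment> \<open>In the exceptional case the index falls from 1 to 0, and the derivative is V
    itself. Otherwise the index still has real part above 1 before differentiating.\<close>
  let ?d = "if z = 0 \<and> Suc j = m then V y else conv (rl_kernel (z + of_nat m - of_nat (Suc j))) V y"
  have 2: "((\<lambda>y. conv (rl_kernel (z + of_nat m - of_nat j)) V y) has_vector_derivative ?d) (at y)"
  proof (cases "z = 0 \<and> Suc j = m")
    case True
    hence "z + of_nat m - of_nat j = 1" by auto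
    thus ?thesis using has_vector_derivative_conv_rl_kernel_1[OF V y] True by simp
  next
    case False
    have "real m \<ge> real j + 1" using j by linarith
    moreover have "z = 0 \<Longrightarrow> real m \<ge> real j + 2" using False j by auto
    ultimately have "Re (z + of_nat m - of_nat j) > 1" using z by auto
    from has_vector_derivative_conv_rl_kernel[OF this V y]
    have "(conv (rl_kernel (z + of_nat m - of_nat j)) V has_vector_derivative
        conv (rl_kernel (z + of_nat m - of_nat (Suc j))) V y) (at y)"
      by (simp add: algebra_simps)
    thus ?thesis using False by auto
  qed
  have "expansion m a V z j = (\<lambda>y. (\<Sum>l<m. a l * rl_kernel (z + of_nat l + 1 - of_nat j) y) +
      conv (rl_kernel (z + of_nat m - of_nat j)) V y)"
    using j by (auto simp: expansion_def fun_eq_iff)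
  thus ?thesis unfolding expansion_def[of _ _ _ _ "Suc j"] using has_vector_derivative_add[OF 1 2] by simp
qed

lemma expansion_decay:
  assumes V: "causal V" and z: "Re z > 0 \<or> z = 0" and j: "j < m"
    and b: "\<And>y. y > 0 \<Longrightarrow> norm (V y) \<le> M * exp (c * y)" and c: "c > 0" and s: "Re s > c"
  shows "((\<lambda>y. exp (- s * of_real y) * expansion m a V z j y) \<longlongrightarrow> 0) at_top"
proof -
  have "Re (z + of_nat m - of_nat j) > 0" using z j by auto
  note 1 = conv_rl_kernel_decay[OF this V b c s]
  have "((\<lambda>y. (\<Sum>l<m. a l * (exp (- s * of_real y) * rl_kernel (z + of_nat l + 1 - of_nat j) y)) +
     exp (- s * of_real y) * conv (rl_kernel (z + of_nat m - of_nat j)) V y) \<longlongrightarrow> (\<Sum>l<m. a l * 0) + 0) at_top"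
    using c s by (intro tendsto_add tendsto_sum tendsto_mult_left rl_kernel_decay 1) auto
  moreover have "exp (- s * of_real y) * expansion m a V z j y =
    (\<Sum>l<m. a l * (exp (- s * of_real y) * rl_kernel (z + of_nat l + 1 - of_nat j) y)) +
     exp (- s * of_real y) * conv (rl_kernel (z + of_nat m - of_nat j)) V y" for y
    using j by (simp add: expansion_def distrib_left sum_distrib_left mult.left_commute)
  ultimately show ?thesis by simp
qed

text \<open>Before any differentiation all indices have positive real part, so the semigroup law
  applies termwise and adds z to each of them.\<close>

lemma expansion_0:
  assumes V: "causal V" and w: "causal w" and z: "Re z > 0" and m: "m > 0"
    and eq: "\<And>y. y > 0 \<Longrightarrow> w y = expansion m a V 0 0 y"
  shows "conv (rl_kernel z) w y = expansion m a V z 0 y"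
proof -
  let ?s = "\<lambda>y. \<Sum>l<m. a l * rl_kernel (of_nat l + 1) y" and ?V = "conv (rl_kernel (of_nat m)) V"
  have cs: "causal ?s" by (intro causal_sum causal_mult causal_rl_kernel) auto
  have cV: "causal ?V" using m by (intro causal_conv causal_rl_kernel V) auto
  have "w y = ?s y + ?V y" for y
    using eq[of y] causal_eq_0[OF w, of y] causal_eq_0[OF cs, of y] causal_eq_0[OF cV, of y] m
    by (cases "y > 0") (auto simp: expansion_def)
  hence w_eq: "w = (\<lambda>y. ?s y + ?V y)" by auto
  have "conv (rl_kernel z) w = (\<lambda>y. conv (rl_kernel z) ?s y + conv (rl_kernel z) ?V y)"
    unfolding w_eq using z by (intro conv_add_right cs cV causal_rl_kernel) auto
  also have "conv (rl_kernel z) ?s = (\<lambda>y. \<Sum>l<m. a l * rl_kernel (z + of_nat l + 1) y)"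
    using z by (subst conv_sum_right) (auto intro!: causal_rl_kernel causal_mult simp: conv_mult_right conv_rl_kernel add_ac)
  also have "conv (rl_kernel z) ?V = conv (rl_kernel (z + of_nat m)) V"
    using z m by (subst conv_rl_kernel_conv_rl_kernel) (auto simp: V)
  finally show ?thesis using m by (simp add: expansion_def)
qed

section \<open>The Gamma function compared with its values on the real axis\<close>

text \<open>A factor with real part X exceeds X in norm by at most the factor
  \<open>exp ((Im z)\<^sup>2 / X\<^sup>2)\<close>. For \<open>X > 1\<close> the exponents are summed
  by means of \<open>1 / X\<^sup>2 \<le> 1 / (X - 1) - 1 / X\<close>, which telescopes. The first
  factor, whose X may be at most 1, is kept apart and gives
  \<open>1 / (Re z)\<^sup>2\<close>.\<close>

lemma norm_pochhammer_le:
  fixes z :: complex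
  assumes "Re z > 0"
  shows "norm (pochhammer z (Suc n)) \<le>
     pochhammer (Re z) (Suc n) * exp ((Im z)\<^sup>2 * (1 / (Re z)\<^sup>2 + 1 / Re z - 1 / (Re z + real n)))"
proof (induction n)
  case 0
  have "norm z \<le> Re z * exp ((Im z)\<^sup>2 / (Re z)\<^sup>2)"
  proof (rule power2_le_imp_le)
    have "(norm z)\<^sup>2 = (Re z)\<^sup>2 * (1 + (Im z)\<^sup>2 / (Re z)\<^sup>2)"
      using assms unfolding cmod_power2 by (simp add: field_simps)
    also have "\<dots> \<le> (Re z)\<^sup>2 * (1 + (Im z)\<^sup>2 / (Re z)\<^sup>2)\<^sup>2"
      by (intro mult_left_mono self_le_power) auto
    also have "\<dots> \<le> (Re z)\<^sup>2 * (exp ((Im z)\<^sup>2 / (Re z)\<^sup>2))\<^sup>2"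
      by (intro mult_left_mono power_mono) (auto intro: exp_ge_add_one_self)
    finally show "(norm z)\<^sup>2 \<le> (Re z * exp ((Im z)\<^sup>2 / (Re z)\<^sup>2))\<^sup>2" by (simp add: power_mult_distrib)
  qed (use assms in auto)
  thus ?case by simp
next
  case (Suc n)
  define X where "X = Re z + real (Suc n)"
  have X: "X > 1" using assms by (simp add: X_def)
  have le: "norm (z + of_nat (Suc n)) \<le> X * exp ((Im z)\<^sup>2 * (1 / (X - 1) - 1 / X))"
  proof (rule power2_le_imp_le)
    have "(norm (z + of_nat (Suc n)))\<^sup>2 = X\<^sup>2 * (1 + (Im z)\<^sup>2 / X\<^sup>2)"
      using X unfolding cmod_power2 X_def by (simp add: field_simps)
    also have "\<dots> \<le> X\<^sup>2 * (1 + (Im z)\<^sup>2 / X\<^sup>2)\<^sup>2"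
      by (intro mult_left_mono self_le_power) auto
    also have "\<dots> \<le> X\<^sup>2 * (exp ((Im z)\<^sup>2 / X\<^sup>2))\<^sup>2"
      by (intro mult_left_mono power_mono) (auto intro: exp_ge_add_one_self)
    also have "\<dots> = (X * exp ((Im z)\<^sup>2 * (1 / X\<^sup>2)))\<^sup>2" by (simp add: power_mult_distrib)
    also have "1 / X\<^sup>2 \<le> 1 / (X - 1) - 1 / X" using X by (simp add: field_simps power2_eq_square)
    hence "(X * exp ((Im z)\<^sup>2 * (1 / X\<^sup>2)))\<^sup>2 \<le> (X * exp ((Im z)\<^sup>2 * (1 / (X - 1) - 1 / X)))\<^sup>2"
      using X by (intro power_mono mult_left_mono) (auto simp del: times_divide_eq_right intro!: mult_left_mono)
    finally show "(norm (z + of_nat (Suc n)))\<^sup>2 \<le> (X * exp ((Im z)\<^sup>2 * (1 / (X - 1) - 1 / X)))\<^sup>2" .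
  qed (use X in auto)
  have "norm (pochhammer z (Suc (Suc n))) = norm (pochhammer z (Suc n)) * norm (z + of_nat (Suc n))"
    by (simp only: pochhammer_Suc[of _ "Suc n"] norm_mult)
  also have "\<dots> \<le> (pochhammer (Re z) (Suc n) * exp ((Im z)\<^sup>2 * (1 / (Re z)\<^sup>2 + 1 / Re z - 1 / (Re z + real n)))) *
      (X * exp ((Im z)\<^sup>2 * (1 / (X - 1) - 1 / X)))"
    using assms by (intro mult_mono Suc.IH le mult_nonneg_nonneg pochhammer_nonneg) auto
  also have "\<dots> = (pochhammer (Re z) (Suc n) * X) * (exp ((Im z)\<^sup>2 * (1 / (Re z)\<^sup>2 + 1 / Re z - 1 / (Re z + real n))) *
       exp ((Im z)\<^sup>2 * (1 / (X - 1) - 1 / X)))" by (simp only: mult_ac)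
  also have "exp ((Im z)\<^sup>2 * (1 / (Re z)\<^sup>2 + 1 / Re z - 1 / (Re z + real n))) * exp ((Im z)\<^sup>2 * (1 / (X - 1) - 1 / X)) =
     exp ((Im z)\<^sup>2 * (1 / (Re z)\<^sup>2 + 1 / Re z - 1 / (Re z + real (Suc n))))"
    by (simp add: X_def algebra_simps flip: exp_add)
  also have "pochhammer (Re z) (Suc n) * X = pochhammer (Re z) (Suc (Suc n))"
    by (simp only: pochhammer_Suc[of _ "Suc n"] X_def)
  finally show ?case .
qed

text \<open>In the Gauss approximants \<open>Gamma_series\<close> the numerators at z and at
  \<open>Re z\<close> have the same norm, so only Pochhammer symbols are compared. The bound on
  these is uniform in n and survives the limit.\<close>

lemma Gamma_Re_le:
  fixes z :: complex
  assumes "Re z > 0"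
  shows "Gamma (Re z) \<le> norm (Gamma z) * exp ((Im z)\<^sup>2 * (1 / (Re z)\<^sup>2 + 1 / Re z))"
proof (rule tendsto_le[OF sequentially_bot _ Gamma_series_LIMSEQ])
  show "(\<lambda>n. norm (Gamma_series z n) * exp ((Im z)\<^sup>2 * (1 / (Re z)\<^sup>2 + 1 / Re z)))
      \<longlonglongrightarrow> norm (Gamma z) * exp ((Im z)\<^sup>2 * (1 / (Re z)\<^sup>2 + 1 / Re z))"
    by (intro tendsto_intros)
  show "\<forall>\<^sub>F n in sequentially. Gamma_series (Re z) n \<le>
       norm (Gamma_series z n) * exp ((Im z)\<^sup>2 * (1 / (Re z)\<^sup>2 + 1 / Re z))"
  proof (rule always_eventually, rule allI)
    fix n :: nat
    let ?E = "exp ((Im z)\<^sup>2 * (1 / (Re z)\<^sup>2 + 1 / Re z))"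
    define A where "A = fact n * exp (Re z * ln (real n))"
    have A: "A > 0" by (simp add: A_def)
    have px: "pochhammer (Re z) (Suc n) > 0" using assms by (rule pochhammer_pos)
    have pz: "norm (pochhammer z (Suc n)) > 0"
      using assms by (auto simp: pochhammer_eq_0_iff)
    have "norm (pochhammer z (Suc n)) \<le> pochhammer (Re z) (Suc n) *
        exp ((Im z)\<^sup>2 * (1 / (Re z)\<^sup>2 + 1 / Re z - 1 / (Re z + real n)))"
      by (rule norm_pochhammer_le[OF assms])
    also have "\<dots> \<le> pochhammer (Re z) (Suc n) * ?E"
      using px assms by (intro mult_left_mono) (auto intro!: mult_left_mono)
    finally have "A / pochhammer (Re z) (Suc n) \<le> A / norm (pochhammer z (Suc n)) * ?E"
      using A px pz by (simp add: field_simps del: pochhammer_Suc)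
    thus "Gamma_series (Re z) n \<le> norm (Gamma_series z n) * ?E"
      unfolding Gamma_series_def A_def by (simp add: norm_divide norm_mult del: pochhammer_Suc)
  qed
qed

section \<open>Series of kernels\<close>

text \<open>The factor between the norm of the kernel of index z and the kernel of the real index
  \<open>Re z\<close>. Absolute values of kernels are thereby again kernels, up to a
  constant.\<close>

definition rl_kernel_ratio :: "complex \<Rightarrow> real" where
  "rl_kernel_ratio z = Gamma (Re z) * norm (rGamma z)"

lemma norm_rl_kernel_eq: "Re z > 0 \<Longrightarrow> complex_of_real (norm (rl_kernel z y)) = of_real (rl_kernel_ratio z) * rl_kernel (of_real (Re z)) y"
  using Gamma_times_rGamma[of "of_real (Re z)"]
  by (cases "y > 0")
     (auto simp: norm_rl_kernel rl_kernel_ratio_def, auto simp: rl_kernel_def Gamma_complex_of_real mult_ac simp flip: powr_of_real)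

lemma rl_kernel_ratio_nonneg: "Re z > 0 \<Longrightarrow> rl_kernel_ratio z \<ge> 0"
  by (simp add: rl_kernel_ratio_def Gamma_real_pos less_imp_le)

lemma rl_kernel_ratio_le:
  assumes "Re z > 0"
  shows "rl_kernel_ratio z \<le> exp ((Im z)\<^sup>2 * (1 / (Re z)\<^sup>2 + 1 / Re z))"
proof -
  have "rl_kernel_ratio z \<le> norm (Gamma z) * exp ((Im z)\<^sup>2 * (1 / (Re z)\<^sup>2 + 1 / Re z)) * norm (rGamma z)"
    unfolding rl_kernel_ratio_def by (intro mult_right_mono Gamma_Re_le assms) auto
  also have "\<dots> = norm (Gamma z * rGamma z) * exp ((Im z)\<^sup>2 * (1 / (Re z)\<^sup>2 + 1 / Re z))"
    by (simp add: norm_mult)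
  finally show ?thesis using Gamma_times_rGamma[OF assms] by simp
qed

lemma rl_kernel_ratio_of_real: "x > 0 \<Longrightarrow> rl_kernel_ratio (of_real x) = 1"
proof -
  assume x: "x > 0"
  have "rl_kernel_ratio (of_real x) = norm (Gamma (complex_of_real x) * rGamma (of_real x))"
    using Gamma_real_pos[OF x] by (simp add: rl_kernel_ratio_def norm_mult Gamma_complex_of_real)
  thus ?thesis using Gamma_times_rGamma[of "of_real x"] x by simp
qed

lemma norm_rl_kernel_le:
  assumes z: "Re z > 0" and y: "y > 0" and \<sigma>: "\<sigma> > 0"
  shows "norm (rl_kernel z y) \<le> rl_kernel_ratio z * Re z * \<sigma> powr (- Re z) * (exp (\<sigma> * y) / y)"
proof -
  have "norm (rl_kernel z y) = y powr (Re z - 1) * norm (rGamma z)" using y by (simp add: norm_rl_kernel)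
  also have "\<dots> \<le> (Re z / y * Gamma (Re z) * exp (\<sigma> * y) * \<sigma> powr (- Re z)) * norm (rGamma z)"
    by (intro mult_right_mono powr_le_exp_scaled assms) auto
  finally show ?thesis by (simp add: rl_kernel_ratio_def mult_ac)
qed

lemma integral_norm_rl_kernel:
  assumes z: "Re z > 0" and s: "Re s > 0"
  shows "(LINT y|lborel. norm (exp (- s * of_real y) * rl_kernel z y)) = rl_kernel_ratio z * Re s powr (- Re z)"
proof -
  have "complex_of_real (LINT y|lborel. norm (exp (- s * of_real y) * rl_kernel z y)) =
      (LINT y|lborel. of_real (rl_kernel_ratio z) * (exp (- of_real (Re s) * of_real y) * rl_kernel (of_real (Re z)) y))"
    unfolding integral_complex_of_real[symmetric]
    by (intro Bochner_Integration.integral_cong) (auto simp: norm_mult norm_rl_kernel_eq[OF z] mult_ac simp flip: exp_of_real)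
  also have "\<dots> = of_real (rl_kernel_ratio z) * lap (rl_kernel (of_real (Re z))) (of_real (Re s))"
    by (simp add: lap_def)
  also have "lap (rl_kernel (of_real (Re z))) (of_real (Re s)) = of_real (Re s powr (- Re z))"
    using lap_rl_kernel_real[of "of_real (Re z)" "Re s"] assms by (simp flip: powr_of_real)
  finally show ?thesis by (simp only: of_real_eq_iff flip: of_real_mult)
qed

text \<open>The summand combines what the estimates cost: the ratio for passing to absolute values,
  the power of \<sigma> for the Laplace transform at \<sigma>, and the linear factor for the
  pointwise bound and for convolution with a further kernel.\<close>

locale rl_kernel_series =
  fixes d z :: "nat \<Rightarrow> complex" and \<sigma> :: real
  assumes z: "\<And>n. Re (z n) > 0" and \<sigma>: "\<sigma> > 0"
    and summable_weights:
      "summable (\<lambda>n. norm (d n) * rl_kernel_ratio (z n) * (1 + Re (z n)) * \<sigma> powr (- Re (z n)))"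
begin

definition kernel :: "real \<Rightarrow> complex" where
  "kernel y = (\<Sum>n. d n * rl_kernel (z n) y)"

definition weight :: "nat \<Rightarrow> real" where
  "weight n = norm (d n) * rl_kernel_ratio (z n) * (1 + Re (z n)) * \<sigma> powr (- Re (z n))"

lemma summable_weight: "summable weight"
  using summable_weights by (simp add: weight_def[abs_def])

lemma norm_term_le:
  assumes "y > 0"
  shows "norm (d n * rl_kernel (z n) y) \<le> weight n * (exp (\<sigma> * y) / y)"
proof -
  have "norm (rl_kernel (z n) y) \<le> rl_kernel_ratio (z n) * Re (z n) * \<sigma> powr (- Re (z n)) * (exp (\<sigma> * y) / y)"
    by (rule norm_rl_kernel_le[OF z assms \<sigma>])
  also have "\<dots> \<le> rl_kernel_ratio (z n) * (1 + Re (z n)) * \<sigma> powr (- Re (z n)) * (exp (\<sigma> * y) / y)"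
    using assms z[of n] by (intro mult_right_mono mult_left_mono rl_kernel_ratio_nonneg z) auto
  finally have "norm (d n) * norm (rl_kernel (z n) y) \<le>
      norm (d n) * (rl_kernel_ratio (z n) * (1 + Re (z n)) * \<sigma> powr (- Re (z n)) * (exp (\<sigma> * y) / y))"
    by (rule mult_left_mono) auto
  thus ?thesis by (simp add: norm_mult weight_def mult.assoc)
qed

lemma summable_terms: "summable (\<lambda>n. norm (d n * rl_kernel (z n) y))"
proof (cases "y > 0")
  case True
  show ?thesis
    by (rule summable_comparison_test_ev[OF _ summable_mult2[OF summable_weight, of "exp (\<sigma> * y) / y"]],
        rule always_eventually) (use norm_term_le[OF True] in auto)
qed auto

lemma kernel_nonpos: "y \<le> 0 \<Longrightarrow> kernel y = 0"
  by (simp add: kernel_def)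

lemma continuous_on_kernel: "continuous_on {0<..} kernel"
proof (rule continuous_at_imp_continuous_on, rule ballI)
  fix y :: real assume "y \<in> {0<..}"
  hence y: "y > 0" by simp
  have "uniform_limit {y/2..2*y} (\<lambda>n t. \<Sum>i<n. d i * rl_kernel (z i) t) (\<lambda>t. \<Sum>i. d i * rl_kernel (z i) t) sequentially"
  proof (rule Weierstrass_m_test)
    show "summable (\<lambda>n. weight n * (exp (\<sigma> * (2*y)) / (y/2)))"
      by (intro summable_mult2 summable_weight)
    fix n t assume t: "t \<in> {y/2..2*y}"
    have "norm (d n * rl_kernel (z n) t) \<le> weight n * (exp (\<sigma> * t) / t)"
      using t y by (intro norm_term_le) auto
    also have "\<dots> \<le> weight n * (exp (\<sigma> * (2*y)) / (y/2))"
      using t y \<sigma> z[of n] by (intro mult_left_mono frac_le) (auto simp: weight_def intro!: mult_nonneg_nonneg rl_kernel_ratio_nonneg)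
    finally show "norm (d n * rl_kernel (z n) t) \<le> weight n * (exp (\<sigma> * (2*y)) / (y/2))" .
  qed
  moreover have "continuous_on {y/2..2*y} (\<lambda>t. \<Sum>i<n. d i * rl_kernel (z i) t)" for n
    using y by (intro continuous_on_sum continuous_on_mult_left continuous_on_subset[OF continuous_on_rl_kernel]) auto
  ultimately have "continuous_on {y/2..2*y} kernel"
    unfolding kernel_def[abs_def] by (intro uniform_limit_theorem[where F=sequentially]) auto
  thus "isCont kernel y" using y by (intro continuous_on_interior[of "{y/2..2*y}"]) auto
qed

text \<open>The pointwise majorant contains \<open>1 / y\<close> and is not integrable at 0.
  Integrability comes from the integrals of the absolute values instead: each is a real-index
  transform at \<open>Re s\<close>, which decreases in \<open>Re s\<close> and is summable at
  \<sigma>.\<close>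

lemma
  assumes s: "Re s \<ge> \<sigma>"
  shows lap_integrable_kernel: "lap_integrable kernel s"
    and lap_kernel: "(\<lambda>n. d n * s powr (- z n)) sums lap kernel s"
proof -
  let ?f = "\<lambda>n y. exp (- s * of_real y) * (d n * rl_kernel (z n) y)"
  have s0: "Re s > 0" using s \<sigma> by simp
  have i: "integrable lborel (?f n)" for n
    using integrable_mult_right[OF lap_integrable_rl_kernel[OF z s0, unfolded lap_integrable_def], of "d n"]
    by (simp add: mult_ac)
  have ae: "AE y in lborel. summable (\<lambda>n. norm (?f n y))"
  proof (rule AE_I2)
    fix y
    show "summable (\<lambda>n. norm (?f n y))"
      using summable_mult[OF summable_terms[of y], of "norm (exp (- s * of_real y))"] by (simp add: norm_mult)
  qed
  have su: "summable (\<lambda>n. LINT y|lborel. norm (?f n y))"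
  proof (rule summable_comparison_test_ev[OF _ summable_weight])
    show "\<forall>\<^sub>F n in sequentially. norm (LINT y|lborel. norm (?f n y)) \<le> weight n"
    proof (rule always_eventually, rule allI)
      fix n
      have "(LINT y|lborel. norm (?f n y)) = (LINT y|lborel. norm (d n) * norm (exp (- s * of_real y) * rl_kernel (z n) y))"
        by (intro Bochner_Integration.integral_cong) (auto simp: norm_mult mult_ac)
      also have "\<dots> = norm (d n) * (rl_kernel_ratio (z n) * Re s powr (- Re (z n)))"
        by (subst Bochner_Integration.integral_mult_right_zero, subst integral_norm_rl_kernel[OF z s0]) (rule refl)
      also have "\<dots> \<le> norm (d n) * (rl_kernel_ratio (z n) * \<sigma> powr (- Re (z n)))"
        using z[of n] s \<sigma> by (intro mult_left_mono rl_kernel_ratio_nonneg powr_mono2') auto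
      also have "\<dots> \<le> norm (d n) * (rl_kernel_ratio (z n) * \<sigma> powr (- Re (z n))) * (1 + Re (z n))"
        using z[of n] rl_kernel_ratio_nonneg[OF z, of n]
        by (subst (1) mult_1_right[symmetric]) (intro mult_left_mono, auto)
      finally show "norm (LINT y|lborel. norm (?f n y)) \<le> weight n" by (simp add: weight_def mult_ac)
    qed
  qed
  have eq: "(\<lambda>y. \<Sum>n. ?f n y) = (\<lambda>y. exp (- s * of_real y) * kernel y)"
    unfolding kernel_def using suminf_mult[OF summable_norm_cancel[OF summable_terms]] by auto
  show "lap_integrable kernel s"
    unfolding lap_integrable_def using integrable_suminf[OF i ae su] unfolding eq .
  have "(LINT y|lborel. ?f n y) = d n * s powr (- z n)" for n
    using lap_rl_kernel[OF z s0, of n] by (simp add: lap_def mult.left_commute)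
  with sums_integral[OF i ae su] show "(\<lambda>n. d n * s powr (- z n)) sums lap kernel s"
    unfolding eq by (simp add: lap_def)
qed

lemma causal_kernel: "causal kernel"
  by (rule causalI_lap_integrable[OF kernel_nonpos continuous_on_kernel lap_integrable_kernel[of "of_real \<sigma>"]]) auto

text \<open>Serves to recognise the convolution with the kernel of index m as the tail of the kernel
  in the generalised integral.\<close>

lemma conv_rl_kernel_kernel:
  assumes \<mu>: "Re \<mu> > 0" and y: "y > 0"
  shows "(\<lambda>n. d n * rl_kernel (\<mu> + z n) y) sums conv (rl_kernel \<mu>) kernel y"
proof -
  let ?f = "\<lambda>n t. rl_kernel \<mu> (y - t) * (d n * rl_kernel (z n) t)"
  have c: "causal (\<lambda>t. d n * rl_kernel (z n) t)" for n by (intro causal_mult causal_rl_kernel z)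
  have i: "integrable lborel (?f n)" for n by (intro conv_integrable c causal_rl_kernel \<mu>)
  have ae: "AE t in lborel. summable (\<lambda>n. norm (?f n t))"
  proof (rule AE_I2)
    fix t
    show "summable (\<lambda>n. norm (?f n t))"
      using summable_mult[OF summable_terms[of t], of "norm (rl_kernel \<mu> (y - t))"] by (simp add: norm_mult)
  qed
  define D where "D = rl_kernel_ratio \<mu> * (1 + Re \<mu>) * \<sigma> powr (- Re \<mu>) * (exp (\<sigma> * y) / y)"
  have su: "summable (\<lambda>n. LINT t|lborel. norm (?f n t))"
  proof (rule summable_comparison_test_ev[OF _ summable_mult2[OF summable_weight, of D]])
    show "\<forall>\<^sub>F n in sequentially. norm (LINT t|lborel. norm (?f n t)) \<le> weight n * D"
    proof (rule always_eventually, rule allI)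
      fix n
      let ?x = "Re \<mu> + Re (z n)"
      \<comment> \<open>Up to ratios, the norms are kernels of real index; their convolution is
        known by the semigroup law and is then bounded pointwise at y.\<close>
      have "complex_of_real (LINT t|lborel. norm (?f n t)) =
          (LINT t|lborel. of_real (norm (d n) * rl_kernel_ratio \<mu> * rl_kernel_ratio (z n)) *
             (rl_kernel (of_real (Re \<mu>)) (y - t) * rl_kernel (of_real (Re (z n))) t))"
        unfolding integral_complex_of_real[symmetric]
        by (intro Bochner_Integration.integral_cong) (auto simp: norm_mult norm_rl_kernel_eq[OF z] norm_rl_kernel_eq[OF \<mu>] mult_ac)
      also have "\<dots> = of_real (norm (d n) * rl_kernel_ratio \<mu> * rl_kernel_ratio (z n)) * rl_kernel (of_real ?x) y"
        using conv_rl_kernel[of "of_real (Re \<mu>)" "of_real (Re (z n))"] z[of n] \<mu> by (simp flip: conv_def)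
      finally have "norm (complex_of_real (LINT t|lborel. norm (?f n t))) =
          norm (d n) * rl_kernel_ratio \<mu> * rl_kernel_ratio (z n) * norm (rl_kernel (of_real ?x) y)"
        using rl_kernel_ratio_nonneg[OF z] rl_kernel_ratio_nonneg[OF \<mu>] by (simp only: norm_mult norm_of_real abs_mult abs_of_nonneg abs_norm_cancel)
      hence "norm (LINT t|lborel. norm (?f n t)) =
          norm (d n) * rl_kernel_ratio \<mu> * rl_kernel_ratio (z n) * norm (rl_kernel (of_real ?x) y)"
        by (simp only: norm_of_real real_norm_def)
      also have "norm (rl_kernel (of_real ?x) y) \<le> ?x * \<sigma> powr (- ?x) * (exp (\<sigma> * y) / y)"
      proof -
        have "rl_kernel_ratio (of_real ?x) = 1" using \<mu> z[of n] by (intro rl_kernel_ratio_of_real) simp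
        thus ?thesis using norm_rl_kernel_le[of "of_real ?x" y \<sigma>] \<mu> z[of n] y \<sigma> by simp
      qed
      \<comment> \<open>The sum \<open>Re \<mu> + Re (z n)\<close> is at most
        \<open>(1 + Re \<mu>) * (1 + Re (z n))\<close>, which separates the part depending on n from
        the constant D.\<close>
      also have "?x * \<sigma> powr (- ?x) * (exp (\<sigma> * y) / y) \<le>
          ((1 + Re \<mu>) * (1 + Re (z n))) * (\<sigma> powr (- Re \<mu>) * \<sigma> powr (- Re (z n))) * (exp (\<sigma> * y) / y)"
        using \<mu> z[of n] y by (intro mult_right_mono mult_mono) (auto simp: algebra_simps simp flip: powr_add)
      finally have "norm (LINT t|lborel. norm (?f n t)) \<le> norm (d n) * rl_kernel_ratio \<mu> * rl_kernel_ratio (z n) *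
          (((1 + Re \<mu>) * (1 + Re (z n))) * (\<sigma> powr (- Re \<mu>) * \<sigma> powr (- Re (z n))) * (exp (\<sigma> * y) / y))"
        using rl_kernel_ratio_nonneg[OF z, of n] rl_kernel_ratio_nonneg[OF \<mu>] by (simp add: mult_left_mono)
      thus "norm (LINT t|lborel. norm (?f n t)) \<le> weight n * D"
        by (simp only: weight_def D_def mult_ac)
    qed
  qed
  have eq: "(LINT t|lborel. (\<Sum>n. ?f n t)) = conv (rl_kernel \<mu>) kernel y"
    unfolding conv_def kernel_def using suminf_mult[OF summable_norm_cancel[OF summable_terms]] by simp
  have "(LINT t|lborel. ?f n t) = d n * rl_kernel (\<mu> + z n) y" for n
    using fun_cong[OF conv_rl_kernel[OF \<mu> z], of n y] by (simp add: conv_def mult.left_commute)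
  with sums_integral[OF i ae su] show ?thesis unfolding eq by simp
qed

end

text \<open>Apart from the power of \<sigma>, all factors of the weight grow at most geometrically
  in n. That power decays geometrically, at a rate that a large \<sigma> makes as fast as
  required.\<close>

lemma rl_kernel_series_exists:
  fixes \<beta> z\<^sub>0 :: complex and d :: "nat \<Rightarrow> complex"
  assumes \<beta>: "Re \<beta> > 0" and z0: "Re z\<^sub>0 > 0" and d: "\<And>n. norm (d n) \<le> C * \<rho> ^ n" and \<rho>: "\<rho> > 0"
  shows "\<exists>\<sigma>. rl_kernel_series d (\<lambda>n. \<beta> * of_nat n + z\<^sub>0) \<sigma>"
proof -
  define z where "z n = \<beta> * of_nat n + z\<^sub>0" for n
  \<comment> \<open>\<delta> and L bound \<open>Re (z n)\<close> from below and
    \<open>norm (z n)\<close> from above by multiples of \<open>n + 1\<close>. Hence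
    \<open>(Im (z n))\<^sup>2 / Re (z n)\<close> is at most \<open>L\<^sup>2 / \<delta>\<close>
    times \<open>n + 1\<close>, and F is the resulting growth factor of the ratios.\<close>
  define \<delta> where "\<delta> = min (Re \<beta>) (Re z\<^sub>0)"
  define L where "L = norm \<beta> + norm z\<^sub>0"
  define F where "F = exp (L\<^sup>2 / \<delta>)"
  \<comment> \<open>This gives \<open>\<sigma> powr \<delta> \<ge> 4 * \<rho> * F\<close>: \<rho>
    absorbs the coefficients, F the ratios, one factor 2 the linear term, and the other 2 leaves a
    geometric series of ratio 1/2.\<close>
  define \<sigma> where "\<sigma> = max 1 ((4 * \<rho> * F) powr (1 / \<delta>))"
  have \<delta>: "\<delta> > 0" using assms by (simp add: \<delta>_def)
  have L0: "L \<ge> 0" by (simp add: L_def)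
  have F: "F > 0" by (simp add: F_def)
  have \<sigma>1: "\<sigma> \<ge> 1" by (simp add: \<sigma>_def)
  have C: "C \<ge> 0" using order_trans[OF norm_ge_zero d[of 0]] by simp
  have z_ge: "Re (z n) \<ge> \<delta> * (real n + 1)" for n
  proof -
    have "\<delta> * real n \<le> Re \<beta> * real n" by (intro mult_right_mono) (auto simp: \<delta>_def)
    moreover have "\<delta> \<le> Re z\<^sub>0" by (simp add: \<delta>_def)
    ultimately show ?thesis by (simp add: z_def algebra_simps)
  qed
  have z_pos: "Re (z n) > 0" for n using less_le_trans[OF _ z_ge[of n]] \<delta> by simp
  have z_le: "norm (z n) \<le> L * (real n + 1)" for n
  proof -
    have "norm (z n) \<le> norm \<beta> * real n + norm z\<^sub>0"
      unfolding z_def by (rule order_trans[OF norm_triangle_ineq]) (simp add: norm_mult)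
    also have "\<dots> \<le> L * (real n + 1)" by (simp add: L_def algebra_simps)
    finally show ?thesis .
  qed
  have ratio: "rl_kernel_ratio (z n) \<le> exp ((L / \<delta>)\<^sup>2) * F * F ^ n" for n
  proof -
    let ?N = "real n + 1"
    have "(Im (z n))\<^sup>2 \<le> (L * ?N)\<^sup>2"
      using abs_Im_le_cmod[of "z n"] z_le[of n] L0 by (intro abs_le_square_iff[THEN iffD1]) auto
    moreover have "1 / (Re (z n))\<^sup>2 + 1 / Re (z n) \<le> 1 / (\<delta> * ?N)\<^sup>2 + 1 / (\<delta> * ?N)"
      using z_ge[of n] z_pos[of n] \<delta> by (intro add_mono divide_left_mono power_mono mult_pos_pos zero_less_power) auto
    ultimately have "(Im (z n))\<^sup>2 * (1 / (Re (z n))\<^sup>2 + 1 / Re (z n)) \<le> (L * ?N)\<^sup>2 * (1 / (\<delta> * ?N)\<^sup>2 + 1 / (\<delta> * ?N))"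
      using z_pos[of n] by (intro mult_mono) auto
    also have "\<dots> = (L / \<delta>)\<^sup>2 + L\<^sup>2 / \<delta> + real n * (L\<^sup>2 / \<delta>)"
    proof -
      have "(L * N)\<^sup>2 * (1 / (\<delta> * N)\<^sup>2 + 1 / (\<delta> * N)) = (L / \<delta>)\<^sup>2 + L\<^sup>2 / \<delta> * N" if "N > 0" for N
        using \<delta> that by (simp add: field_simps power2_eq_square)
      hence "(L * ?N)\<^sup>2 * (1 / (\<delta> * ?N)\<^sup>2 + 1 / (\<delta> * ?N)) = (L / \<delta>)\<^sup>2 + L\<^sup>2 / \<delta> * ?N" by simp
      also have "\<dots> = (L / \<delta>)\<^sup>2 + L\<^sup>2 / \<delta> + real n * (L\<^sup>2 / \<delta>)" by (simp only: distrib_left mult_1_right mult.commute[of "real n"] add.assoc)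
      finally show ?thesis .
    qed
    finally have "rl_kernel_ratio (z n) \<le> exp ((L / \<delta>)\<^sup>2 + L\<^sup>2 / \<delta> + real n * (L\<^sup>2 / \<delta>))"
      using rl_kernel_ratio_le[OF z_pos[of n]] by (meson exp_le_cancel_iff order_trans)
    thus ?thesis unfolding F_def exp_add exp_of_nat_mult .
  qed
  have lin: "1 + Re (z n) \<le> (1 + L) * 2 ^ n" for n
  proof -
    have "1 + Re (z n) \<le> 1 + L * (real n + 1)" using complex_Re_le_cmod[of "z n"] z_le[of n] by linarith
    also have "\<dots> \<le> (1 + L) * (real n + 1)" by (simp add: algebra_simps)
    also have "real n + 1 \<le> 2 ^ n" using less_exp[of n] by (metis Suc_leI of_nat_Suc of_nat_le_iff of_nat_numeral of_nat_power add.commute)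
    hence "(1 + L) * (real n + 1) \<le> (1 + L) * 2 ^ n" using L0 by (intro mult_left_mono) auto
    finally show ?thesis .
  qed
  have pw: "\<sigma> powr (- Re (z n)) \<le> (1 / (4 * \<rho> * F)) ^ n" for n
  proof -
    have "4 * \<rho> * F = ((4 * \<rho> * F) powr (1 / \<delta>)) powr \<delta>" using \<rho> F \<delta> by (simp add: powr_powr)
    also have "\<dots> \<le> \<sigma> powr \<delta>" using \<delta> by (intro powr_mono2) (auto simp: \<sigma>_def)
    finally have 1: "4 * \<rho> * F \<le> \<sigma> powr \<delta>" .
    have "\<delta> * real n \<le> Re (z n)" using z_ge[of n] \<delta> by (simp add: algebra_simps)
    hence "\<sigma> powr (- Re (z n)) \<le> \<sigma> powr (- (\<delta> * real n))" using \<sigma>1 by (intro powr_mono) auto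
    also have "\<dots> = (1 / (\<sigma> powr \<delta>)) ^ n"
      using \<sigma>1 by (simp add: powr_minus powr_powr[symmetric] powr_realpow power_divide divide_inverse power_inverse)
    also have "\<dots> \<le> (1 / (4 * \<rho> * F)) ^ n"
      using 1 \<rho> F \<sigma>1 by (intro power_mono divide_left_mono) auto
    finally show ?thesis .
  qed
  have "summable (\<lambda>n. norm (d n) * rl_kernel_ratio (z n) * (1 + Re (z n)) * \<sigma> powr (- Re (z n)))"
  proof (rule summable_comparison_test_ev)
    show "summable (\<lambda>n. (C * (exp ((L / \<delta>)\<^sup>2) * F) * (1 + L)) * (1/2) ^ n)"
      by (intro summable_mult summable_geometric) auto
    show "\<forall>\<^sub>F n in sequentially. norm (norm (d n) * rl_kernel_ratio (z n) * (1 + Re (z n)) * \<sigma> powr (- Re (z n)))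
        \<le> (C * (exp ((L / \<delta>)\<^sup>2) * F) * (1 + L)) * (1/2) ^ n"
    proof (rule always_eventually, rule allI)
      fix n
      have "norm (norm (d n) * rl_kernel_ratio (z n) * (1 + Re (z n)) * \<sigma> powr (- Re (z n))) =
          norm (d n) * rl_kernel_ratio (z n) * (1 + Re (z n)) * \<sigma> powr (- Re (z n))"
        using rl_kernel_ratio_nonneg[OF z_pos[of n]] z_pos[of n] by (simp add: abs_mult)
      also have "\<dots> \<le> (C * \<rho> ^ n) * (exp ((L / \<delta>)\<^sup>2) * F * F ^ n) * ((1 + L) * 2 ^ n) * (1 / (4 * \<rho> * F)) ^ n"
        using rl_kernel_ratio_nonneg[OF z_pos[of n]] z_pos[of n] C \<rho> F L0
        by (intro mult_mono d ratio lin pw mult_nonneg_nonneg) auto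
      also have "\<dots> = (C * (exp ((L / \<delta>)\<^sup>2) * F) * (1 + L)) * (\<rho> * F * 2 * (1 / (4 * \<rho> * F))) ^ n"
        by (simp only: power_mult_distrib mult_ac)
      also have "\<rho> * F * 2 * (1 / (4 * \<rho> * F)) = 1/2" using \<rho> F by (simp add: field_simps)
      finally show "norm (norm (d n) * rl_kernel_ratio (z n) * (1 + Re (z n)) * \<sigma> powr (- Re (z n)))
        \<le> (C * (exp ((L / \<delta>)\<^sup>2) * F) * (1 + L)) * (1/2) ^ n" .
    qed
  qed
  hence "rl_kernel_series d z \<sigma>" using z_pos \<sigma>1 by unfold_locales auto
  thus ?thesis unfolding z_def[abs_def] by blast
qed

section \<open>Change of variables\<close>

text \<open>One direction of Hake's theorem at infinity: convergence of the integrals over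
  \<open>{0..b}\<close> suffices, without absolute integrability. Extending f by 0 makes left
  endpoints below 0 irrelevant.\<close>

lemma has_integral_halflineI:
  fixes f :: "real \<Rightarrow> complex"
  assumes I: "\<And>b. b > 0 \<Longrightarrow> (f has_integral I b) {0..b}" and J: "(I \<longlongrightarrow> J) at_top"
  shows "(f has_integral J) {0..}"
proof -
  define h where "h = (\<lambda>x. if x \<in> {0..} then f x else 0)"
  have h: "(h has_integral I c) {a..c}" if "c > 0" "a \<le> 0" for a c
  proof -
    have "((\<lambda>x. if x \<in> {0..c} then f x else 0) has_integral I c) {a..c}"
      using I[OF that(1)] that by (subst has_integral_restrict) auto
    thus ?thesis by (rule has_integral_eq[rotated]) (auto simp: h_def)
  qed
  show ?thesis unfolding has_integral_alt' h_def[symmetric]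
  proof (intro conjI allI impI)
    fix a b :: real
    have "h integrable_on {min a 0..max b 1}" using h[of "max b 1" "min a 0"] unfolding integrable_on_def by (intro exI[of _ "I (max b 1)"]) simp
    thus "h integrable_on cbox a b" unfolding cbox_interval by (rule integrable_subinterval_real) auto
  next
    fix e :: real assume "e > 0"
    from tendstoD[OF J this] obtain B where B: "\<And>b. b \<ge> B \<Longrightarrow> dist (I b) J < e"
      by (auto simp: eventually_at_top_linorder)
    define B' where "B' = max B 1"
    show "\<exists>B>0. \<forall>a b. ball 0 B \<subseteq> cbox a b \<longrightarrow> norm (integral (cbox a b) h - J) < e"
    proof (intro exI[of _ "B' + 1"] conjI allI impI)
      fix a b :: real assume sub: "ball 0 (B' + 1) \<subseteq> cbox a b"
      have "0 \<in> ball 0 (B' + 1)" "B' \<in> ball 0 (B' + 1)" by (auto simp: B'_def)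
      hence "0 \<in> cbox a b" "B' \<in> cbox a b" using sub by blast+
      hence ab: "a \<le> 0" "B' \<le> b" by auto
      hence b: "b > 0" "b \<ge> B" by (auto simp: B'_def)
      show "norm (integral (cbox a b) h - J) < e"
        using integral_unique[OF h[OF b(1) ab(1)]] B[OF b(2)] by (simp add: dist_norm)
    qed (auto simp: B'_def)
  qed
qed

text \<open>The composition of g with the primitive of F is differentiated. Continuity of F is
  demanded in the open interval only, which admits integrands that are singular at both
  ends.\<close>

lemma has_integral_substitution_FTC:
  fixes F :: "real \<Rightarrow> 'a::banach"
  assumes ab: "a \<le> b" and g: "continuous_on {a..b} g"
    and g': "\<And>x. x \<in> {a<..<b} \<Longrightarrow> (g has_real_derivative g' x) (at x)"
    and mono: "\<And>x. x \<in> {a<..<b} \<Longrightarrow> g x \<in> {g a<..<g b}" and gab: "g a \<le> g b"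
    and F: "continuous_on {g a<..<g b} F" "F integrable_on {g a..g b}"
  shows "((\<lambda>x. g' x *\<^sub>R F (g x)) has_integral integral {g a..g b} F) {a..b}"
proof -
  define Q where "Q y = integral {g a..y} F" for y
  have Q: "continuous_on {g a..g b} Q"
    unfolding Q_def by (rule indefinite_integral_continuous_1[OF F(2)])
  have "((\<lambda>x. g' x *\<^sub>R F (g x)) has_integral (Q \<circ> g) b - (Q \<circ> g) a) {a..b}"
  proof (rule fundamental_theorem_of_calculus_interior[OF ab])
    have "x \<in> {a..b} \<Longrightarrow> g x \<in> {g a..g b}" for x
      using mono[of x] gab by (cases "x = a \<or> x = b") (auto simp: less_le)
    thus "continuous_on {a..b} (Q \<circ> g)"
      by (intro continuous_on_compose g continuous_on_subset[OF Q]) auto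
    fix x assume x: "x \<in> {a<..<b}"
    have gx: "g x \<in> {g a<..<g b}" by (rule mono[OF x])
    hence "isCont F (g x)" using F(1) by (simp add: continuous_on_eq_continuous_at)
    hence "(Q has_vector_derivative F (g x)) (at (g x) within ({g a..g b} - {}))"
      unfolding Q_def using gx
      by (intro integral_has_vector_derivative_continuous_at F(2)) (auto intro: continuous_at_imp_continuous_at_within)
    also have "at (g x) within ({g a..g b} - {}) = at (g x)"
      using gx by (intro at_within_interior) auto
    finally show "(Q \<circ> g has_vector_derivative g' x *\<^sub>R F (g x)) (at x)"
      using g'[OF x] by (intro vector_diff_chain_at) (simp_all add: has_real_derivative_iff_has_vector_derivative)
  qed
  thus ?thesis by (simp add: Q_def)
qed

text \<open>Growth to infinity makes \<phi> a bijection of the half-line, and the positive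
  derivative makes its inverse \<psi> differentiable at positive arguments. Statements in x and in
  \<open>y = \<phi> x\<close> can then be exchanged.\<close>

locale halfline_diffeo =
  fixes \<phi> :: "real \<Rightarrow> real"
  assumes deriv_within: "\<And>x. x \<ge> 0 \<Longrightarrow> (\<phi> has_real_derivative dhl \<phi> x) (at x within {0..})"
    and continuous_dhl: "continuous_on {0..} (dhl \<phi>)"
    and dhl_pos: "\<And>x. x \<ge> 0 \<Longrightarrow> dhl \<phi> x > 0"
    and zero: "\<phi> 0 = 0"
    and at_top: "filterlim \<phi> at_top at_top"
begin

lemma deriv: "x > 0 \<Longrightarrow> (\<phi> has_real_derivative dhl \<phi> x) (at x)"
  using deriv_within[of x] at_within_interior[of x "{0..}"] by simp

lemma continuous_on_phi: "continuous_on {0..} \<phi>"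
  using deriv_within by (auto simp: continuous_on_eq_continuous_within intro: DERIV_continuous)

lemma strict_mono: "0 \<le> x \<Longrightarrow> x < y \<Longrightarrow> \<phi> x < \<phi> y"
proof (rule DERIV_pos_imp_increasing_open[of x y])
  assume "0 \<le> x"
  show "\<exists>D. (\<phi> has_real_derivative D) (at t) \<and> 0 < D" if "x < t" "t < y" for t
    using deriv[of t] dhl_pos[of t] that \<open>0 \<le> x\<close> by (intro exI[of _ "dhl \<phi> t"]) simp
  show "continuous_on {x..y} \<phi>"
    by (rule continuous_on_subset[OF continuous_on_phi]) (use \<open>0 \<le> x\<close> in auto)
qed

lemma mono: "0 \<le> x \<Longrightarrow> x \<le> y \<Longrightarrow> \<phi> x \<le> \<phi> y"
  using strict_mono[of x y] by (cases "x = y") auto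

lemma pos: "x > 0 \<Longrightarrow> \<phi> x > 0"
  using strict_mono[of 0 x] zero by simp

definition \<psi> :: "real \<Rightarrow> real" where "\<psi> = inv_into {0..} \<phi>"

lemma inj: "inj_on \<phi> {0..}"
proof (rule inj_onI)
  fix x y assume "x \<in> {0..}" "y \<in> {0..}" "\<phi> x = \<phi> y"
  thus "x = y" using strict_mono[of x y] strict_mono[of y x] by (cases x y rule: linorder_cases) auto
qed

lemma psi_phi: "x \<ge> 0 \<Longrightarrow> \<psi> (\<phi> x) = x"
  unfolding \<psi>_def by (rule inv_into_f_f[OF inj]) auto

lemma surj: "y \<ge> 0 \<Longrightarrow> \<exists>x\<ge>0. \<phi> x = y"
proof -
  assume y: "y \<ge> 0"
  have "\<forall>\<^sub>F x in at_top. \<phi> x \<ge> y \<and> x \<ge> 0"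
    using at_top by (auto simp: filterlim_at_top intro: eventually_conj eventually_ge_at_top)
  then obtain b where b: "\<phi> b \<ge> y" "b \<ge> 0" by (auto simp: eventually_at_top_linorder)
  have "\<exists>x\<ge>0. x \<le> b \<and> \<phi> x = y"
    by (rule IVT') (use b y zero continuous_on_subset[OF continuous_on_phi] in auto)
  thus ?thesis by auto
qed

lemma psi_nonneg: "y \<ge> 0 \<Longrightarrow> \<psi> y \<ge> 0" and phi_psi: "y \<ge> 0 \<Longrightarrow> \<phi> (\<psi> y) = y"
proof -
  assume "y \<ge> 0"
  then obtain x where x: "x \<ge> 0" "\<phi> x = y" using surj by blast
  hence "\<psi> y = x" using psi_phi by blast
  thus "\<psi> y \<ge> 0" "\<phi> (\<psi> y) = y" using x by simp_all
qed

lemma psi_0: "\<psi> 0 = 0"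
  using psi_phi[of 0] zero by simp

lemma psi_pos: "y > 0 \<Longrightarrow> \<psi> y > 0"
  using psi_nonneg[of y] phi_psi[of y] zero by (metis less_eq_real_def order_less_irrefl)

lemma psi_strict_mono: "0 \<le> x \<Longrightarrow> x < y \<Longrightarrow> \<psi> x < \<psi> y"
  using mono[of "\<psi> y" "\<psi> x"] phi_psi[of x] phi_psi[of y] psi_nonneg[of y]
  by (metis less_eq_real_def not_less order.trans)

lemma continuous_on_psi: "continuous_on {0..b} \<psi>" if "b \<ge> 0"
proof -
  have "continuous_on (\<phi> ` {0..\<psi> b}) \<psi>"
    by (rule continuous_on_inv) (auto intro: continuous_on_subset[OF continuous_on_phi] simp: psi_phi)
  moreover have "{0..b} \<subseteq> \<phi> ` {0..\<psi> b}"
  proof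
    fix y assume y: "y \<in> {0..b}"
    hence "\<psi> y \<in> {0..\<psi> b}" using psi_nonneg[of y] psi_strict_mono[of y b] by (cases "y = b") auto
    thus "y \<in> \<phi> ` {0..\<psi> b}" using phi_psi[of y] y by (metis atLeastAtMost_iff imageI)
  qed
  ultimately show ?thesis by (rule continuous_on_subset)
qed

lemma isCont_psi: "y > 0 \<Longrightarrow> isCont \<psi> y"
  using continuous_on_psi[of "2 * y"] by (intro continuous_on_interior[of "{0..2*y}"]) auto

lemma psi_deriv: "y > 0 \<Longrightarrow> (\<psi> has_real_derivative inverse (dhl \<phi> (\<psi> y))) (at y)"
proof (rule DERIV_inverse_function[where f=\<phi> and a=0 and b="y+1"])
  assume y: "y > 0"
  show "(\<phi> has_real_derivative dhl \<phi> (\<psi> y)) (at (\<psi> y))" by (rule deriv[OF psi_pos[OF y]])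
  show "dhl \<phi> (\<psi> y) \<noteq> 0" using dhl_pos[OF psi_nonneg, of y] y by simp
  show "isCont \<psi> y" by (rule isCont_psi[OF y])
qed (simp_all add: phi_psi)

lemma filterlim_phi_at_right: "filterlim \<phi> (at_right 0) (at_right 0)"
proof -
  have "(\<phi> \<longlongrightarrow> \<phi> 0) (at 0 within {0..})" using continuous_on_phi by (simp add: continuous_on_def)
  hence "(\<phi> \<longlongrightarrow> 0) (at_right 0)" unfolding zero by (rule tendsto_within_subset) auto
  moreover have "\<forall>\<^sub>F x in at_right 0. \<phi> x > 0" using pos by (simp add: eventually_at_filter)
  ultimately show ?thesis by (auto simp: filterlim_at elim: eventually_mono)
qed

lemma filterlim_psi_at_right: "filterlim \<psi> (at_right 0) (at_right 0)"
proof -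
  have "(\<psi> \<longlongrightarrow> \<psi> 0) (at 0 within {0..1})" using continuous_on_psi[of 1] by (simp add: continuous_on_def)
  hence "(\<psi> \<longlongrightarrow> 0) (at_right 0)" unfolding psi_0 by (simp add: at_within_Icc_at_right)
  moreover have "\<forall>\<^sub>F x in at_right 0. \<psi> x > 0" using psi_pos by (simp add: eventually_at_filter)
  ultimately show ?thesis by (auto simp: filterlim_at elim: eventually_mono)
qed

definition pullback :: "(real \<Rightarrow> complex) \<Rightarrow> real \<Rightarrow> complex" where
  "pullback f y = (if y > 0 then f (\<psi> y) else 0)"

lemma pullback_phi: "x > 0 \<Longrightarrow> pullback f (\<phi> x) = f x"
  by (simp add: pullback_def pos psi_phi)

lemma continuous_on_pullback:
  assumes "continuous_on {0<..} f"
  shows "continuous_on {0<..} (pullback f)"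
proof -
  have "continuous_on {0<..} (f \<circ> \<psi>)"
    by (intro continuous_on_compose continuous_on_subset[OF assms] continuous_at_imp_continuous_on ballI isCont_psi)
       (auto intro: psi_pos)
  thus ?thesis by (rule continuous_on_eq) (auto simp: pullback_def)
qed

text \<open>Substitution along \<psi> brings in the reciprocal of the derivative of \<phi>, so it is
  applied to f multiplied by that derivative. The multiplier is bounded on compact intervals and
  preserves absolute integrability. The same computation is made for the norms.\<close>

lemma causal_pullback:
  assumes c: "continuous_on {0<..} f" and i: "\<And>b. b > 0 \<Longrightarrow> f absolutely_integrable_on {0..b}"
  shows "causal (pullback f)"
  unfolding causal_def
proof (intro conjI allI impI)
  fix b :: real
  have [measurable]: "pullback f \<in> borel_measurable borel"
    by (rule measurable_continuous_on_halfline) (auto simp: continuous_on_pullback[OF c], simp add: pullback_def)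
  have int: "pullback f absolutely_integrable_on {0..b}" if b: "b > 0" for b
  proof -
    have pb: "\<psi> b > 0" by (rule psi_pos[OF b])
    have a: "(\<lambda>x. dhl \<phi> x *\<^sub>R f x) absolutely_integrable_on {0..\<psi> b}"
    proof (rule absolutely_integrable_bounded_measurable_product[where h="\<lambda>(x::real) (y::complex). x *\<^sub>R y" and f="dhl \<phi>"])
      have cd: "continuous_on {0..\<psi> b} (dhl \<phi>)" by (rule continuous_on_subset[OF continuous_dhl]) auto
      show "dhl \<phi> \<in> borel_measurable (lebesgue_on {0..\<psi> b})"
        by (rule continuous_imp_measurable_on_sets_lebesgue[OF cd]) auto
      show "bounded (dhl \<phi> ` {0..\<psi> b})"
        by (intro compact_imp_bounded compact_continuous_image cd) auto
      show "bilinear (\<lambda>(x::real) (y::complex). x *\<^sub>R y)"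
        by (simp add: bilinear_conv_bounded_bilinear bounded_bilinear_scaleR)
    qed (use i[OF pb] in auto)
    note a' = a[unfolded absolutely_integrable_on_def]
    have sub: "((\<lambda>y. inverse (dhl \<phi> (\<psi> y)) *\<^sub>R F (\<psi> y)) has_integral integral {0..\<psi> b} F) {0..b}"
      if "continuous_on {0<..} F" "F integrable_on {0..\<psi> b}" for F :: "real \<Rightarrow> 'b::banach"
    proof -
      have "((\<lambda>y. inverse (dhl \<phi> (\<psi> y)) *\<^sub>R F (\<psi> y)) has_integral integral {\<psi> 0..\<psi> b} F) {0..b}"
        by (rule has_integral_substitution_FTC[where g=\<psi> and F=F])
           (use b pb that(2) in \<open>auto simp: psi_0 intro: psi_deriv psi_pos psi_strict_mono continuous_on_psi
              continuous_on_subset[OF that(1)]\<close>)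
      thus ?thesis by (simp add: psi_0)
    qed
    have cF: "continuous_on {0<..} (\<lambda>x. dhl \<phi> x *\<^sub>R f x)"
      by (intro continuous_on_scaleR c continuous_on_subset[OF continuous_dhl]) auto
    have "(pullback f has_integral integral {0..\<psi> b} (\<lambda>x. dhl \<phi> x *\<^sub>R f x)) {0..b}"
    proof (rule has_integral_spike_finite[OF _ _ sub[OF cF]])
      show "(\<lambda>x. dhl \<phi> x *\<^sub>R f x) integrable_on {0..\<psi> b}" by (rule conjunct1[OF a'])
      show "pullback f y = inverse (dhl \<phi> (\<psi> y)) *\<^sub>R (dhl \<phi> (\<psi> y) *\<^sub>R f (\<psi> y))" if "y \<in> {0..b} - {0}" for y
        using that dhl_pos[OF psi_nonneg, of y] by (simp add: pullback_def)
    qed auto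
    moreover have "((\<lambda>y. norm (pullback f y)) has_integral integral {0..\<psi> b} (\<lambda>x. norm (dhl \<phi> x *\<^sub>R f x))) {0..b}"
    proof (rule has_integral_spike_finite[OF _ _ sub[OF continuous_on_norm[OF cF]]])
      show "(\<lambda>x. norm (dhl \<phi> x *\<^sub>R f x)) integrable_on {0..\<psi> b}" by (rule conjunct2[OF a'])
      show "norm (pullback f y) = inverse (dhl \<phi> (\<psi> y)) *\<^sub>R norm (dhl \<phi> (\<psi> y) *\<^sub>R f (\<psi> y))" if "y \<in> {0..b} - {0}" for y
        using that dhl_pos[OF psi_nonneg, of y] by (simp add: pullback_def)
    qed auto
    ultimately show ?thesis by (auto simp: absolutely_integrable_on_def integrable_on_def)
  qed
  have "set_integrable lborel {0..max b 1} (pullback f)"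
  proof -
    have "integrable lebesgue (\<lambda>x. indicator {0..max b 1} x *\<^sub>R pullback f x)"
      using int[of "max b 1"] unfolding set_integrable_def by simp
    thus ?thesis unfolding set_integrable_def by (subst (asm) integrable_completion) auto
  qed
  hence "integrable lborel (\<lambda>y. indicator {..b} y *\<^sub>R (indicator {0..max b 1} y *\<^sub>R pullback f y))"
    unfolding set_integrable_def by (rule integrable_mult_indicator[rotated]) auto
  also have "(\<lambda>y. indicator {..b} y *\<^sub>R (indicator {0..max b 1} y *\<^sub>R pullback f y)) = (\<lambda>y. indicator {..b} y *\<^sub>R pullback f y)"
    by (auto simp: indicator_def pullback_def fun_eq_iff)
  finally show "set_integrable lborel {..b} (pullback f)" unfolding set_integrable_def .
qed (auto simp: continuous_on_pullback[OF c], simp add: pullback_def)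

lemma has_integral_conv:
  assumes k: "causal k" and f: "causal (pullback f)" and x: "x > 0"
  shows "((\<lambda>t. of_real (dhl \<phi> t) * k (\<phi> x - \<phi> t) * f t) has_integral conv k (pullback f) (\<phi> x)) {0..x}"
proof -
  let ?F = "\<lambda>\<tau>. k (\<phi> x - \<tau>) * pullback f \<tau>"
  have i: "integrable lborel ?F" by (rule conv_integrable[OF k f])
  have "(?F has_integral conv k (pullback f) (\<phi> x)) UNIV"
    unfolding conv_def by (rule has_integral_integral_lborel[OF i])
  hence "((\<lambda>\<tau>. if \<tau> \<in> {0..\<phi> x} then ?F \<tau> else 0) has_integral conv k (pullback f) (\<phi> x)) UNIV"
    by (rule has_integral_eq[rotated]) (use causal_eq_0[OF k] causal_eq_0[OF f] in \<open>simp add: not_le\<close>)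
  hence F: "(?F has_integral conv k (pullback f) (\<phi> x)) {0..\<phi> x}"
    by (simp only: has_integral_restrict_UNIV)
  have "((\<lambda>t. dhl \<phi> t *\<^sub>R ?F (\<phi> t)) has_integral integral {\<phi> 0..\<phi> x} ?F) {0..x}"
  proof (rule has_integral_substitution_FTC[where g=\<phi> and F="?F"])
    have "continuous_on {0<..<\<phi> x} ?F"
      by (intro continuous_on_mult continuous_on_subset[OF causal_continuous_on[OF f]]
            continuous_on_compose2[OF causal_continuous_on[OF k]] continuous_intros) auto
    thus "continuous_on {\<phi> 0<..<\<phi> x} ?F" by (simp add: zero)
    show "?F integrable_on {\<phi> 0..\<phi> x}" using F by (auto simp: zero integrable_on_def)
  qed (use x in \<open>auto simp: zero less_imp_le pos intro: strict_mono deriv continuous_on_subset[OF continuous_on_phi]\<close>)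
  also have "integral {\<phi> 0..\<phi> x} ?F = conv k (pullback f) (\<phi> x)" using F by (simp add: zero integral_unique)
  finally show ?thesis
    by (rule has_integral_spike_finite[of "{0}", rotated 2]) (auto simp: pullback_phi scaleR_conv_of_real mult_ac)
qed

text \<open>The chain rule produces the derivative of \<phi> that \<open>dphi\<close> divides by: in
  the variable y, \<open>dphi\<close> is plain differentiation.\<close>

lemma dphi_eq:
  assumes x: "x > 0" and F: "(F has_vector_derivative F') (at (\<phi> x))" and f: "\<And>t. t > 0 \<Longrightarrow> f t = F (\<phi> t)"
  shows "dphi \<phi> f x = F'"
proof -
  have "(F \<circ> \<phi> has_vector_derivative dhl \<phi> x *\<^sub>R F') (at x)"
    using deriv[OF x] F by (intro vector_diff_chain_at) (simp_all add: has_real_derivative_iff_has_vector_derivative)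
  hence "(f has_vector_derivative dhl \<phi> x *\<^sub>R F') (at x)"
    by (rule has_vector_derivative_transform_within_open[where S="{0<..}"]) (use x f in auto)
  hence "vector_derivative f (at x) = dhl \<phi> x *\<^sub>R F'" by (rule vector_derivative_at)
  moreover have "at x within {0..} = at x" using x by (intro at_within_interior) auto
  ultimately show ?thesis
    using dhl_pos[of x] x by (simp add: dphi_def dhl_def scaleR_conv_of_real)
qed

lemma dphi_funpow:
  assumes "\<And>i y. i < k \<Longrightarrow> y > 0 \<Longrightarrow> (F i has_vector_derivative F (Suc i) y) (at y)"
    and "\<And>t. t > 0 \<Longrightarrow> f t = F 0 (\<phi> t)" and "x > 0"
  shows "(dphi \<phi> ^^ k) f x = F k (\<phi> x)"
  using assms(1,3)
proof (induction k arbitrary: x)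
  case (Suc k)
  have "dphi \<phi> ((dphi \<phi> ^^ k) f) x = F (Suc k) (\<phi> x)"
    by (rule dphi_eq[OF \<open>x > 0\<close> Suc.prems(1)]) (use Suc pos in auto)
  thus ?case by simp
qed (use assms(2) in auto)

lemma dphi_exists_derivative:
  assumes "dphi_exists k \<phi> f" "i < k" "y > 0"
  shows "((\<lambda>y. (dphi \<phi> ^^ i) f (\<psi> y)) has_vector_derivative (dphi \<phi> ^^ Suc i) f (\<psi> y)) (at y)"
proof -
  let ?g = "(dphi \<phi> ^^ i) f"
  have p: "\<psi> y > 0" by (rule psi_pos[OF assms(3)])
  have a: "at (\<psi> y) within {0..} = at (\<psi> y)" using p by (intro at_within_interior) auto
  have "?g differentiable (at (\<psi> y))" using assms p by (auto simp: dphi_exists_def)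
  hence "(?g has_vector_derivative dhl ?g (\<psi> y)) (at (\<psi> y))"
    by (simp add: dhl_def a vector_derivative_works)
  hence "(?g \<circ> \<psi> has_vector_derivative inverse (dhl \<phi> (\<psi> y)) *\<^sub>R dhl ?g (\<psi> y)) (at y)"
    using psi_deriv[OF assms(3)]
    by (intro vector_diff_chain_at) (simp_all add: has_real_derivative_iff_has_vector_derivative)
  also have "inverse (dhl \<phi> (\<psi> y)) *\<^sub>R dhl ?g (\<psi> y) = (dphi \<phi> ^^ Suc i) f (\<psi> y)"
    by (simp add: dphi_def scaleR_conv_of_real field_simps)
  finally show ?thesis by (simp add: o_def)
qed

text \<open>A primitive in y with limits at both ends determines the transform, so convergence may
  be conditional at 0 as well as at infinity.\<close>

lemma laplace_integrand_has_integral: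
  assumes P: "\<And>y. y > 0 \<Longrightarrow> (P has_vector_derivative exp (- s * of_real y) * F y) (at y)"
    and P0: "(P \<longlongrightarrow> P\<^sub>0) (at_right 0)" and L: "(P \<longlongrightarrow> L) at_top"
    and f: "\<And>x. x > 0 \<Longrightarrow> f x = F (\<phi> x)"
  shows "(laplace_integrand \<phi> f s has_integral (L - P\<^sub>0)) {0..}"
proof (rule has_integral_halflineI)
  define Q where "Q x = (if x > 0 then P (\<phi> x) else P\<^sub>0)" for x
  have Q': "(Q has_vector_derivative laplace_integrand \<phi> f s x) (at x)" if x: "x > 0" for x
  proof -
    have "(P \<circ> \<phi> has_vector_derivative dhl \<phi> x *\<^sub>R (exp (- s * of_real (\<phi> x)) * F (\<phi> x))) (at x)"
      using deriv[OF x] P[OF pos[OF x]]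
      by (intro vector_diff_chain_at) (simp_all add: has_real_derivative_iff_has_vector_derivative)
    also have "dhl \<phi> x *\<^sub>R (exp (- s * of_real (\<phi> x)) * F (\<phi> x)) = laplace_integrand \<phi> f s x"
      using f[OF x] by (simp add: laplace_integrand_def scaleR_conv_of_real mult_ac)
    finally show ?thesis
      by (rule has_vector_derivative_transform_within_open[where S="{0<..}"]) (use x in \<open>auto simp: Q_def\<close>)
  qed
  have Q0: "(Q \<longlongrightarrow> Q 0) (at_right 0)"
  proof -
    have "((\<lambda>x. P (\<phi> x)) \<longlongrightarrow> P\<^sub>0) (at_right 0)"
      by (rule filterlim_compose[OF P0 filterlim_phi_at_right])
    moreover have "\<forall>\<^sub>F x in at_right 0. P (\<phi> x) = Q x" by (auto simp: eventually_at_filter Q_def)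
    ultimately have "(Q \<longlongrightarrow> P\<^sub>0) (at_right 0)" by (rule Lim_transform_eventually)
    thus ?thesis by (simp add: Q_def)
  qed
  fix b :: real assume b: "b > 0"
  have "(laplace_integrand \<phi> f s has_integral (Q b - Q 0)) {0..b}"
  proof (rule fundamental_theorem_of_calculus_interior)
    show "continuous_on {0..b} Q"
      unfolding continuous_on_eq_continuous_within
    proof
      fix x assume x: "x \<in> {0..b}"
      show "continuous (at x within {0..b}) Q"
      proof (cases "x = 0")
        case True
        thus ?thesis using Q0 b by (simp add: continuous_within at_within_Icc_at_right)
      next
        case False
        hence "isCont Q x" using Q'[of x] x by (auto intro: has_vector_derivative_continuous)
        thus ?thesis by (rule continuous_at_imp_continuous_at_within)
      qed
    qed
  qed (use b Q' in auto)
  thus "(laplace_integrand \<phi> f s has_integral (P (\<phi> b) - P\<^sub>0)) {0..b}" using b by (simp add: Q_def)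
next
  show "((\<lambda>b. P (\<phi> b) - P\<^sub>0) \<longlongrightarrow> L - P\<^sub>0) at_top"
    by (intro tendsto_intros filterlim_compose[OF L at_top])
qed

end

section \<open>Laplace transforms of fractional derivatives\<close>

lemma causal_exp_mult:
  assumes f: "causal f" and s: "lap_integrable f s"
  shows "causal (\<lambda>y. exp (- s * of_real y) * f y)"
proof (rule causalI_lap_integrable[where s=0])
  show "continuous_on {0<..} (\<lambda>y. exp (- s * of_real y) * f y)"
    by (intro continuous_intros causal_continuous_on f)
  show "lap_integrable (\<lambda>y. exp (- s * of_real y) * f y) 0"
    using s by (simp add: lap_integrable_def)
qed (simp add: causal_eq_0[OF f])

lemma lap_integrable_exp_order:
  assumes f: "causal f" and b: "\<And>y. y > Y \<Longrightarrow> norm (f y) \<le> M * exp (c * y)" and s: "Re s > c"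
  shows "lap_integrable f s"
  unfolding lap_integrable_def
proof (rule Bochner_Integration.integrable_bound)
  note [measurable] = causal_measurable[OF f]
  \<comment> \<open>The first summand dominates up to Y by local integrability, the second beyond Y;
    there \<open>rl_kernel 1\<close> is a cutoff to positive y.\<close>
  let ?g = "\<lambda>y. exp (\<bar>Re s\<bar> * \<bar>Y\<bar>) * norm (indicator {..Y} y *\<^sub>R f y) +
    \<bar>M\<bar> * norm (exp (- of_real (Re s - c) * of_real y) * rl_kernel 1 y)"
  have "lap_integrable (rl_kernel 1) (of_real (Re s - c))" using s by (intro lap_integrable_rl_kernel) auto
  thus "integrable lborel ?g"
    using causal_set_integrable[OF f, of Y] unfolding set_integrable_def lap_integrable_def
    by (intro Bochner_Integration.integrable_add integrable_mult_right integrable_norm)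
  show "AE y in lborel. norm (exp (- s * of_real y) * f y) \<le> norm (?g y)"
  proof (rule AE_I2)
    fix y
    have nn: "?g y \<ge> 0" by (intro add_nonneg_nonneg mult_nonneg_nonneg) auto
    have "norm (exp (- s * of_real y) * f y) \<le> ?g y"
    proof (cases "0 < y")
      case False
      thus ?thesis using nn causal_eq_0[OF f, of y] by auto
    next
      case y: True
      show ?thesis
      proof (cases "y \<le> Y")
        case True
        have "- Re s * y \<le> \<bar>Re s\<bar> * y" using y by (intro mult_right_mono) auto
        also have "\<dots> \<le> \<bar>Re s\<bar> * \<bar>Y\<bar>" using True y by (intro mult_left_mono) auto
        finally have "exp (- Re s * y) * norm (f y) \<le> exp (\<bar>Re s\<bar> * \<bar>Y\<bar>) * norm (f y)"
          by (intro mult_right_mono) auto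
        moreover have "\<bar>M\<bar> * norm (exp (- of_real (Re s - c) * of_real y) * rl_kernel 1 y) \<ge> 0" by simp
        ultimately have "exp (- Re s * y) * norm (f y) \<le> exp (\<bar>Re s\<bar> * \<bar>Y\<bar>) * norm (f y) +
            \<bar>M\<bar> * norm (exp (- of_real (Re s - c) * of_real y) * rl_kernel 1 y)" by linarith
        thus ?thesis using True by (simp add: norm_mult)
      next
        case False
        have "norm (exp (- s * of_real y) * f y) \<le> exp (- Re s * y) * (\<bar>M\<bar> * exp (c * y))"
          unfolding norm_mult
          using order_trans[OF b[of y] mult_right_mono[of M "\<bar>M\<bar>" "exp (c * y)"]] False
          by (intro mult_mono) auto
        also have "\<dots> = \<bar>M\<bar> * norm (exp (- of_real (Re s - c) * of_real y) * rl_kernel 1 y)"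
          using y by (simp add: rl_kernel_def norm_mult algebra_simps flip: exp_add)
        finally show ?thesis using False by simp
      qed
    qed
    also have "?g y \<le> norm (?g y)" by simp
    finally show "norm (exp (- s * of_real y) * f y) \<le> norm (?g y)" .
  qed
qed (use causal_measurable[OF f] in measurable)

text \<open>Exponential order says nothing about small y. The limit gives a bound near 0 and
  compactness one in between; as c is positive, constants are bounded by multiples of
  \<open>exp (c * y)\<close>.\<close>

lemma exp_order_globalI:
  fixes f :: "real \<Rightarrow> complex"
  assumes f: "continuous_on {0<..} f" and l: "(f \<longlongrightarrow> l) (at_right 0)"
    and b: "\<And>y. y > Y \<Longrightarrow> norm (f y) \<le> M * exp (c * y)" and c: "c > 0" and M: "M > 0"
  obtains M' where "M' > 0" "\<And>y. y > 0 \<Longrightarrow> norm (f y) \<le> M' * exp (c * y)"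
proof -
  have "\<forall>\<^sub>F y in at_right 0. dist (f y) l < 1" using l by (rule tendstoD) simp
  then obtain e where e: "e > 0" "\<And>y. 0 < y \<Longrightarrow> y < e \<Longrightarrow> dist (f y) l < 1"
    by (auto simp: eventually_at_right_field)
  have "bounded (f ` {e..Y})"
    by (intro compact_imp_bounded compact_continuous_image continuous_on_subset[OF f]) (use e in auto)
  then obtain B where B: "\<And>y. y \<in> {e..Y} \<Longrightarrow> norm (f y) \<le> B" unfolding bounded_iff by blast
  define M' where "M' = M + (norm l + 1) + \<bar>B\<bar>"
  show ?thesis
  proof (rule that)
    show "M' > 0" using M by (simp add: M'_def add_pos_nonneg)
    fix y :: real assume y: "y > 0"
    consider "y < e" | "y \<in> {e..Y}" | "y > Y" by force
    thus "norm (f y) \<le> M' * exp (c * y)"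
    proof cases
      case 1
      have "norm (f y) \<le> norm l + norm (f y - l)" by (metis norm_triangle_sub)
      also have "\<dots> \<le> M' * 1" using e(2)[OF y 1] M by (simp add: M'_def dist_norm)
      also have "\<dots> \<le> M' * exp (c * y)" using c y M by (intro mult_left_mono) (auto simp: M'_def)
      finally show ?thesis .
    next
      case 2
      have "norm (f y) \<le> M' * 1"
        using B[OF 2] M by (simp add: M'_def) (smt (verit) norm_ge_zero)
      also have "\<dots> \<le> M' * exp (c * y)" using c y M by (intro mult_left_mono) (auto simp: M'_def)
      finally show ?thesis .
    next
      case 3
      have "norm (f y) \<le> M * exp (c * y)" by (rule b[OF 3])
      also have "\<dots> \<le> M' * exp (c * y)" by (intro mult_right_mono) (auto simp: M'_def)
      finally show ?thesis .
    qed
  qed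
qed

text \<open>Both sides are differentiated j times from the given identity, and derivatives are
  unique. The condition on j keeps the index on the left in the range where it is still the order of
  a fractional integral.\<close>

lemma conv_rl_kernel_eq_expansion:
  assumes v: "causal v" and V: "causal V" and z: "Re z > 0 \<or> z = 0"
    and E0: "\<And>y. y > 0 \<Longrightarrow> conv (rl_kernel (of_nat m - \<gamma>)) v y = expansion m a V z 0 y"
    and j: "real j < real m - Re \<gamma>" and y: "y > 0" and jm: "j \<le> m"
  shows "conv (rl_kernel (of_nat m - \<gamma> - of_nat j)) v y = expansion m a V z j y"
  using j y jm
proof (induction j arbitrary: y)
  case (Suc j)
  have "(conv (rl_kernel (of_nat m - \<gamma> - of_nat j)) v has_vector_derivative
      conv (rl_kernel (of_nat m - \<gamma> - of_nat j - 1)) v y) (at y)"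
    using Suc.prems by (intro has_vector_derivative_conv_rl_kernel v) auto
  moreover have "(conv (rl_kernel (of_nat m - \<gamma> - of_nat j)) v has_vector_derivative expansion m a V z (Suc j) y) (at y)"
    by (rule has_vector_derivative_transform_within_open[OF has_vector_derivative_expansion[OF V z], where S="{0<..}"])
       (use Suc in auto)
  ultimately have "conv (rl_kernel (of_nat m - \<gamma> - of_nat j - 1)) v y = expansion m a V z (Suc j) y"
    by (rule vector_derivative_unique_at)
  thus ?case by (simp add: algebra_simps)
qed (use E0 in simp)

text \<open>Integrating \<open>exp (- s y)\<close> times the \<open>(N + 1)\<close>-st derivative of \<open>g\<close> by parts \<open>N + 1\<close> times
  leaves the boundary terms and \<open>s ^ (N + 1)\<close> times the primitive of \<open>exp (- s y) g\<close>. Only this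
  antiderivative is needed: the derivative itself need not be absolutely integrable at \<open>0\<close>.\<close>

lemma fractional_antiderivative:
  fixes N :: nat
  assumes v: "causal v" and V: "causal V" and z: "Re z > 0 \<or> z = 0"
    and E0: "\<And>y. y > 0 \<Longrightarrow> conv (rl_kernel (of_nat m - \<gamma>)) v y = expansion m a V z 0 y"
    and V_bound: "\<And>y. y > 0 \<Longrightarrow> norm (V y) \<le> M * exp (c * y)" and c: "c > 0"
    and s: "Re s > c" and vs: "lap_integrable v s"
    and N: "real N \<le> Re \<gamma>" "Re \<gamma> < real N + 1" "N < m"
    and l: "\<And>i. i \<le> N \<Longrightarrow> (expansion m a V z (m - Suc N + i) \<longlongrightarrow> l i) (at_right 0)"
  obtains P where "\<And>y. y > 0 \<Longrightarrow> (P has_vector_derivative exp (- s * of_real y) * expansion m a V z m y) (at y)"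
    "(P \<longlongrightarrow> (\<Sum>i\<le>N. s ^ (N - i) * l i)) (at_right 0)" "(P \<longlongrightarrow> s powr \<gamma> * lap v s) at_top"
proof -
  \<comment> \<open>\<open>g i\<close> is the i-th derivative of G on (0,\<infinity>): the first
    \<open>m - Suc N\<close> derivatives bring the index down to \<mu>, which is G, and
    \<open>Suc N\<close> more reach order m.\<close>
  define g where "g i = expansion m a V z (m - Suc N + i)" for i
  define \<mu> where "\<mu> = of_nat (Suc N) - \<gamma>"
  define G where "G = conv (rl_kernel \<mu>) v"
  define P where "P y = (\<Sum>i\<le>N. s ^ (N - i) * (exp (- s * of_real y) * g i y)) +
      s ^ Suc N * conv (rl_kernel 1) (\<lambda>y. exp (- s * of_real y) * G y) y" for y
  have s0: "Re s > 0" using s c by simp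
  have \<mu>: "Re \<mu> > 0" using N by (simp add: \<mu>_def)
  have cG: "causal G" unfolding G_def by (intro causal_conv causal_rl_kernel v \<mu>)
  have sG: "lap_integrable G s" unfolding G_def by (intro lap_integrable_conv lap_integrable_rl_kernel vs \<mu> s0)
  note ceG = causal_exp_mult[OF cG sG]
  have G_eq: "G y = g 0 y" if "y > 0" for y
  proof -
    have "of_nat m - \<gamma> - of_nat (m - Suc N) = \<mu>" using N by (simp add: \<mu>_def of_nat_diff)
    thus ?thesis
      unfolding G_def g_def using conv_rl_kernel_eq_expansion[OF v V z E0, where j="m - Suc N", OF _ _ that] N
      by (simp add: of_nat_diff)
  qed
  show ?thesis
  proof (rule that)
    fix y :: real assume y: "y > 0"
    have gd: "(g i has_vector_derivative g (Suc i) y) (at y)" if "i \<le> N" for i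
      using has_vector_derivative_expansion[OF V z, of "m - Suc N + i" m y] N that y by (simp add: g_def)
    define e where "e = exp (- s * of_real y)"
    have ed: "((\<lambda>y. exp (- s * of_real y)) has_vector_derivative - s * e) (at y)"
      unfolding e_def by (auto intro!: derivative_eq_intros has_vector_derivative_real_field)
    have "(P has_vector_derivative (\<Sum>i\<le>N. s ^ (N - i) * (e * g (Suc i) y + - s * e * g i y)) + s ^ Suc N * (e * G y)) (at y)"
      unfolding P_def
      by (intro has_vector_derivative_add has_vector_derivative_sum has_vector_derivative_mult_right)
         (use has_vector_derivative_mult[OF ed gd] has_vector_derivative_conv_rl_kernel_1[OF ceG y] in \<open>auto simp: e_def\<close>)
    \<comment> \<open>The \<open>- s\<close> from the exponential raises the power of s by one, so
      the sum telescopes. Its end at \<open>g 0\<close> cancels against the derivative of the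
      integral term, because \<open>g 0\<close> is G.\<close>
    also have "(\<Sum>i\<le>N. s ^ (N - i) * (e * g (Suc i) y + - s * e * g i y)) =
       (\<Sum>i<Suc N. s ^ (Suc N - Suc i) * (e * g (Suc i) y) - s ^ (Suc N - i) * (e * g i y))"
      unfolding lessThan_Suc_atMost by (intro sum.cong) (auto simp: Suc_diff_le algebra_simps)
    also have "\<dots> = e * g (Suc N) y - s ^ Suc N * (e * g 0 y)"
      by (subst sum_lessThan_telescope) simp
    also have "e * g (Suc N) y - s ^ Suc N * (e * g 0 y) + s ^ Suc N * (e * G y) = e * expansion m a V z m y"
      using G_eq[OF y] N by (simp add: g_def)
    finally show "(P has_vector_derivative exp (- s * of_real y) * expansion m a V z m y) (at y)"
      by (simp add: e_def)
  next
    have "((\<lambda>y. exp (- s * complex_of_real y)) \<longlongrightarrow> exp (- s * complex_of_real 0)) (at_right 0)"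
      by (intro tendsto_intros)
    hence "(P \<longlongrightarrow> (\<Sum>i\<le>N. s ^ (N - i) * (1 * l i)) + s ^ Suc N * 0) (at_right 0)"
      unfolding P_def
      by (intro tendsto_add tendsto_sum tendsto_mult tendsto_const conv_rl_kernel_1_at_right_0 ceG)
         (use l in \<open>auto simp: g_def\<close>)
    thus "(P \<longlongrightarrow> (\<Sum>i\<le>N. s ^ (N - i) * l i)) (at_right 0)" by simp
  next
    have "(P \<longlongrightarrow> (\<Sum>i\<le>N. s ^ (N - i) * 0) + s ^ Suc N * lap G s) at_top"
      unfolding P_def lap_def
    proof (intro tendsto_add tendsto_sum tendsto_mult_left)
      fix i assume "i \<in> {..N}"
      thus "((\<lambda>y. exp (- s * of_real y) * g i y) \<longlongrightarrow> 0) at_top"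
        unfolding g_def using N by (intro expansion_decay[OF V z _ V_bound c s]) auto
    qed (use conv_rl_kernel_1_at_top[OF ceG] sG in \<open>auto simp: lap_integrable_def\<close>)
    also have "lap G s = s powr (- \<mu>) * lap v s"
      unfolding G_def using lap_conv[OF lap_integrable_rl_kernel[OF \<mu> s0] vs] lap_rl_kernel[OF \<mu> s0] by simp
    \<comment> \<open>Written as a complex power, \<open>s ^ Suc N\<close> combines with
      \<open>s powr (- \<mu>)\<close> to \<open>s powr \<gamma>\<close>, since
      \<open>\<mu> = Suc N - \<gamma>\<close>.\<close>
    also have "(\<Sum>i\<le>N. s ^ (N - i) * 0) + s ^ Suc N * (s powr (- \<mu>) * lap v s) =
       (s powr of_nat (Suc N) * s powr (- \<mu>)) * lap v s"
      using s0 by (subst powr_nat') auto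
    also have "s powr of_nat (Suc N) * s powr (- \<mu>) = s powr \<gamma>"
      by (simp add: \<mu>_def flip: powr_add)
    finally show "(P \<longlongrightarrow> s powr \<gamma> * lap v s) at_top" .
  qed
qed

section \<open>Operators in x as convolutions in y\<close>

context halfline_diffeo
begin

lemma tendsto_pullback:
  assumes "(f \<longlongrightarrow> l) (at_right 0)" "\<And>x. x > 0 \<Longrightarrow> f x = F (\<phi> x)"
  shows "(F \<longlongrightarrow> l) (at_right 0)"
proof -
  have "((\<lambda>y. f (\<psi> y)) \<longlongrightarrow> l) (at_right 0)"
    by (rule filterlim_compose[OF assms(1) filterlim_psi_at_right])
  moreover have "\<forall>\<^sub>F y in at_right 0. f (\<psi> y) = F y"
    using assms(2) psi_pos by (simp add: eventually_at_filter phi_psi)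
  ultimately show ?thesis by (rule Lim_transform_eventually)
qed

lemma exp_order_pullback:
  assumes "phi_exponential_order \<phi> f"
  obtains c M Y where "c > 0" "M > 0" "\<And>y. y > Y \<Longrightarrow> norm (pullback f y) \<le> M * exp (c * y)"
proof -
  obtain c M X where c: "c > 0" "M > 0" "X > 0" and b: "\<And>x. x > X \<Longrightarrow> norm (f x) \<le> M * exp (c * \<phi> x)"
    using assms unfolding phi_exponential_order_def by blast
  show ?thesis
  proof (rule that[OF c(1,2)])
    fix y assume y: "y > \<phi> X"
    hence y0: "y > 0" using pos[OF c(3)] by simp
    have "\<psi> y > X" using psi_strict_mono[of "\<phi> X" y] y pos[OF c(3)] psi_phi[of X] c(3) by simp
    thus "norm (pullback f y) \<le> M * exp (c * y)"
      using b[of "\<psi> y"] y0 by (simp add: pullback_def phi_psi)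
  qed
qed

lemma RL_integral_eq_conv:
  assumes \<mu>: "Re \<mu> > 0" and f: "causal (pullback f)" and x: "x > 0"
  shows "RL_integral \<phi> \<mu> f x = conv (rl_kernel \<mu>) (pullback f) (\<phi> x)"
proof -
  have "((\<lambda>t. rGamma \<mu> * (of_real (dhl \<phi> t) * of_real (\<phi> x - \<phi> t) powr (\<mu> - 1) * f t))
      has_integral conv (rl_kernel \<mu>) (pullback f) (\<phi> x)) {0..x}"
  proof (rule has_integral_eq[OF _ has_integral_conv[OF causal_rl_kernel[OF \<mu>] f x]])
    fix t assume "t \<in> {0..x}"
    hence "\<phi> t \<le> \<phi> x" by (intro mono) auto
    thus "of_real (dhl \<phi> t) * rl_kernel \<mu> (\<phi> x - \<phi> t) * f t =
        rGamma \<mu> * (of_real (dhl \<phi> t) * of_real (\<phi> x - \<phi> t) powr (\<mu> - 1) * f t)"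
      by (cases "\<phi> t = \<phi> x") (auto simp: rl_kernel_def)
  qed
  from integral_unique[OF this] show ?thesis
    by (simp add: RL_integral_def rGamma_inverse_Gamma divide_inverse)
qed

lemma gen_integral_eq_conv:
  assumes k: "causal k" and f: "causal (pullback f)" and x: "x > 0"
    and eq: "\<And>y. y > 0 \<Longrightarrow> k y = of_real y powr (of_nat m - \<alpha> - 1) * power_series b (of_real y powr \<beta>)"
  shows "gen_integral \<phi> \<alpha> \<beta> m b f x = conv k (pullback f) (\<phi> x)"
  unfolding gen_integral_def
proof (rule integral_unique, rule has_integral_eq[OF _ has_integral_conv[OF k f x]])
  fix t assume "t \<in> {0..x}"
  hence "\<phi> t \<le> \<phi> x" by (intro mono) auto
  thus "of_real (dhl \<phi> t) * k (\<phi> x - \<phi> t) * f t =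
     of_real (dhl \<phi> t) * of_real (\<phi> x - \<phi> t) powr (of_nat m - \<alpha> - 1) *
       power_series b (of_real (\<phi> x - \<phi> t) powr \<beta>) * f t"
    using eq[of "\<phi> x - \<phi> t"] causal_eq_0[OF k, of 0] by (cases "\<phi> t = \<phi> x") auto
qed

lemma laplace_has_integral:
  assumes f: "causal (pullback f)" and s: "lap_integrable (pullback f) s"
  shows "(laplace_integrand \<phi> f s has_integral lap (pullback f) s) {0..}"
proof -
  note c = causal_exp_mult[OF f s]
  have "(laplace_integrand \<phi> f s has_integral lap (pullback f) s - 0) {0..}"
  proof (rule laplace_integrand_has_integral[where F="pullback f"])
    show "(conv (rl_kernel 1) (\<lambda>y. exp (- s * of_real y) * pullback f y) \<longlongrightarrow> lap (pullback f) s) at_top"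
      using conv_rl_kernel_1_at_top[OF c] s by (simp add: lap_def lap_integrable_def)
  qed (use has_vector_derivative_conv_rl_kernel_1[OF c] conv_rl_kernel_1_at_right_0[OF c] pullback_phi in auto)
  thus ?thesis by simp
qed

end

context halfline_diffeo
begin

text \<open>The integer-order derivative m of \<open>RL_I\<close> and the derivative of order
  \<alpha> agree on (0,\<infinity>). The former brings continuity and exponential order, the latter
  its limit at 0; together they make V causal and bounded by an exponential.\<close>

lemma RL_expansion:
  assumes m: "m = RL_deg \<alpha>" and \<alpha>: "Re \<alpha> \<ge> 0" and f: "causal (pullback f)"
    and ex: "RL_D_exists \<phi> (of_nat m) (RL_I \<phi> (of_nat m - \<alpha>) f)"
    and cont: "continuous_on {0<..} (RL_D \<phi> (of_nat m) (RL_I \<phi> (of_nat m - \<alpha>) f))"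
    and ord: "phi_exponential_order \<phi> (RL_D \<phi> (of_nat m) (RL_I \<phi> (of_nat m - \<alpha>) f))"
    and lim: "(RL_D \<phi> \<alpha> f \<longlongrightarrow> l) (at_right 0)"
  obtains a V M c where "causal V" "c > 0" "\<And>y. y > 0 \<Longrightarrow> norm (V y) \<le> M * exp (c * y)"
    "\<And>y. y > 0 \<Longrightarrow> conv (rl_kernel (of_nat m - \<alpha>)) (pullback f) y = expansion m a V 0 0 y"
proof -
  define w where "w = conv (rl_kernel (of_nat m - \<alpha>)) (pullback f)"
  define R where "R = RL_I \<phi> (of_nat m - \<alpha>) f"
  \<comment> \<open>For the integer order m, \<open>RL_deg\<close> is \<open>Suc m\<close>, so
    \<open>RL_D\<close> starts from the integral of order 1 and its first derivative merely restores
    R.\<close>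
  define h where "h = RL_integral \<phi> 1 R"
  have m_eq: "real m = real_of_int \<lfloor>Re \<alpha>\<rfloor> + 1" using \<alpha> by (simp add: m RL_deg_def)
  have m0: "m > 0" using \<alpha> by (simp add: m RL_deg_def)
  have \<mu>: "Re (of_nat m - \<alpha>) > 0" using m_eq by (simp add: floor_less_cancel)
  have cw: "causal w" unfolding w_def by (intro causal_conv causal_rl_kernel \<mu> f)
  have R: "R x = w (\<phi> x)" if "x > 0" for x
    using \<mu> RL_integral_eq_conv[OF \<mu> f that] by (simp add: R_def RL_I_def w_def)
  have pR: "pullback R = w"
    using R psi_pos by (auto simp: fun_eq_iff pullback_def phi_psi causal_eq_0[OF cw])
  have h: "h x = conv (rl_kernel 1) w (\<phi> x)" if "x > 0" for x
    unfolding h_def using RL_integral_eq_conv[of 1 R x] cw that by (simp add: pR)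
  have deg: "RL_deg (of_nat m) = Suc m" by (simp add: RL_deg_def)
  have dex: "dphi_exists (Suc m) \<phi> h"
    using ex by (simp add: RL_D_exists_def deg h_def R_def[symmetric])
  \<comment> \<open>The \<open>Suc\<close> skips the restoring derivative: \<open>W j\<close> is the
    j-th derivative of w.\<close>
  define W where "W j y = (dphi \<phi> ^^ Suc j) h (\<psi> y)" for j y
  have W': "(W j has_vector_derivative W (Suc j) y) (at y)" if "j < m" "y > 0" for j y
    using dphi_exists_derivative[OF dex, of "Suc j" y] that by (simp add: W_def[abs_def])
  have W0: "W 0 y = w y" if y: "y > 0" for y
  proof -
    have "((\<lambda>y. h (\<psi> y)) has_vector_derivative W 0 y) (at y)"
      using dphi_exists_derivative[OF dex, of 0 y] y by (simp add: W_def)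
    hence "(conv (rl_kernel 1) w has_vector_derivative W 0 y) (at y)"
      by (rule has_vector_derivative_transform_within_open[where S="{0<..}"])
         (use y h psi_pos in \<open>auto simp: phi_psi\<close>)
    thus ?thesis using has_vector_derivative_conv_rl_kernel_1[OF cw y] vector_derivative_unique_at by blast
  qed
  define D where "D = RL_D \<phi> (of_nat m) R"
  have D: "D x = W m (\<phi> x)" if "x > 0" for x
    using that by (simp add: D_def RL_D_def deg W_def psi_phi h_def)
  have D\<alpha>: "RL_D \<phi> \<alpha> f x = W m (\<phi> x)" if x: "x > 0" for x
    unfolding RL_D_def m[symmetric]
  proof (rule dphi_funpow[where F=W, OF W' _ x])
    show "RL_integral \<phi> (of_nat m - \<alpha>) f t = W 0 (\<phi> t)" if "t > 0" for t
      using RL_integral_eq_conv[OF \<mu> f that] W0[OF pos[OF that]] by (simp add: w_def)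
  qed
  define V where "V = pullback D"
  have V_eq: "V y = W m y" if "y > 0" for y
    using D[OF psi_pos[OF that]] that by (simp add: V_def pullback_def phi_psi)
  have cV: "continuous_on {0<..} V"
    unfolding V_def using cont by (intro continuous_on_pullback) (simp add: D_def R_def)
  have lV: "(V \<longlongrightarrow> l) (at_right 0)"
    by (rule tendsto_pullback[OF lim]) (use D\<alpha> V_eq pos in auto)
  obtain c M0 Y where c: "c > 0" "M0 > 0" "\<And>y. y > Y \<Longrightarrow> norm (V y) \<le> M0 * exp (c * y)"
    using exp_order_pullback[of D] ord unfolding V_def D_def R_def by metis
  obtain M where M: "M > 0" "\<And>y. y > 0 \<Longrightarrow> norm (V y) \<le> M * exp (c * y)"
    using exp_order_globalI[OF cV lV c(3) c(1,2)] by blast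
  have V0: "V y = 0" if "y \<le> 0" for y using that by (simp add: V_def pullback_def)
  \<comment> \<open>One more than the growth rate leaves the weight \<open>exp (- y)\<close>, which
    is integrable on the half-line.\<close>
  have "lap_integrable V (of_real (c + 1))"
    unfolding lap_integrable_def
  proof (rule Bochner_Integration.integrable_bound)
    have "lap_integrable (rl_kernel 1) 1" by (intro lap_integrable_rl_kernel) auto
    thus "integrable lborel (\<lambda>y. M * norm (exp (- 1 * of_real y) * rl_kernel 1 y))"
      unfolding lap_integrable_def by (intro integrable_mult_right integrable_norm)
    show "AE y in lborel. norm (exp (- of_real (c + 1) * of_real y) * V y) \<le>
        norm (M * norm (exp (- 1 * of_real y) * rl_kernel 1 y))"
    proof (rule AE_I2)
      fix y
      show "norm (exp (- of_real (c + 1) * of_real y) * V y) \<le> norm (M * norm (exp (- 1 * of_real y) * rl_kernel 1 y))"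
      proof (cases "y > 0")
        case True
        have "exp (- (c + 1) * y) * norm (V y) \<le> exp (- (c + 1) * y) * (M * exp (c * y))"
          by (intro mult_left_mono M True) auto
        also have "\<dots> = M * exp (- y)" by (simp add: algebra_simps flip: exp_add)
        finally show ?thesis using True M(1) by (simp add: norm_mult rl_kernel_def abs_mult)
      qed (simp add: V0)
    qed
    have "V \<in> borel_measurable borel" by (rule measurable_continuous_on_halfline[OF V0 cV])
    thus "(\<lambda>y. exp (- of_real (c + 1) * of_real y) * V y) \<in> borel_measurable lborel" by measurable
  qed
  hence causV: "causal V" using V0 cV by (intro causalI_lap_integrable[where f=V])
  obtain a where a: "\<And>y. y > 0 \<Longrightarrow> W 0 y = (\<Sum>l<m. a l * rl_kernel (of_nat l + 1) y) + conv (rl_kernel (of_nat m)) V y"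
    using taylor_causal[of m W V] m0 W' causV V_eq by metis
  show ?thesis
  proof (rule that[OF causV c(1) M(2)])
    fix y :: real assume "y > 0"
    thus "conv (rl_kernel (of_nat m - \<alpha>)) (pullback f) y = expansion m a V 0 0 y"
      using a[of y] W0[of y] m0 by (simp add: w_def expansion_def)
  qed
qed

text \<open>For \<open>i = 0\<close> the order has positive real part and \<open>RL_I\<close> is an
  integral. For \<open>i \<ge> 1\<close> the real part of the negated order lies in
  \<open>[i - 1, i)\<close>, so \<open>RL_deg\<close> is i, and \<open>RL_I\<close> is the i-th
  derivative of that same integral of order \<open>N + 1 - \<gamma>\<close>.\<close>

lemma RL_I_eq_expansion:
  fixes N i :: nat
  assumes f: "causal (pullback f)" and V: "causal V" and z: "Re z > 0 \<or> z = 0"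
    and E0: "\<And>y. y > 0 \<Longrightarrow> conv (rl_kernel (of_nat m - \<gamma>)) (pullback f) y = expansion m a V z 0 y"
    and N: "real N \<le> Re \<gamma>" "Re \<gamma> < real N + 1" "N < m" and i: "i \<le> N" and x: "x > 0"
  shows "RL_I \<phi> (of_nat N - of_nat i + 1 - \<gamma>) f x = expansion m a V z (m - Suc N + i) (\<phi> x)"
proof -
  let ?\<mu> = "of_nat N - of_nat i + 1 - \<gamma>" and ?\<nu> = "of_nat N + 1 - \<gamma>"
  have \<nu>: "Re ?\<nu> > 0" using N by simp
  have \<nu>_eq: "of_nat m - \<gamma> - of_nat (m - Suc N) = ?\<nu>" using N by (simp add: of_nat_diff)
  have base: "RL_integral \<phi> ?\<nu> f t = expansion m a V z (m - Suc N) (\<phi> t)" if t: "t > 0" for t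
  proof -
    have "real (m - Suc N) < real m - Re \<gamma>" using N by (simp add: of_nat_diff)
    from conv_rl_kernel_eq_expansion[OF f V z E0 this pos[OF t]]
    show ?thesis using RL_integral_eq_conv[OF \<nu> f t] unfolding \<nu>_eq by simp
  qed
  show ?thesis
  proof (cases "i = 0")
    case True
    thus ?thesis using base[OF x] \<nu> by (simp add: RL_I_def)
  next
    case False
    have "Re ?\<mu> \<le> 0" using N False by simp
    moreover have "\<lfloor>Re (- ?\<mu>)\<rfloor> = int i - 1" using N by (intro floor_unique) auto
    hence deg: "RL_deg (- ?\<mu>) = i" by (simp add: RL_deg_def)
    have "(dphi \<phi> ^^ i) (RL_integral \<phi> ?\<nu> f) x = expansion m a V z (m - Suc N + i) (\<phi> x)"
    proof (rule dphi_funpow[where F="\<lambda>i. expansion m a V z (m - Suc N + i)"])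
      fix j y assume "j < i" "(y::real) > 0"
      thus "(expansion m a V z (m - Suc N + j) has_vector_derivative expansion m a V z (m - Suc N + Suc j) y) (at y)"
        using has_vector_derivative_expansion[OF V z, of "m - Suc N + j" m y a] N i by simp
    qed (use base x in auto)
    moreover have "of_nat i - - ?\<mu> = ?\<nu>" by simp
    ultimately show ?thesis unfolding RL_I_def RL_D_def deg by simp
  qed
qed

end

text \<open>The terms of a convergent power series are bounded at any point inside its disc; a point
  near 0 already gives the geometric growth that the tail series tolerates.\<close>

lemma Gamma_coeff_bound:
  assumes "conv_radius (Gamma_coeff \<beta> \<gamma> b) > 0"
  obtains C \<rho> where "\<rho> > 0" "\<And>n. norm (b n * Gamma (\<beta> * of_nat n + \<gamma>)) \<le> C * \<rho> ^ n"
proof -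
  obtain r where r: "0 < ereal r" "ereal r < conv_radius (Gamma_coeff \<beta> \<gamma> b)"
    using ereal_dense2[OF assms] by auto
  have "summable (\<lambda>n. norm (Gamma_coeff \<beta> \<gamma> b n * of_real r ^ n))"
    using r by (intro abs_summable_in_conv_radius) auto
  hence "bounded (range (\<lambda>n. norm (Gamma_coeff \<beta> \<gamma> b n * of_real r ^ n)))"
    by (intro convergent_imp_bounded) (auto dest: summable_LIMSEQ_zero)
  then obtain C where C: "\<And>n. norm (Gamma_coeff \<beta> \<gamma> b n * of_real r ^ n) \<le> C"
    by (auto simp: bounded_iff)
  show ?thesis
  proof (rule that)
    show "1 / r > 0" using r by simp
    show "norm (b n * Gamma (\<beta> * of_nat n + \<gamma>)) \<le> C * (1 / r) ^ n" for n
      using C[of n] r by (simp add: Gamma_coeff_def norm_mult norm_power power_one_over field_simps)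
  qed
qed

section \<open>Assembly of the transform from the head and the tail of the kernel\<close>

theorem theorem5p4:
  fixes \<alpha> \<beta> :: complex and m :: nat and \<phi> u :: "real \<Rightarrow> real"
    and a abar :: "nat \<Rightarrow> complex" and U :: "real \<Rightarrow> complex" and N :: "nat \<Rightarrow> int"
  assumes alpha: "Re \<alpha> \<ge> 0" and beta: "Re \<beta> > 0"
    and m: "m = nat (\<lfloor>Re \<alpha>\<rfloor> + 1)"
    and phi_nonneg: "\<And>x. x \<ge> 0 \<Longrightarrow> \<phi> x \<ge> 0"
    and phi_mono: "mono_on {0..} \<phi>"
    and phi_C_m: "C_k_halfline m \<phi>"
    and phi_0: "\<phi> 0 = 0"
    and phi_deriv: "\<And>x. x \<ge> 0 \<Longrightarrow> dhl \<phi> x > 0"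
    and phi_unbounded: "filterlim \<phi> at_top at_top"
    and A_radius: "\<And>b. b > 0 \<Longrightarrow> ereal (b powr Re \<beta>) < conv_radius a"
    and Abar_radius: "\<And>b. b > 0 \<Longrightarrow> ereal (b powr Re \<beta>) < conv_radius abar"
    and reciprocal: "Gamma_reciprocal \<alpha> \<beta> m a abar"
    and U: "U = (\<lambda>x. complex_of_real (u x))"
    and u_L1: "\<And>b. b > 0 \<Longrightarrow> u absolutely_integrable_on {0..b}"
    and D_exists: "gen_D_exists \<phi> \<alpha> \<beta> m abar U"
    and u_cont: "continuous_on {0<..} U"
    and u_exp: "phi_exponential_order \<phi> U"
    and I_cont: "continuous_on {0<..} (RL_I \<phi> (of_nat m - \<alpha>) U)"
    and I_exp: "phi_exponential_order \<phi> (RL_I \<phi> (of_nat m - \<alpha>) U)"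
    and DI_exists: "\<And>j. j \<in> {1..m} \<Longrightarrow>
          RL_D_exists \<phi> (of_nat j) (RL_I \<phi> (of_nat m - \<alpha>) U)"
    and DI_cont: "\<And>j. j \<in> {1..m} \<Longrightarrow>
          continuous_on {0<..} (RL_D \<phi> (of_nat j) (RL_I \<phi> (of_nat m - \<alpha>) U))"
    and DI_exp: "\<And>j. j \<in> {1..m} \<Longrightarrow>
          phi_exponential_order \<phi> (RL_D \<phi> (of_nat j) (RL_I \<phi> (of_nat m - \<alpha>) U))"
    and D_alpha_pc: "piecewise_continuous_halfline (RL_D \<phi> \<alpha> U)"
    and N: "N = (\<lambda>n. \<lfloor>Re (\<alpha> - \<beta> * of_nat n)\<rfloor>)"
    and values_at_0: "\<And>n i. n \<le> nat \<lfloor>Re \<alpha> / Re \<beta>\<rfloor> \<Longrightarrow> abar n \<noteq> 0 \<Longrightarrow> i \<le> nat (N n) \<Longrightarrow>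
          has_value_at_0 (RL_I \<phi> (of_int (N n) - of_nat i + \<beta> * of_nat n - \<alpha> + 1) U)"
  shows "\<exists>\<sigma>. \<forall>s. Re s > \<sigma> \<longrightarrow>
      laplace_converges \<phi> U s \<and>
      laplace_converges \<phi> (gen_D \<phi> \<alpha> \<beta> m abar U) s \<and>
      summable (\<lambda>n. abar n * Gamma (\<beta> * of_nat n - \<alpha> + of_nat m) *
                    s powr (\<alpha> - \<beta> * of_nat n) * laplace \<phi> U s) \<and>
      laplace \<phi> (gen_D \<phi> \<alpha> \<beta> m abar U) s =
        (\<Sum>n. abar n * Gamma (\<beta> * of_nat n - \<alpha> + of_nat m) *
              s powr (\<alpha> - \<beta> * of_nat n) * laplace \<phi> U s)
        - (\<Sum>n = 0..nat \<lfloor>Re \<alpha> / Re \<beta>\<rfloor>. \<Sum>i = 0..nat (N n).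
             abar n * Gamma (\<beta> * of_nat n - \<alpha> + of_nat m) * s powi (N n - int i) *
             value_at_0 (RL_I \<phi> (of_int (N n) - of_nat i + \<beta> * of_nat n - \<alpha> + 1) U))"
proof -
  have m0: "m > 0" using alpha m by simp
  have m_deg: "m = RL_deg \<alpha>" by (simp add: m RL_deg_def)
  have m_eq: "real m = real_of_int \<lfloor>Re \<alpha>\<rfloor> + 1" using alpha m by simp
  have m_gt: "real m > Re \<alpha>" unfolding m_eq by linarith
  interpret halfline_diffeo \<phi>
  proof
    have "\<phi> differentiable (at x within {0..})" if "x \<ge> 0" for x
      using phi_C_m m0 that unfolding C_k_halfline_def by (metis funpow_0)
    thus "(\<phi> has_real_derivative dhl \<phi> x) (at x within {0..})" if "x \<ge> 0" for x
      using that by (simp add: dhl_def vector_derivative_works has_real_derivative_iff_has_vector_derivative)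
    have "continuous_on {0..} ((dhl ^^ 1) \<phi>)" using phi_C_m m0 unfolding C_k_halfline_def by (metis Suc_leI One_nat_def)
    thus "continuous_on {0..} (dhl \<phi>)" by simp
  qed (use phi_deriv phi_0 phi_unbounded in auto)
  define v where "v = pullback U"
  have v: "causal v"
    unfolding v_def
  proof (rule causal_pullback[OF u_cont])
    fix b :: real assume "b > 0"
    from absolutely_integrable_linear[OF u_L1[OF this] bounded_linear_of_real]
    show "U absolutely_integrable_on {0..b}" by (simp add: U o_def)
  qed
  obtain c\<^sub>v M\<^sub>v Y where v_exp: "c\<^sub>v > 0" "\<And>y. y > Y \<Longrightarrow> norm (v y) \<le> M\<^sub>v * exp (c\<^sub>v * y)"
    using exp_order_pullback[OF u_exp] unfolding v_def by metis
  \<comment> \<open>The right-hand limit at 0 that piecewise continuity on \<open>{0..1}\<close>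
    includes.\<close>
  obtain l\<^sub>0 where l0: "(RL_D \<phi> \<alpha> U \<longlongrightarrow> l\<^sub>0) (at_right 0)"
    using D_alpha_pc[unfolded piecewise_continuous_halfline_def, rule_format, of 1] by force
  have m1: "m \<in> {1..m}" using m0 by simp
  obtain t V M c where V: "causal V" and c: "c > 0"
    and V_bound: "\<And>y. y > 0 \<Longrightarrow> norm (V y) \<le> M * exp (c * y)"
    and w_eq: "\<And>y. y > 0 \<Longrightarrow> conv (rl_kernel (of_nat m - \<alpha>)) v y = expansion m t V 0 0 y"
    using RL_expansion[OF m_deg alpha v[unfolded v_def] DI_exists[OF m1] DI_cont[OF m1] DI_exp[OF m1] l0]
    unfolding v_def by metis
  \<comment> \<open>By \<open>E0\<close> and \<open>E'\<close>, \<open>E n j\<close> is the j-th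
    derivative of v convolved with the kernel of index \<open>m - \<gamma> n\<close>. One expansion,
    obtained at \<open>n = 0\<close>, serves all n.\<close>
  define E where "E n = expansion m t V (\<beta> * of_nat n)" for n
  \<comment> \<open>The last n with \<open>Re (\<gamma> n) \<ge> 0\<close>. From
    \<open>Suc K\<close> on, the index \<open>- \<gamma> n\<close> left after m derivatives has
    positive real part; the first of these is \<open>z\<^sub>0\<close>.\<close>
  define K where "K = nat \<lfloor>Re \<alpha> / Re \<beta>\<rfloor>"
  define \<gamma> where "\<gamma> n = \<alpha> - \<beta> * of_nat n" for n
  define C where "C n = abar n * Gamma (\<beta> * of_nat n - \<alpha> + of_nat m)" for n
  have bz: "Re (\<beta> * of_nat n) > 0 \<or> \<beta> * of_nat n = 0" for n using beta by (cases "n = 0") auto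
  have \<gamma>_pos: "Re (of_nat m - \<gamma> n) > 0" for n
  proof -
    have "Re \<beta> * real n \<ge> 0" using beta by simp
    thus ?thesis using m_gt by (simp add: \<gamma>_def)
  qed
  have \<alpha>_pos: "Re (of_nat m - \<alpha>) > 0" using m_gt by simp
  have E0: "conv (rl_kernel (of_nat m - \<gamma> n)) v y = E n 0 y" if "y > 0" for n y
  proof (cases "n = 0")
    case True
    thus ?thesis using w_eq[OF that] by (simp add: E_def \<gamma>_def)
  next
    case False
    hence z: "Re (\<beta> * of_nat n) > 0" using beta by simp
    have "conv (rl_kernel (of_nat m - \<gamma> n)) v = conv (rl_kernel (\<beta> * of_nat n)) (conv (rl_kernel (of_nat m - \<alpha>)) v)"
      using conv_rl_kernel_conv_rl_kernel[OF z \<alpha>_pos v] by (simp add: \<gamma>_def algebra_simps)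
    thus ?thesis
      using expansion_0[OF V causal_conv[OF causal_rl_kernel[OF \<alpha>_pos] v] z m0 w_eq, of y] by (simp add: E_def)
  qed
  have E': "(E n j has_vector_derivative E n (Suc j) y) (at y)" if "j < m" "y > 0" for n j y
    unfolding E_def by (rule has_vector_derivative_expansion[OF V bz that])
  have K_eq: "real K = real_of_int \<lfloor>Re \<alpha> / Re \<beta>\<rfloor>" using alpha beta by (simp add: K_def)
  have N_nat: "N n \<ge> 0" "real (nat (N n)) \<le> Re (\<gamma> n)" "Re (\<gamma> n) < real (nat (N n)) + 1" "nat (N n) < m"
    if "n \<le> K" for n
  proof -
    have "real n \<le> Re \<alpha> / Re \<beta>" using that K_eq by linarith
    hence g: "Re (\<gamma> n) \<ge> 0" using beta by (simp add: \<gamma>_def field_simps)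
    thus N0: "N n \<ge> 0" by (simp add: N \<gamma>_def)
    thus "real (nat (N n)) \<le> Re (\<gamma> n)" "Re (\<gamma> n) < real (nat (N n)) + 1" by (simp_all add: N \<gamma>_def)
    hence "real (nat (N n)) < real m" using \<gamma>_pos[of n] by simp
    thus "nat (N n) < m" by simp
  qed
  define z\<^sub>0 where "z\<^sub>0 = \<beta> * of_nat (Suc K) - \<alpha>"
  have z0: "Re z\<^sub>0 > 0"
  proof -
    have "Re \<alpha> / Re \<beta> < real (Suc K)" unfolding of_nat_Suc K_eq by linarith
    thus ?thesis using beta by (simp add: z\<^sub>0_def field_simps)
  qed
  have C_eq: "C n = abar n * Gamma (\<beta> * of_nat n + (of_nat m - \<alpha>))" for n
    by (simp add: C_def algebra_simps)
  have "conv_radius (Gamma_coeff \<beta> (of_nat m - \<alpha>) abar) > 0"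
    using reciprocal unfolding Gamma_reciprocal_def by blast
  from Gamma_coeff_bound[OF this]
  obtain \<rho> B where \<rho>: "\<rho> > 0" "\<And>n. norm (C n) \<le> B * \<rho> ^ n"
    unfolding C_eq by blast
  define d where "d n = C (n + Suc K)" for n
  have d: "norm (d n) \<le> (B * \<rho> ^ Suc K) * \<rho> ^ n" for n
    using \<rho>(2)[of "n + Suc K"] by (simp add: d_def power_add mult_ac)
  obtain \<sigma> where "rl_kernel_series d (\<lambda>n. \<beta> * of_nat n + z\<^sub>0) \<sigma>"
    using rl_kernel_series_exists[OF beta z0 d \<rho>(1)] by blast
  \<comment> \<open>Here \<open>kernel\<close> is the tail of the generalised kernel with all m
    derivatives already applied; convolution with the kernel of index m restores the tail
    itself.\<close>
  then interpret rl_kernel_series d "\<lambda>n. \<beta> * of_nat n + z\<^sub>0" \<sigma> .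
  have zd: "\<beta> * of_nat n + z\<^sub>0 = - \<gamma> (n + Suc K)" for n
    by (simp add: z\<^sub>0_def \<gamma>_def algebra_simps)
  define H where "H = conv kernel v"
  have H: "causal H" unfolding H_def by (intro causal_conv causal_kernel v)

  define k where "k y = (\<Sum>n\<le>K. C n * rl_kernel (of_nat m - \<gamma> n) y) + conv (rl_kernel (of_nat m)) kernel y" for y
  have ck1: "causal (\<lambda>y. \<Sum>n\<le>K. C n * rl_kernel (of_nat m - \<gamma> n) y)"
    by (intro causal_sum causal_mult causal_rl_kernel \<gamma>_pos)
  have ck2: "causal (conv (rl_kernel (of_nat m)) kernel)"
    using m0 by (intro causal_conv causal_kernel causal_rl_kernel) auto
  have ck: "causal k" unfolding k_def by (intro causal_add ck1 ck2)
  have k_eq: "k y = of_real y powr (of_nat m - \<alpha> - 1) * power_series abar (of_real y powr \<beta>)" if y: "y > 0" for y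
  proof -
    \<comment> \<open>The Gamma factor in \<open>C n\<close> cancels the \<open>rGamma\<close> in
      the kernel, so the powers of y in the generalised integral become Riemann-Liouville
      kernels.\<close>
    have term_eq: "of_real y powr (of_nat m - \<alpha> - 1) * (abar n * (of_real y powr \<beta>) ^ n) = C n * rl_kernel (of_nat m - \<gamma> n) y" for n
    proof -
      have "of_real y powr (of_nat m - \<alpha> - 1) * (complex_of_real y powr \<beta>) ^ n = of_real y powr (of_nat m - \<gamma> n - 1)"
        using y by (simp add: \<gamma>_def powr_def exp_add[symmetric] exp_of_nat_mult[symmetric] algebra_simps)
      moreover have "Gamma (of_nat m - \<gamma> n) * rGamma (of_nat m - \<gamma> n) = 1"
        by (rule Gamma_times_rGamma[OF \<gamma>_pos])
      moreover have "C n = abar n * Gamma (of_nat m - \<gamma> n)" by (simp add: C_def \<gamma>_def algebra_simps)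
      ultimately show ?thesis using y by (simp add: rl_kernel_def)
    qed
    have "ereal (norm (complex_of_real y powr \<beta>)) < conv_radius abar"
      using Abar_radius[OF y] y by (simp add: norm_powr_real_powr)
    hence "summable (\<lambda>n. abar n * (of_real y powr \<beta>) ^ n)" by (rule summable_in_conv_radius)
    hence "(\<lambda>n. abar n * (of_real y powr \<beta>) ^ n) sums power_series abar (of_real y powr \<beta>)"
      unfolding power_series_def by (rule summable_sums)
    from sums_mult[OF this, of "of_real y powr (of_nat m - \<alpha> - 1)"]
    have s1: "(\<lambda>n. C n * rl_kernel (of_nat m - \<gamma> n) y) sums
        (of_real y powr (of_nat m - \<alpha> - 1) * power_series abar (of_real y powr \<beta>))"
      unfolding term_eq .
    have "(\<lambda>n. C (n + Suc K) * rl_kernel (of_nat m - \<gamma> (n + Suc K)) y) sums conv (rl_kernel (of_nat m)) kernel y"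
      using conv_rl_kernel_kernel[of "of_nat m" y] m0 y by (simp add: zd d_def)
    hence "(\<lambda>n. C n * rl_kernel (of_nat m - \<gamma> n) y) sums (conv (rl_kernel (of_nat m)) kernel y + (\<Sum>n<Suc K. C n * rl_kernel (of_nat m - \<gamma> n) y))"
      by (subst (asm) sums_iff_shift)
    with s1 show ?thesis unfolding k_def lessThan_Suc_atMost by (simp add: sums_unique2 add.commute)
  qed
  \<comment> \<open>\<open>F j\<close> is the j-th derivative of the generalised integral in y. At
    \<open>j = m\<close> the remaining index is 0, and H has to appear without a
    convolution.\<close>
  define F where "F j y = (\<Sum>n\<le>K. C n * E n j y) + (if j = m then H y else conv (rl_kernel (of_nat m - of_nat j)) H y)" for j y
  have F0: "gen_integral \<phi> \<alpha> \<beta> m abar U x = F 0 (\<phi> x)" if x: "x > 0" for x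
  proof -
    have "gen_integral \<phi> \<alpha> \<beta> m abar U x = conv k v (\<phi> x)"
      unfolding v_def using gen_integral_eq_conv[OF ck v[unfolded v_def] x k_eq] .
    also have "conv k v = (\<lambda>y. conv (\<lambda>y. \<Sum>n\<le>K. C n * rl_kernel (of_nat m - \<gamma> n) y) v y + conv (conv (rl_kernel (of_nat m)) kernel) v y)"
      unfolding k_def by (rule conv_add_left[OF ck1 ck2 v])
    also have "conv (\<lambda>y. \<Sum>n\<le>K. C n * rl_kernel (of_nat m - \<gamma> n) y) v = (\<lambda>y. \<Sum>n\<le>K. C n * conv (rl_kernel (of_nat m - \<gamma> n)) v y)"
      by (subst conv_sum_left[OF v]) (auto intro!: causal_mult causal_rl_kernel \<gamma>_pos simp: conv_mult_left)
    also have "conv (conv (rl_kernel (of_nat m)) kernel) v = conv (rl_kernel (of_nat m)) H"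
      unfolding H_def using m0 by (intro conv_assoc[symmetric] causal_rl_kernel causal_kernel v) auto
    finally show ?thesis using E0[OF pos[OF x]] m0 by (simp add: F_def)
  qed
  have F': "(F j has_vector_derivative F (Suc j) y) (at y)" if j: "j < m" and y: "y > 0" for j y
  proof -
    have 1: "((\<lambda>y. \<Sum>n\<le>K. C n * E n j y) has_vector_derivative (\<Sum>n\<le>K. C n * E n (Suc j) y)) (at y)"
      by (intro has_vector_derivative_sum has_vector_derivative_mult_right E' j y)
    have 2: "(conv (rl_kernel (of_nat m - of_nat j)) H has_vector_derivative
        (if Suc j = m then H y else conv (rl_kernel (of_nat m - of_nat (Suc j))) H y)) (at y)"
    proof (cases "Suc j = m")
      case True
      hence "of_nat m - of_nat j = (1 :: complex)" by auto
      thus ?thesis using has_vector_derivative_conv_rl_kernel_1[OF H y] True by simp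
    next
      case False
      hence "real m > real j + 1" using j by linarith
      hence "Re (of_nat m - of_nat j) > 1" by simp
      from has_vector_derivative_conv_rl_kernel[OF this H y] show ?thesis using False by (simp add: algebra_simps)
    qed
    have "F j = (\<lambda>y. (\<Sum>n\<le>K. C n * E n j y) + conv (rl_kernel (of_nat m - of_nat j)) H y)"
      using j by (auto simp: F_def fun_eq_iff)
    thus ?thesis unfolding F_def[of "Suc j"] using has_vector_derivative_add[OF 1 2] by simp
  qed
  have gen_D_eq: "gen_D \<phi> \<alpha> \<beta> m abar U x = F m (\<phi> x)" if "x > 0" for x
    unfolding gen_D_def by (rule dphi_funpow[where F=F, OF F' F0 that])

  define val where "val n i = value_at_0 (RL_I \<phi> (of_int (N n) - of_nat i + \<beta> * of_nat n - \<alpha> + 1) U)" for n i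
  have val: "(E n (m - Suc (nat (N n)) + i) \<longlongrightarrow> val n i) (at_right 0)"
    if n: "n \<le> K" "abar n \<noteq> 0" and i: "i \<le> nat (N n)" for n i
  proof -
    let ?\<mu> = "of_int (N n) - of_nat i + \<beta> * of_nat n - \<alpha> + 1"
    have "has_value_at_0 (RL_I \<phi> ?\<mu> U)" using values_at_0[of n i] n i by (simp add: K_def)
    then obtain l where l: "(RL_I \<phi> ?\<mu> U \<longlongrightarrow> l) (at_right 0)" by (auto simp: has_value_at_0_def)
    have "val n i = l" unfolding val_def value_at_0_def by (rule tendsto_Lim[OF _ l]) simp
    moreover have "(E n (m - Suc (nat (N n)) + i) \<longlongrightarrow> l) (at_right 0)"
    proof (rule tendsto_pullback[OF l])
      fix x :: real assume x: "x > 0"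
      have "?\<mu> = of_nat (nat (N n)) - of_nat i + 1 - \<gamma> n"
        using N_nat(1)[OF n(1)] by (simp add: \<gamma>_def)
      thus "RL_I \<phi> ?\<mu> U x = E n (m - Suc (nat (N n)) + i) (\<phi> x)"
        unfolding E_def
        using RL_I_eq_expansion[OF v[unfolded v_def] V bz, of m "\<gamma> n" t n] N_nat[OF n(1)] E0 i x
        unfolding E_def v_def by metis
    qed
    ultimately show ?thesis by simp
  qed

  show ?thesis
  \<comment> \<open>\<sigma> is for the tail kernel, c for the boundary terms at infinity, and
    \<open>c\<^sub>v\<close> for the transform of u.\<close>
  proof (intro exI[of _ "Max {\<sigma>, c, c\<^sub>v}"] allI impI)
    fix s assume "Re s > Max {\<sigma>, c, c\<^sub>v}"
    hence s: "Re s > \<sigma>" "Re s > c" "Re s > c\<^sub>v" by auto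
    have vs: "lap_integrable v s" by (rule lap_integrable_exp_order[OF v v_exp(2) s(3)])
    have LU: "(laplace_integrand \<phi> U s has_integral lap v s) {0..}"
      unfolding v_def by (rule laplace_has_integral[OF v[unfolded v_def] vs[unfolded v_def]])
    have lapU: "laplace \<phi> U s = lap v s" unfolding laplace_def by (rule integral_unique[OF LU])
    have "Re s \<ge> \<sigma>" using s by simp
    note ks = lap_integrable_kernel[OF this] lap_kernel[OF this]
    have Hs: "lap_integrable H s" unfolding H_def by (rule lap_integrable_conv[OF ks(1) vs])
    have lapH: "lap H s = lap kernel s * lap v s" unfolding H_def by (rule lap_conv[OF ks(1) vs])
    have "(\<lambda>n. C (n + Suc K) * s powr \<gamma> (n + Suc K)) sums lap kernel s"
      using ks(2) by (simp add: zd d_def)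
    hence ser: "(\<lambda>n. C n * s powr \<gamma> n) sums (lap kernel s + (\<Sum>n<Suc K. C n * s powr \<gamma> n))"
      by (subst (asm) sums_iff_shift)
    have ser': "(\<lambda>n. C n * s powr \<gamma> n * lap v s) sums (lap H s + (\<Sum>n\<le>K. C n * (s powr \<gamma> n * lap v s)))"
      using sums_mult2[OF ser, of "lap v s"]
      by (simp add: lapH distrib_right sum_distrib_right lessThan_Suc_atMost mult.assoc)
    \<comment> \<open>Initial values are assumed only where \<open>abar n\<close> is nonzero, so
      antiderivatives are built for these n; the omitted terms carry the factor
      \<open>C n = 0\<close> and are put back by \<open>sumS\<close>.\<close>
    define S where "S = {n. n \<le> K \<and> abar n \<noteq> 0}"
    have fS: "finite S" by (simp add: S_def)
    have "\<forall>n\<in>S. \<exists>P. (\<forall>y>0. (P has_vector_derivative exp (- s * of_real y) * E n m y) (at y)) \<and>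
        (P \<longlongrightarrow> (\<Sum>i\<le>nat (N n). s ^ (nat (N n) - i) * val n i)) (at_right 0) \<and>
        (P \<longlongrightarrow> s powr \<gamma> n * lap v s) at_top"
    proof
      fix n assume "n \<in> S"
      hence n: "n \<le> K" "abar n \<noteq> 0" by (auto simp: S_def)
      show "\<exists>P. (\<forall>y>0. (P has_vector_derivative exp (- s * of_real y) * E n m y) (at y)) \<and>
        (P \<longlongrightarrow> (\<Sum>i\<le>nat (N n). s ^ (nat (N n) - i) * val n i)) (at_right 0) \<and>
        (P \<longlongrightarrow> s powr \<gamma> n * lap v s) at_top"
        unfolding E_def
        by (rule fractional_antiderivative[OF v V bz E0[of _ n, unfolded E_def] V_bound c s(2) vs
              N_nat(2,3,4)[OF n(1)] val[OF n, unfolded E_def]]) blast+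
    qed
    from bchoice[OF this] obtain P where "\<forall>n\<in>S. (\<forall>y>0. (P n has_vector_derivative exp (- s * of_real y) * E n m y) (at y)) \<and>
        (P n \<longlongrightarrow> (\<Sum>i\<le>nat (N n). s ^ (nat (N n) - i) * val n i)) (at_right 0) \<and>
        (P n \<longlongrightarrow> s powr \<gamma> n * lap v s) at_top" ..
    hence P: "n \<in> S \<Longrightarrow> y > 0 \<Longrightarrow> (P n has_vector_derivative exp (- s * of_real y) * E n m y) (at y)"
      "n \<in> S \<Longrightarrow> (P n \<longlongrightarrow> (\<Sum>i\<le>nat (N n). s ^ (nat (N n) - i) * val n i)) (at_right 0)"
      "n \<in> S \<Longrightarrow> (P n \<longlongrightarrow> s powr \<gamma> n * lap v s) at_top" for n y
      by simp_all
    note ceH = causal_exp_mult[OF H Hs]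
    \<comment> \<open>A primitive of \<open>exp (- s y) * F m y\<close>. Its limits at 0 and at
      infinity produce the double sum of initial values and the series, respectively.\<close>
    define Q where "Q y = (\<Sum>n\<in>S. C n * P n y) + conv (rl_kernel 1) (\<lambda>y. exp (- s * of_real y) * H y) y" for y
    have sumS: "(\<Sum>n\<in>S. C n * g n) = (\<Sum>n\<le>K. C n * g n)" for g :: "nat \<Rightarrow> complex"
      by (rule sum.mono_neutral_left) (auto simp: S_def C_def)
    have "(laplace_integrand \<phi> (gen_D \<phi> \<alpha> \<beta> m abar U) s has_integral
       (((\<Sum>n\<in>S. C n * (s powr \<gamma> n * lap v s)) + lap H s) -
        ((\<Sum>n\<in>S. C n * (\<Sum>i\<le>nat (N n). s ^ (nat (N n) - i) * val n i)) + 0))) {0..}"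
    proof (rule laplace_integrand_has_integral[where P=Q and F="F m"])
      fix y :: real assume y: "y > 0"
      have "(Q has_vector_derivative (\<Sum>n\<in>S. C n * (exp (- s * of_real y) * E n m y)) + exp (- s * of_real y) * H y) (at y)"
        unfolding Q_def
        by (intro has_vector_derivative_add has_vector_derivative_sum has_vector_derivative_mult_right P
             has_vector_derivative_conv_rl_kernel_1 ceH y)
      also have "(\<Sum>n\<in>S. C n * (exp (- s * of_real y) * E n m y)) + exp (- s * of_real y) * H y = exp (- s * of_real y) * F m y"
        by (simp add: sumS F_def distrib_left sum_distrib_left mult_ac)
      finally show "(Q has_vector_derivative exp (- s * of_real y) * F m y) (at y)" .
    next
      show "(Q \<longlongrightarrow> (\<Sum>n\<in>S. C n * (\<Sum>i\<le>nat (N n). s ^ (nat (N n) - i) * val n i)) + 0) (at_right 0)"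
        unfolding Q_def by (intro tendsto_add tendsto_sum tendsto_mult_left P conv_rl_kernel_1_at_right_0 ceH)
      show "(Q \<longlongrightarrow> (\<Sum>n\<in>S. C n * (s powr \<gamma> n * lap v s)) + lap H s) at_top"
        unfolding Q_def lap_def[of H]
        by (intro tendsto_add tendsto_sum tendsto_mult_left P conv_rl_kernel_1_at_top ceH)
           (use Hs in \<open>simp_all add: lap_integrable_def\<close>)
    qed (rule gen_D_eq)
    hence LD: "(laplace_integrand \<phi> (gen_D \<phi> \<alpha> \<beta> m abar U) s has_integral
       ((\<Sum>n. C n * s powr \<gamma> n * lap v s) -
        (\<Sum>n\<le>K. C n * (\<Sum>i\<le>nat (N n). s ^ (nat (N n) - i) * val n i)))) {0..}"
      unfolding sumS using sums_unique[OF ser'] by (simp add: add.commute)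
    have boundary: "(\<Sum>n\<le>K. C n * (\<Sum>i\<le>nat (N n). s ^ (nat (N n) - i) * val n i)) =
      (\<Sum>n = 0..K. \<Sum>i = 0..nat (N n). C n * s powi (N n - int i) * val n i)"
      unfolding atMost_atLeast0 sum_distrib_left
    proof (intro sum.cong refl)
      fix n i assume ni: "n \<in> {0..K}" "i \<in> {0..nat (N n)}"
      \<comment> \<open>The exponent is nonnegative in this range, so \<open>powi\<close> is an
        ordinary power.\<close>
      hence "N n - int i = int (nat (N n) - i)" using N_nat(1)[of n] by auto
      thus "C n * (s ^ (nat (N n) - i) * val n i) = C n * s powi (N n - int i) * val n i"
        by (simp only: power_int_of_nat mult.assoc)
    qed
    show "laplace_converges \<phi> U s \<and>
      laplace_converges \<phi> (gen_D \<phi> \<alpha> \<beta> m abar U) s \<and>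
      summable (\<lambda>n. abar n * Gamma (\<beta> * of_nat n - \<alpha> + of_nat m) *
                    s powr (\<alpha> - \<beta> * of_nat n) * laplace \<phi> U s) \<and>
      laplace \<phi> (gen_D \<phi> \<alpha> \<beta> m abar U) s =
        (\<Sum>n. abar n * Gamma (\<beta> * of_nat n - \<alpha> + of_nat m) *
              s powr (\<alpha> - \<beta> * of_nat n) * laplace \<phi> U s)
        - (\<Sum>n = 0..nat \<lfloor>Re \<alpha> / Re \<beta>\<rfloor>. \<Sum>i = 0..nat (N n).
             abar n * Gamma (\<beta> * of_nat n - \<alpha> + of_nat m) * s powi (N n - int i) *
             value_at_0 (RL_I \<phi> (of_int (N n) - of_nat i + \<beta> * of_nat n - \<alpha> + 1) U))"
      unfolding lapU C_def[symmetric] \<gamma>_def[symmetric] K_def[symmetric] val_def[symmetric] boundary[symmetric]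
      using LU LD sums_summable[OF ser'] integral_unique[OF LD]
      by (auto simp: laplace_converges_def laplace_def integrable_on_def)
  qed
qed

end
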